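(* Any subspace $Y$ of an operator space $X$ from the family $\mathfrak{F}$ has a $1$-completely unconditional canonical basis. Any $C$-completely unconditional basis in such a $Y$ is $\phi(C)$-equivalent (up to a permutation) to the canonical basis of $Y$, with $\phi(C)$ polynomial in $C$.
   Context: Row and column spaces: for a Hilbert space $H$, $H_{\mathbf{R}}$ and $H_{\mathbf{C}}$ denote $H$ with its row and column operator space structures; for an orthonormal system $(\xi_i)$ and finitely many matrices $a_i\in M_n$, $\|\sum a_i\otimes\xi_i\|_{M_n(H_{\mathbf{R}})}=\|\sum a_ia_i^*\|^{1/2}$ and $\|\sum a_i\otimes\xi_i\|_{M_n(H_{\mathbf{C}})}=\|\sum a_i^*a_i\|^{1/2}$. $\oplus$ denotes the $\ell_\infty$-direct sum of operator spaces. For a linear map $u$ between operator spaces, $\|u\|_{cb}=\sup_n\|I_{M_n}\otimes u\|$. For a contraction $A\in B(H,K)$ ($H,K$ separable Hilbert spaces), $X(A)=X(H,K,A)$ is the subspace $\{(e,Ae):e\in H\}$ of $H_{\mathbf{R}}\oplus K_{\mathbf{C}}$. The map $\xi\mapsto(\xi,A\xi)$ is an isometry of $H$ onto $X(A)$, and subspaces of $X(A)$ are identified with subspaces of $H$; a (closed) subspace $Y$ of $X(A)$ is then $X(A|_Y)$. $\mathfrak{F}$ is the set of all operator spaces $X(A)$, where $A\in B(\ell_2)$ is a compact contraction which is not Hilbert–Schmidt. Canonical basis: for a compact contraction $A\in B(H,K)$, let $(\xi_i)_{i\in I_1}$ be an orthonormal system of eigenvectors of $|A|=(A^*A)^{1/2}$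 corresponding to its positive eigenvalues (with multiplicity), let $(\xi_i)_{i\in I_0}$ be an orthonormal basis of $\ker A$, and $I=I_0\sqcup I_1$. The canonical basis of $X(A)$ is $e_i=(\xi_i,A\xi_i)$, $i\in I$. The canonical basis of a subspace $Y$ of $X(A)$ is the canonical basis of $X(A|_Y)$. A family $(x_i)$ in an operator space $X$ is a $c$-completely unconditional basic sequence ($c\geq1$) if $\|\sum_i\lambda_ia_i\otimes x_i\|_{M_n(X)}\leq c\|\sum_ia_i\otimes x_i\|_{M_n(X)}$ for all finite sequences of matrices $a_i\in M_n$ and scalars $|\lambda_i|\leq1$; it is a $c$-completely unconditional basis of $X$ if, in addition, its closed linear span is $X$. Families $(x_i)_{i\in I}$ and $(y_i)_{i\in I}$ are $c$-equivalent if there is a linear map $u$ from the closed span of $(x_i)$ onto the closed span of $(y_i)$ with $ux_i=y_i$ and $\|u\|_{cb}\|u^{-1}\|_{cb}\leq c$; they are $c$-equivalent up to a permutation if this holds after re-indexing one of them by a bijection of index sets.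
   Formalization: The C-completely unconditional basis in the second sentence is assumed normalized (all its vectors have norm 1); without this the claim fails, e.g. for the canonical basis (e_j) rescaled to (2^j e_j), which is 1-completely unconditional but not equivalent to the canonical basis. *)

theory Defs
  imports "HOL-Analysis.Analysis" "HOL-Computational_Algebra.Polynomial"
begin

section \<open>Complex vector spaces\<close>

text \<open>Real vector spaces with a compatible complex scalar multiplication; topological notions are
  inherited from the real structure.\<close>

class complex_vector = real_vector +
  fixes scaleC :: "complex \<Rightarrow> 'a \<Rightarrow> 'a"  (infixr \<open>*\<^sub>C\<close> 75)
  assumes scaleC_add_right: "a *\<^sub>C (x + y) = a *\<^sub>C x + a *\<^sub>C y"
    and scaleC_add_left: "(a + b) *\<^sub>C x = a *\<^sub>C x + b *\<^sub>C x"
    and scaleC_scaleC: "a *\<^sub>C b *\<^sub>C x = (a * b) *\<^sub>C x"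
    and scaleC_one: "1 *\<^sub>C x = x"
    and scaleR_scaleC: "scaleR r x = complex_of_real r *\<^sub>C x"

global_interpretation cvec: vector_space "scaleC :: complex \<Rightarrow> 'a \<Rightarrow> 'a::complex_vector"
  by unfold_locales
    (simp_all add: scaleC_add_right scaleC_add_left scaleC_scaleC scaleC_one)

instantiation prod :: (complex_vector, complex_vector) complex_vector
begin

definition scaleC_prod_def: "scaleC c p = (c *\<^sub>C fst p, c *\<^sub>C snd p)"

instance
  by standard
    (simp_all add: scaleC_prod_def prod_eq_iff scaleC_add_right scaleC_add_left scaleC_scaleC
      scaleC_one scaleR_scaleC)

end

definition clinear_on :: "'a::complex_vector set \<Rightarrow> ('a \<Rightarrow> 'b::complex_vector) \<Rightarrow> bool" where
  "clinear_on D u \<longleftrightarrow>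
     (\<forall>x\<in>D. \<forall>y\<in>D. u (x + y) = u x + u y) \<and> (\<forall>c. \<forall>x\<in>D. u (c *\<^sub>C x) = c *\<^sub>C u x)"

definition closed_csubspace :: "'a::{complex_vector, topological_space} set \<Rightarrow> bool" where
  "closed_csubspace D \<longleftrightarrow> cvec.subspace D \<and> closed D"

definition closed_cspan :: "'a::{complex_vector, topological_space} set \<Rightarrow> 'a set" where
  "closed_cspan S = closure (cvec.span S)"


section \<open>The complex Hilbert space \<open>\<ell>\<^sub>2\<close>\<close>

typedef ell2 = "{f :: nat \<Rightarrow> complex. summable (\<lambda>i. (cmod (f i))\<^sup>2)}"
  morphisms coord Abs_ell2
  by (rule exI[of _ "\<lambda>_. 0"]) simp

lemma summable_coord: "summable (\<lambda>i. (cmod (coord x i))\<^sup>2)"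
  using coord[of x] by simp

lemma coord_Abs: "summable (\<lambda>i. (cmod (f i))\<^sup>2) \<Longrightarrow> coord (Abs_ell2 f) = f"
  by (simp add: Abs_ell2_inverse)

lemma ell2_eqI: "(\<And>i. coord x i = coord y i) \<Longrightarrow> x = y"
  by (metis coord_inject ext)

lemma summable_add_sq:
  fixes f g :: "nat \<Rightarrow> complex"
  assumes "summable (\<lambda>i. (cmod (f i))\<^sup>2)" "summable (\<lambda>i. (cmod (g i))\<^sup>2)"
  shows "summable (\<lambda>i. (cmod (f i + g i))\<^sup>2)"
proof (rule summable_comparison_test')
  show "summable (\<lambda>i. 2 * (cmod (f i))\<^sup>2 + 2 * (cmod (g i))\<^sup>2)"
    by (intro summable_add summable_mult assms)
  fix i :: nat assume "i \<ge> 0"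
  have "(cmod (f i + g i))\<^sup>2 \<le> (cmod (f i) + cmod (g i))\<^sup>2"
    by (intro power_mono norm_triangle_ineq) auto
  also have "\<dots> \<le> 2 * (cmod (f i))\<^sup>2 + 2 * (cmod (g i))\<^sup>2"
    using zero_le_power2[of "cmod (f i) - cmod (g i)"]
    by (simp add: power2_eq_square algebra_simps)
  finally show "norm ((cmod (f i + g i))\<^sup>2) \<le> 2 * (cmod (f i))\<^sup>2 + 2 * (cmod (g i))\<^sup>2" by simp
qed

lemma summable_scale_sq:
  fixes f :: "nat \<Rightarrow> complex"
  assumes "summable (\<lambda>i. (cmod (f i))\<^sup>2)"
  shows "summable (\<lambda>i. (cmod (c * f i))\<^sup>2)"
  using summable_mult[OF assms, of "(cmod c)\<^sup>2"] by (simp add: norm_mult power_mult_distrib)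

lemma summable_mult_cnj:
  fixes f g :: "nat \<Rightarrow> complex"
  assumes "summable (\<lambda>i. (cmod (f i))\<^sup>2)" "summable (\<lambda>i. (cmod (g i))\<^sup>2)"
  shows "summable (\<lambda>i. f i * cnj (g i))"
proof (rule summable_norm_cancel, rule summable_comparison_test')
  show "summable (\<lambda>i. (cmod (f i))\<^sup>2 + (cmod (g i))\<^sup>2)"
    by (intro summable_add assms)
  fix i :: nat assume "i \<ge> 0"
  have "2 * (cmod (f i) * cmod (g i)) \<le> (cmod (f i))\<^sup>2 + (cmod (g i))\<^sup>2"
    using zero_le_power2[of "cmod (f i) - cmod (g i)"]
    by (simp add: power2_eq_square algebra_simps)
  moreover have "0 \<le> cmod (f i) * cmod (g i)" by simp
  ultimately have "cmod (f i) * cmod (g i) \<le> (cmod (f i))\<^sup>2 + (cmod (g i))\<^sup>2" by linarith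
  then show "norm (norm (f i * cnj (g i))) \<le> (cmod (f i))\<^sup>2 + (cmod (g i))\<^sup>2"
    by (simp add: norm_mult)
qed

instantiation ell2 :: complex_vector
begin

definition zero_ell2_def: "0 = Abs_ell2 (\<lambda>_. 0)"
definition plus_ell2_def: "x + y = Abs_ell2 (\<lambda>i. coord x i + coord y i)"
definition uminus_ell2_def: "- x = Abs_ell2 (\<lambda>i. - coord x i)"
definition minus_ell2_def: "x - y = Abs_ell2 (\<lambda>i. coord x i - coord y i)"
definition scaleR_ell2_def: "scaleR r x = Abs_ell2 (\<lambda>i. complex_of_real r * coord x i)"
definition scaleC_ell2_def: "scaleC c x = Abs_ell2 (\<lambda>i. c * coord x i)"

lemma coord_zero [simp]: "coord 0 i = 0"
  by (simp add: zero_ell2_def coord_Abs)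

lemma coord_plus [simp]: "coord (x + y) i = coord x i + coord y i"
  by (simp add: plus_ell2_def coord_Abs summable_add_sq summable_coord)

lemma coord_uminus [simp]: "coord (- x) i = - coord x i"
  by (simp add: uminus_ell2_def coord_Abs summable_coord)

lemma coord_minus [simp]: "coord (x - y) i = coord x i - coord y i"
  using summable_add_sq[of "coord x" "\<lambda>i. - coord y i"]
  by (simp add: minus_ell2_def coord_Abs summable_coord)

lemma coord_scaleR [simp]: "coord (scaleR r x) i = complex_of_real r * coord x i"
  using summable_scale_sq[OF summable_coord[of x], of "complex_of_real r"]
  by (simp add: scaleR_ell2_def coord_Abs)

lemma coord_scaleC [simp]: "coord (scaleC c x) i = c * coord x i"
  using summable_scale_sq[OF summable_coord[of x], of c]
  by (simp add: scaleC_ell2_def coord_Abs)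

instance
  by standard (auto intro!: ell2_eqI simp: algebra_simps)

end

text \<open>The inner product is linear in the first and conjugate linear in the second argument.\<close>

definition cinner :: "ell2 \<Rightarrow> ell2 \<Rightarrow> complex" where
  "cinner x y = (\<Sum>i. coord x i * cnj (coord y i))"

lemma summable_cinner: "summable (\<lambda>i. coord x i * cnj (coord y i))"
  by (intro summable_mult_cnj summable_coord)

lemma cinner_add_left: "cinner (x + y) z = cinner x z + cinner y z"
  by (simp add: cinner_def distrib_right suminf_add[OF summable_cinner summable_cinner])

lemma cinner_scaleC_left: "cinner (c *\<^sub>C x) y = c * cinner x y"
  by (simp add: cinner_def mult.assoc suminf_mult[OF summable_cinner])

lemma cinner_commute: "cinner x y = cnj (cinner y x)"
proof -
  have "(\<lambda>i. cnj (coord y i * cnj (coord x i))) sums cnj (cinner y x)"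
    unfolding cinner_def by (intro sums_cnj[THEN iffD2] summable_sums summable_cinner)
  then show ?thesis
    by (simp add: cinner_def sums_iff mult.commute)
qed

lemma cinner_self: "cinner x x = complex_of_real (\<Sum>i. (cmod (coord x i))\<^sup>2)"
  unfolding cinner_def
  by (simp only: complex_norm_square[symmetric] suminf_of_real[OF summable_coord])

instantiation ell2 :: real_inner
begin

definition inner_ell2_def: "inner x y = Re (cinner x y)"
definition norm_ell2_def: "norm (x::ell2) = sqrt (inner x x)"
definition sgn_ell2_def: "sgn (x::ell2) = x /\<^sub>R norm x"
definition dist_ell2_def: "dist (x::ell2) y = norm (x - y)"
definition uniformity_ell2_def [code del]:
  "(uniformity :: (ell2 \<times> ell2) filter) = (INF e\<in>{0<..}. principal {(x, y). dist x y < e})"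
definition open_ell2_def [code del]:
  "open (U :: ell2 set) \<longleftrightarrow> (\<forall>x\<in>U. \<forall>\<^sub>F (x', y) in uniformity. x' = x \<longrightarrow> y \<in> U)"

instance
proof
  fix x y z :: ell2 and r :: real
  show "dist x y = norm (x - y)" by (rule dist_ell2_def)
  show "sgn x = x /\<^sub>R norm x" by (rule sgn_ell2_def)
  show "uniformity = (INF e\<in>{0<..}. principal {(x::ell2, y). dist x y < e})"
    by (rule uniformity_ell2_def)
  show "open U \<longleftrightarrow> (\<forall>x\<in>U. \<forall>\<^sub>F (x', y) in uniformity. x' = x \<longrightarrow> y \<in> U)" for U :: "ell2 set"
    by (rule open_ell2_def)
  show "inner x y = inner y x"
    by (metis inner_ell2_def cinner_commute complex_cnj(1) cnj.simps(1))
  show "inner (x + y) z = inner x z + inner y z"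
    by (simp add: inner_ell2_def cinner_add_left)
  show "inner (scaleR r x) y = r * inner x y"
    by (simp add: inner_ell2_def scaleR_scaleC cinner_scaleC_left)
  have self: "inner x x = (\<Sum>i. (cmod (coord x i))\<^sup>2)"
    by (simp add: inner_ell2_def cinner_self)
  show "0 \<le> inner x x"
    unfolding self by (intro suminf_nonneg summable_coord) simp
  show "inner x x = 0 \<longleftrightarrow> x = 0"
    unfolding self using suminf_eq_zero_iff[OF summable_coord[of x]]
    by (auto intro: ell2_eqI)
  show "norm x = sqrt (inner x x)" by (rule norm_ell2_def)
qed

end

definition unit_ell2 :: "nat \<Rightarrow> ell2" where
  "unit_ell2 k = Abs_ell2 (\<lambda>i. if i = k then 1 else 0)"

definition orthonormal :: "'i set \<Rightarrow> ('i \<Rightarrow> ell2) \<Rightarrow> bool" where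
  "orthonormal I \<xi> \<longleftrightarrow> (\<forall>i\<in>I. \<forall>j\<in>I. cinner (\<xi> i) (\<xi> j) = (if i = j then 1 else 0))"


section \<open>Row and column operator space structures\<close>

text \<open>An element of \<open>M\<^sub>n(V)\<close> is a function \<open>nat \<Rightarrow> nat \<Rightarrow> 'v\<close> of which only the entries with
  both indices below \<open>n\<close> matter.\<close>

definition mat_norm :: "nat \<Rightarrow> (nat \<Rightarrow> nat \<Rightarrow> complex) \<Rightarrow> real" where
  "mat_norm n a =
     (SUP v \<in> {v :: nat \<Rightarrow> complex. L2_set (\<lambda>k. cmod (v k)) {..<n} \<le> 1}.
        L2_set (\<lambda>k. cmod (\<Sum>l<n. a k l * v l)) {..<n})"

definition mat_mult ::
  "nat \<Rightarrow> (nat \<Rightarrow> nat \<Rightarrow> complex) \<Rightarrow> (nat \<Rightarrow> nat \<Rightarrow> complex) \<Rightarrow> nat \<Rightarrow> nat \<Rightarrow> complex" where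
  "mat_mult n a b k l = (\<Sum>m<n. a k m * b m l)"

definition mat_adj :: "(nat \<Rightarrow> nat \<Rightarrow> complex) \<Rightarrow> nat \<Rightarrow> nat \<Rightarrow> complex" where
  "mat_adj a k l = cnj (a l k)"

definition tensor_sum ::
  "'i set \<Rightarrow> ('i \<Rightarrow> nat \<Rightarrow> nat \<Rightarrow> complex) \<Rightarrow> ('i \<Rightarrow> 'v::complex_vector) \<Rightarrow> nat \<Rightarrow> nat \<Rightarrow> 'v" where
  "tensor_sum F a x k l = (\<Sum>i\<in>F. a i k l *\<^sub>C x i)"

text \<open>The norms of \<open>M\<^sub>n(H\<^sub>R)\<close> and \<open>M\<^sub>n(H\<^sub>C)\<close> on arbitrary elements. If
  \<open>z = \<Sum>\<^sub>i a\<^sub>i \<otimes> \<xi>\<^sub>i\<close> with \<open>(\<xi>\<^sub>i)\<close> orthonormal, the matrices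
  of inner products below are \<open>\<Sum>\<^sub>i a\<^sub>i a\<^sub>i\<^sup>*\<close> and \<open>\<Sum>\<^sub>i a\<^sub>i\<^sup>* a\<^sub>i\<close>; see the lemmas
  \<open>row_norm_orthonormal\<close> and \<open>col_norm_orthonormal\<close>.\<close>

definition row_norm :: "nat \<Rightarrow> (nat \<Rightarrow> nat \<Rightarrow> ell2) \<Rightarrow> real" where
  "row_norm n z = sqrt (mat_norm n (\<lambda>k l. \<Sum>m<n. cinner (z k m) (z l m)))"

definition col_norm :: "nat \<Rightarrow> (nat \<Rightarrow> nat \<Rightarrow> ell2) \<Rightarrow> real" where
  "col_norm n z = sqrt (mat_norm n (\<lambda>k l. \<Sum>m<n. cinner (z m l) (z m k)))"

lemma cinner_zero_left [simp]: "cinner 0 y = 0"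
  by (simp add: cinner_def)

lemma cinner_sum_left: "cinner (\<Sum>i\<in>F. f i) y = (\<Sum>i\<in>F. cinner (f i) y)"
  by (induction F rule: infinite_finite_induct) (simp_all add: cinner_add_left)

lemma cinner_sum_right: "cinner x (\<Sum>i\<in>F. f i) = (\<Sum>i\<in>F. cinner x (f i))"
  by (subst cinner_commute, simp add: cinner_sum_left, subst (2) cinner_commute, simp)

lemma cinner_scaleC_right: "cinner x (c *\<^sub>C y) = cnj c * cinner x y"
  by (subst (1 2) cinner_commute) (simp add: cinner_scaleC_left)

lemma cinner_orthonormal_sum:
  assumes "finite F" "orthonormal F \<xi>"
  shows "cinner (\<Sum>i\<in>F. b i *\<^sub>C \<xi> i) (\<Sum>i\<in>F. c i *\<^sub>C \<xi> i) = (\<Sum>i\<in>F. b i * cnj (c i))"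
proof -
  have "cinner (\<Sum>i\<in>F. b i *\<^sub>C \<xi> i) (\<Sum>i\<in>F. c i *\<^sub>C \<xi> i)
      = (\<Sum>i\<in>F. \<Sum>j\<in>F. b i * (cnj (c j) * cinner (\<xi> i) (\<xi> j)))"
    by (simp add: cinner_sum_left) (simp add: cinner_sum_right cinner_scaleC_left
        cinner_scaleC_right sum_distrib_left mult.left_commute)
  also have "\<dots> = (\<Sum>i\<in>F. \<Sum>j\<in>F. if i = j then b i * cnj (c j) else 0)"
    using assms(2) by (intro sum.cong refl) (simp add: orthonormal_def)
  also have "\<dots> = (\<Sum>i\<in>F. b i * cnj (c i))"
    using assms(1) by simp
  finally show ?thesis .
qed

lemma row_norm_orthonormal:
  assumes "finite F" "orthonormal F \<xi>"
  shows "row_norm n (tensor_sum F a \<xi>) =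
    sqrt (mat_norm n (\<lambda>k l. \<Sum>i\<in>F. mat_mult n (a i) (mat_adj (a i)) k l))"
  unfolding row_norm_def tensor_sum_def mat_mult_def mat_adj_def cinner_orthonormal_sum[OF assms]
  by (subst sum.swap) simp

lemma col_norm_orthonormal:
  assumes "finite F" "orthonormal F \<xi>"
  shows "col_norm n (tensor_sum F a \<xi>) =
    sqrt (mat_norm n (\<lambda>k l. \<Sum>i\<in>F. mat_mult n (mat_adj (a i)) (a i) k l))"
  unfolding col_norm_def tensor_sum_def mat_mult_def mat_adj_def cinner_orthonormal_sum[OF assms]
  by (subst sum.swap) (simp add: mult.commute)

text \<open>The norm of \<open>M\<^sub>n(H\<^sub>R \<oplus> K\<^sub>C)\<close>. Every operator space considered below is a linear
  subspace of \<open>H\<^sub>R \<oplus> K\<^sub>C\<close> (with \<open>H = K = \<ell>\<^sub>2\<close>) with the inherited matrix norms. The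
  library norm of the product type is a different but equivalent norm on \<open>H\<^sub>R \<oplus> K\<^sub>C\<close>,
  and is used only through its topology.\<close>

definition rc_norm :: "nat \<Rightarrow> (nat \<Rightarrow> nat \<Rightarrow> ell2 \<times> ell2) \<Rightarrow> real" where
  "rc_norm n z = max (row_norm n (\<lambda>k l. fst (z k l))) (col_norm n (\<lambda>k l. snd (z k l)))"

definition cb_norm :: "(ell2 \<times> ell2) set \<Rightarrow> (ell2 \<times> ell2 \<Rightarrow> ell2 \<times> ell2) \<Rightarrow> ennreal" where
  "cb_norm E u =
     (SUP n. SUP z \<in> {z. (\<forall>k<n. \<forall>l<n. z k l \<in> E) \<and> rc_norm n z \<le> 1}.
        ennreal (rc_norm n (\<lambda>k l. u (z k l))))"


section \<open>Unconditional bases and equivalence\<close>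

definition cu_basic_sequence :: "real \<Rightarrow> 'i set \<Rightarrow> ('i \<Rightarrow> ell2 \<times> ell2) \<Rightarrow> bool" where
  "cu_basic_sequence c I x \<longleftrightarrow> c \<ge> 1 \<and>
     (\<forall>n F (a :: 'i \<Rightarrow> nat \<Rightarrow> nat \<Rightarrow> complex) (t :: 'i \<Rightarrow> complex).
        finite F \<longrightarrow> F \<subseteq> I \<longrightarrow> (\<forall>i\<in>F. cmod (t i) \<le> 1) \<longrightarrow>
        rc_norm n (tensor_sum F (\<lambda>i k l. t i * a i k l) x) \<le> c * rc_norm n (tensor_sum F a x))"

definition cu_basis ::
  "real \<Rightarrow> 'i set \<Rightarrow> ('i \<Rightarrow> ell2 \<times> ell2) \<Rightarrow> (ell2 \<times> ell2) set \<Rightarrow> bool" where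
  "cu_basis c I x Y \<longleftrightarrow> cu_basic_sequence c I x \<and> closed_cspan (x ` I) = Y"

definition normalized :: "'i set \<Rightarrow> ('i \<Rightarrow> ell2 \<times> ell2) \<Rightarrow> bool" where
  "normalized I x \<longleftrightarrow> (\<forall>i\<in>I. rc_norm 1 (\<lambda>_ _. x i) = 1)"

definition equivalent ::
  "real \<Rightarrow> 'i set \<Rightarrow> ('i \<Rightarrow> ell2 \<times> ell2) \<Rightarrow> ('i \<Rightarrow> ell2 \<times> ell2) \<Rightarrow> bool" where
  "equivalent c I x y \<longleftrightarrow>
     (let E = closed_cspan (x ` I); F = closed_cspan (y ` I) in
      \<exists>u. clinear_on E u \<and> bij_betw u E F \<and> (\<forall>i\<in>I. u (x i) = y i) \<and>
          cb_norm E u * cb_norm F (inv_into E u) \<le> ennreal c)"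

definition equivalent_up_to_permutation ::
  "real \<Rightarrow> 'i set \<Rightarrow> ('i \<Rightarrow> ell2 \<times> ell2) \<Rightarrow> 'j set \<Rightarrow> ('j \<Rightarrow> ell2 \<times> ell2) \<Rightarrow> bool" where
  "equivalent_up_to_permutation c I x J y \<longleftrightarrow>
     (\<exists>\<pi>. bij_betw \<pi> I J \<and> equivalent c I x (\<lambda>i. y (\<pi> i)))"


section \<open>The spaces \<open>X(A)\<close>\<close>

text \<open>Operators defined on a closed subspace \<open>D\<close> of \<open>\<ell>\<^sub>2\<close> with values in \<open>\<ell>\<^sub>2\<close>;
  values outside \<open>D\<close> are irrelevant.\<close>

definition compact_contraction_on :: "ell2 set \<Rightarrow> (ell2 \<Rightarrow> ell2) \<Rightarrow> bool" where
  "compact_contraction_on D A \<longleftrightarrow>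
     clinear_on D A \<and> (\<forall>x\<in>D. norm (A x) \<le> norm x) \<and> compact (closure (A ` (D \<inter> cball 0 1)))"

definition hilbert_schmidt :: "(ell2 \<Rightarrow> ell2) \<Rightarrow> bool" where
  "hilbert_schmidt A \<longleftrightarrow> summable (\<lambda>k. (norm (A (unit_ell2 k)))\<^sup>2)"

definition X_space :: "ell2 set \<Rightarrow> (ell2 \<Rightarrow> ell2) \<Rightarrow> (ell2 \<times> ell2) set" where
  "X_space D A = {(e, A e) | e. e \<in> D}"

definition family_F :: "(ell2 \<times> ell2) set set" where
  "family_F = {X_space UNIV A | A. compact_contraction_on UNIV A \<and> \<not> hilbert_schmidt A}"

text \<open>\<open>S\<close> is the adjoint \<open>A\<^sup>* : \<ell>\<^sub>2 \<rightarrow> D\<close> of \<open>A : D \<rightarrow> \<ell>\<^sub>2\<close>.\<close>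

definition is_adjoint :: "ell2 set \<Rightarrow> (ell2 \<Rightarrow> ell2) \<Rightarrow> (ell2 \<Rightarrow> ell2) \<Rightarrow> bool" where
  "is_adjoint D A S \<longleftrightarrow>
     range S \<subseteq> D \<and> (\<forall>x\<in>D. \<forall>y. cinner (A x) y = cinner x (S y))"

text \<open>\<open>B\<close> is \<open>|A|\<close>, the positive square root of \<open>A\<^sup>*A\<close> in \<open>B(D)\<close>.\<close>

definition is_modulus :: "ell2 set \<Rightarrow> (ell2 \<Rightarrow> ell2) \<Rightarrow> (ell2 \<Rightarrow> ell2) \<Rightarrow> bool" where
  "is_modulus D A B \<longleftrightarrow>
     clinear_on D B \<and> B ` D \<subseteq> D \<and> (\<exists>M. \<forall>x\<in>D. norm (B x) \<le> M * norm x) \<and>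
     (\<forall>x\<in>D. cinner (B x) x \<in> \<real> \<and> Re (cinner (B x) x) \<ge> 0) \<and>
     (\<exists>S. is_adjoint D A S \<and> (\<forall>x\<in>D. B (B x) = S (A x)))"

text \<open>The eigenvectors \<open>\<xi> i\<close>, \<open>i \<in> I\<^sub>1\<close>, exhaust the positive eigenvalues with
  multiplicity: those for the eigenvalue \<open>s\<close> span the whole eigenspace, which is finite-dimensional
  by compactness.\<close>

definition is_canonical_system ::
  "ell2 set \<Rightarrow> (ell2 \<Rightarrow> ell2) \<Rightarrow> 'i set \<Rightarrow> ('i \<Rightarrow> ell2) \<Rightarrow> bool" where
  "is_canonical_system D A I \<xi> \<longleftrightarrow>
     (\<exists>B I\<^sub>0 I\<^sub>1. is_modulus D A B \<and> I = I\<^sub>0 \<union> I\<^sub>1 \<and> I\<^sub>0 \<inter> I\<^sub>1 = {} \<and>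
        orthonormal I\<^sub>1 \<xi> \<and> \<xi> ` I\<^sub>1 \<subseteq> D \<and>
        (\<forall>i\<in>I\<^sub>1. \<exists>s::real. s > 0 \<and> B (\<xi> i) = s *\<^sub>R \<xi> i) \<and>
        (\<forall>s::real. s > 0 \<longrightarrow>
           {x\<in>D. B x = s *\<^sub>R x} = cvec.span (\<xi> ` {i\<in>I\<^sub>1. B (\<xi> i) = s *\<^sub>R \<xi> i})) \<and>
        orthonormal I\<^sub>0 \<xi> \<and> closed_cspan (\<xi> ` I\<^sub>0) = {x\<in>D. A x = 0})"

text \<open>A closed subspace of some \<open>X(A)\<close> is \<open>X(A|\<^sub>D)\<close> for a unique closed subspace \<open>D\<close> of
  \<open>\<ell>\<^sub>2\<close> and a unique operator on it.\<close>

definition is_canonical_basis ::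
  "(ell2 \<times> ell2) set \<Rightarrow> 'i set \<Rightarrow> ('i \<Rightarrow> ell2 \<times> ell2) \<Rightarrow> bool" where
  "is_canonical_basis Y I e \<longleftrightarrow>
     (\<exists>D A \<xi>. closed_csubspace D \<and> compact_contraction_on D A \<and> Y = X_space D A \<and>
        is_canonical_system D A I \<xi> \<and> (\<forall>i\<in>I. e i = (\<xi> i, A (\<xi> i))))"

end

theory Submission
  imports Defs
begin

text \<open>Let \<open>Y = X(A|\<^sub>D)\<close> and let \<open>x\<^sub>j = (f\<^sub>j, A f\<^sub>j)\<close> be a normalized \<open>C\<close>-completely unconditional basis of \<open>Y\<close>,
  with \<open>t\<^sub>j = \<parallel>A f\<^sub>j\<parallel>\<close>. Averaging over signs shows that \<open>(f\<^sub>j)\<close> is a Riesz basis of \<open>D\<close>. Testing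
  unconditionality on matrices supported in one column and averaging again compares
  \<open>\<Sum>\<^sub>m \<parallel>\<Sum>\<^sub>j c\<^sub>m\<^sub>j A f\<^sub>j\<parallel>\<^sup>2\<close> with \<open>\<Sum>\<^sub>m \<Sum>\<^sub>j t\<^sub>j\<^sup>2 |c\<^sub>m\<^sub>j|\<^sup>2\<close>, up to the square of the norm of \<open>(c\<^sub>m\<^sub>j)\<close>
  as an operator. Hence the basis is determined up to equivalence by the weights \<open>t\<^sub>j\<close>, and these matter
  only up to a constant factor and a square summable error. The canonical basis is itself
  \<open>1\<close>-completely unconditional, so it remains to match the weights of two unconditional bases of the same
  space: both sets of weights are enumerated in decreasing order, and for every dyadic level a dimension
  count produces as many orthonormal vectors as there are mismatched indices at that level. The two
  comparisons applied to this orthonormal system bound the total mismatched weight.\<close>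

section \<open>The Hilbert space structure of \<open>\<ell>\<^sub>2\<close>\<close>

text \<open>The weights cannot be matched separately at each dyadic level. Every comparison between
  weights and norms of images carries an additive error, a power of C times the squared operator
  norm of the coefficient matrix, because a column of coefficients also has a row norm in the
  operator space. This error does not grow with the number of vectors, but it is paid once per
  system, and separate systems for infinitely many levels would make it diverge. Hence the vectors
  for all levels are chosen inside one orthonormal system. The price is that vectors chosen for
  earlier levels use up dimensions at later ones, so that only cumulative counts are available;
  since level l enters with the factor (1/2)^l, a geometric series absorbs the loss. The gap
  \<open>K\<close> between large and small weights is chosen so that the lower and the upper
  estimate for the images are incompatible once the total weight of the system exceeds 1. Each
  direction of the equivalence costs 7 C^9, whence the polynomial 49 C^18.\<close>

class complex_normed_vector = complex_vector + real_normed_vector +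
  assumes norm_scaleC: "norm (c *\<^sub>C x) = cmod c * norm x"

lemma of_real_cmod_sq: "(complex_of_real (cmod z))\<^sup>2 = z * cnj z"
  using complex_norm_square[of z] by simp

lemma cinner_self_norm: "cinner x x = complex_of_real ((norm x)\<^sup>2)"
  by (simp add: norm_ell2_def inner_ell2_def cinner_self suminf_nonneg summable_coord)

lemma norm_ell2_sq: "(norm x)\<^sup>2 = (\<Sum>i. (cmod (coord x i))\<^sup>2)"
  using cinner_self[of x] unfolding cinner_self_norm of_real_eq_iff .

instance ell2 :: complex_normed_vector
proof
  fix c :: complex and x :: ell2
  have "complex_of_real ((norm (c *\<^sub>C x))\<^sup>2) = c * cnj c * complex_of_real ((norm x)\<^sup>2)"
    by (simp only: cinner_self_norm[symmetric] cinner_scaleC_left cinner_scaleC_right ac_simps)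
  also have "\<dots> = complex_of_real ((cmod c * norm x)\<^sup>2)"
    by (simp add: of_real_cmod_sq power_mult_distrib)
  finally show "norm (c *\<^sub>C x) = cmod c * norm x"
    by (simp only: of_real_eq_iff) (simp add: power2_eq_iff_nonneg)
qed

text \<open>The operator spaces sit in \<open>ell2 \<times> ell2\<close>, and the graph of a map
  between two of them sits in a product of two such spaces; closed spans are needed in both.\<close>

instance prod :: (complex_normed_vector, complex_normed_vector) complex_normed_vector
proof
  fix c :: complex and x :: "'a \<times> 'b"
  show "norm (c *\<^sub>C x) = cmod c * norm x"
    by (simp add: norm_prod_def scaleC_prod_def norm_scaleC power_mult_distrib
        real_sqrt_mult flip: distrib_left)
qed

lemma bounded_linear_scaleC: "bounded_linear (\<lambda>x::'a::complex_normed_vector. c *\<^sub>C x)"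
proof (rule bounded_linear_intro[where K = "cmod c"])
  show "c *\<^sub>C r *\<^sub>R x = r *\<^sub>R c *\<^sub>C x" for r and x :: 'a
    by (simp add: scaleR_scaleC scaleC_scaleC mult.commute)
qed (auto simp: scaleC_add_right norm_scaleC)

lemma tendsto_scaleC [tendsto_intros]:
  fixes f :: "'b \<Rightarrow> 'a::complex_normed_vector"
  assumes "(f \<longlongrightarrow> a) F" shows "((\<lambda>x. c *\<^sub>C f x) \<longlongrightarrow> c *\<^sub>C a) F"
  by (rule bounded_linear.tendsto[OF bounded_linear_scaleC assms])

lemma tendsto_scaleC_left [tendsto_intros]:
  fixes a :: "'a::complex_normed_vector"
  assumes "(c \<longlongrightarrow> b) F" shows "((\<lambda>x. c x *\<^sub>C a) \<longlongrightarrow> b *\<^sub>C a) F"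
proof -
  have "bounded_linear (\<lambda>c. c *\<^sub>C a)"
    by (rule bounded_linear_intro[where K = "norm a"])
      (auto simp: scaleC_add_left norm_scaleC scaleR_scaleC scaleC_scaleC scaleR_conv_of_real)
  from bounded_linear.tendsto[OF this assms] show ?thesis .
qed

lemma cinner_add_right: "cinner x (y + z) = cinner x y + cinner x z"
  by (subst (1 2 3) cinner_commute) (simp add: cinner_add_left)

lemma cinner_zero_right [simp]: "cinner x 0 = 0"
  by (subst cinner_commute) simp

lemma cinner_minus_left: "cinner (- x) y = - cinner x y"
  using cinner_add_left[of x "- x" y] by (simp add: add_eq_0_iff)

lemma cinner_minus_right: "cinner x (- y) = - cinner x y"
  using cinner_add_right[of x y "- y"] by (simp add: add_eq_0_iff)

lemma cinner_diff_left: "cinner (x - y) z = cinner x z - cinner y z"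
  using cinner_add_left[of x "- y" z] by (simp add: cinner_minus_left)

lemma cinner_diff_right: "cinner x (y - z) = cinner x y - cinner x z"
  using cinner_add_right[of x y "- z"] by (simp add: cinner_minus_right)

lemma cinner_eq_zero_commute: "cinner x y = 0 \<longleftrightarrow> cinner y x = 0"
  by (metis cinner_commute complex_cnj_zero_iff)

text \<open>A unimodular factor turns \<open>cinner x y\<close> into its absolute value, which
  reduces the claim to the inequality for the real inner product.\<close>

lemma cinner_Cauchy_Schwarz: "cmod (cinner x y) \<le> norm x * norm y"
proof (cases "cinner x y = 0")
  case False
  define c where "c = cnj (cinner x y) / cmod (cinner x y)"
  have c: "cmod c = 1" using False by (simp add: c_def norm_divide)
  have c2: "cinner (c *\<^sub>C x) y = cmod (cinner x y)"
    using False complex_norm_square[of "cinner x y"]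
    by (simp add: c_def cinner_scaleC_left divide_simps power2_eq_square mult.commute)
  have "cmod (cinner x y) = inner (c *\<^sub>C x) y"
    using c2 by (simp add: inner_ell2_def)
  also have "\<dots> \<le> norm (c *\<^sub>C x) * norm y"
    by (rule norm_cauchy_schwarz)
  finally show ?thesis using c by (simp add: norm_scaleC)
qed simp

lemma bounded_bilinear_cinner: "bounded_bilinear cinner"
proof
  show "cinner (r *\<^sub>R a) b = r *\<^sub>R cinner a b" "cinner a (r *\<^sub>R b) = r *\<^sub>R cinner a b" for r a b
    by (simp_all add: scaleR_scaleC cinner_scaleC_left cinner_scaleC_right scaleR_conv_of_real)
  show "\<exists>K. \<forall>a b. norm (cinner a b) \<le> norm a * norm b * K"
    by (rule exI[of _ 1]) (simp add: cinner_Cauchy_Schwarz)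
qed (simp_all add: cinner_add_left cinner_add_right)

lemmas tendsto_cinner [tendsto_intros] = bounded_bilinear.tendsto[OF bounded_bilinear_cinner]

lemma norm_coord_le: "cmod (coord x i) \<le> norm x"
proof -
  have "(cmod (coord x i))\<^sup>2 \<le> (norm x)\<^sup>2"
    unfolding norm_ell2_sq
    using sum_le_suminf[OF summable_coord[of x], of "{i}"] by simp
  then show ?thesis by (rule power2_le_imp_le) simp
qed

lemma sum_coord_le: "(\<Sum>i<(N::nat). (cmod (coord x i))\<^sup>2) \<le> (norm x)\<^sup>2"
  unfolding norm_ell2_sq by (rule sum_le_suminf[OF summable_coord]) auto

text \<open>The limit is formed coordinatewise. The Cauchy estimate passes to the limit only for
  finitely many coordinates, so \<open>part\<close> fixes \<open>N\<close>, and the norm bound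
  follows because the estimate is uniform in \<open>N\<close>.\<close>

instance ell2 :: complete_space
proof
  fix X :: "nat \<Rightarrow> ell2"
  assume C: "Cauchy X"
  have "Cauchy (\<lambda>n. coord (X n) i)" for i
  proof (rule metric_CauchyI)
    fix e :: real assume "e > 0"
    then obtain M where M: "\<forall>m\<ge>M. \<forall>n\<ge>M. dist (X m) (X n) < e"
      using C unfolding Cauchy_def by blast
    have "dist (coord (X m) i) (coord (X n) i) \<le> dist (X m) (X n)" for m n
      using norm_coord_le[of "X m - X n" i] by (simp add: dist_norm)
    then show "\<exists>M. \<forall>m\<ge>M. \<forall>n\<ge>M. dist (coord (X m) i) (coord (X n) i) < e"
      using M by (meson order_le_less_trans)
  qed
  then have "\<forall>i. \<exists>l. (\<lambda>n. coord (X n) i) \<longlonglongrightarrow> l"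
    using Cauchy_convergent_iff convergent_def by blast
  then obtain f where f: "\<And>i. (\<lambda>n. coord (X n) i) \<longlonglongrightarrow> f i" by metis
  have part: "(\<Sum>i<N. (cmod (coord (X m) i - f i))\<^sup>2) \<le> e\<^sup>2"
    if "e > 0" and M: "\<forall>m\<ge>M. \<forall>n\<ge>M. dist (X m) (X n) < e" and "m \<ge> M" for e M m N
  proof (rule tendsto_upperbound)
    show "(\<lambda>n. \<Sum>i<N. (cmod (coord (X m) i - coord (X n) i))\<^sup>2)
        \<longlonglongrightarrow> (\<Sum>i<N. (cmod (coord (X m) i - f i))\<^sup>2)"
      by (intro tendsto_intros f)
    show "\<forall>\<^sub>F n in sequentially. (\<Sum>i<N. (cmod (coord (X m) i - coord (X n) i))\<^sup>2) \<le> e\<^sup>2"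
      unfolding eventually_sequentially
    proof (intro exI[of _ M] allI impI)
      fix n assume "M \<le> n"
      then have "norm (X m - X n) \<le> e" using M \<open>m \<ge> M\<close> by (force simp: dist_norm)
      then have "(norm (X m - X n))\<^sup>2 \<le> e\<^sup>2" by (intro power_mono) auto
      then show "(\<Sum>i<N. (cmod (coord (X m) i - coord (X n) i))\<^sup>2) \<le> e\<^sup>2"
        using sum_coord_le[of "X m - X n" N] by simp
    qed
  qed simp
  have summ: "summable (\<lambda>i. (cmod (coord (X m) i - f i))\<^sup>2)"
    if "e > 0" and M: "\<forall>m\<ge>M. \<forall>n\<ge>M. dist (X m) (X n) < e" and "m \<ge> M" for e M m
    using part[OF that, of "Suc _"] by (intro bounded_imp_summable[where B = "e\<^sup>2"])
      (auto simp: lessThan_Suc_atMost simp del: sum.lessThan_Suc)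
  obtain M1 where M1: "\<forall>m\<ge>M1. \<forall>n\<ge>M1. dist (X m) (X n) < 1"
    using C unfolding Cauchy_def by (meson zero_less_one)
  \<comment> \<open>\<open>f\<close> is square summable as the difference of \<open>X M1\<close> and
    \<open>X M1 - f\<close>.\<close>
  have "summable (\<lambda>i. (cmod (coord (X M1) i + (-1) * (coord (X M1) i - f i)))\<^sup>2)"
    by (intro summable_add_sq summable_coord summable_scale_sq summ[OF zero_less_one M1]) auto
  then have sf: "coord (Abs_ell2 f) = f"
    by (intro coord_Abs) simp
  have "X \<longlonglongrightarrow> Abs_ell2 f"
  proof (rule metric_LIMSEQ_I)
    fix r :: real assume "r > 0"
    then obtain M where M: "\<forall>m\<ge>M. \<forall>n\<ge>M. dist (X m) (X n) < r / 2"
      using C unfolding Cauchy_def by (meson half_gt_zero)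
    have "dist (X m) (Abs_ell2 f) < r" if "m \<ge> M" for m
    proof -
      have "(norm (X m - Abs_ell2 f))\<^sup>2 \<le> (r / 2)\<^sup>2"
        unfolding norm_ell2_sq coord_minus sf
      proof (rule suminf_le_const)
        show "summable (\<lambda>i. (cmod (coord (X m) i - f i))\<^sup>2)"
          by (rule summ[OF _ M that]) (use \<open>r > 0\<close> in simp)
        show "(\<Sum>i<n. (cmod (coord (X m) i - f i))\<^sup>2) \<le> (r / 2)\<^sup>2" for n
          by (rule part[OF _ M that]) (use \<open>r > 0\<close> in simp)
      qed
      then have "norm (X m - Abs_ell2 f) \<le> r / 2"
        by (rule power2_le_imp_le) (use \<open>r > 0\<close> in simp)
      then show ?thesis using \<open>r > 0\<close> by (simp add: dist_norm)
    qed
    then show "\<exists>M. \<forall>m\<ge>M. dist (X m) (Abs_ell2 f) < r" by blast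
  qed
  then show "convergent X" by (auto simp: convergent_def)
qed

section \<open>Closed spans and orthonormal expansions\<close>

lemma subspace_closure:
  fixes S :: "'a::complex_normed_vector set"
  assumes "cvec.subspace S"
  shows "cvec.subspace (closure S)"
proof (rule cvec.subspaceI)
  show "0 \<in> closure S"
    using cvec.subspace_0[OF assms] closure_subset by blast
  show "x + y \<in> closure S" if xy: "x \<in> closure S" "y \<in> closure S" for x y
  proof -
    obtain f g where "\<And>n. f n \<in> S" "f \<longlonglongrightarrow> x" "\<And>n. g n \<in> S" "g \<longlonglongrightarrow> y"
      using xy unfolding closure_sequential by blast
    then show ?thesis
      unfolding closure_sequential
      by (intro exI[of _ "\<lambda>n. f n + g n"]) (auto intro: tendsto_add cvec.subspace_add[OF assms])
  qed
  show "c *\<^sub>C x \<in> closure S" if xy: "x \<in> closure S" for c x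
  proof -
    obtain f where "\<And>n. f n \<in> S" "f \<longlonglongrightarrow> x"
      using xy unfolding closure_sequential by blast
    then show ?thesis
      unfolding closure_sequential
      by (intro exI[of _ "\<lambda>n. c *\<^sub>C f n"]) (auto intro: tendsto_scaleC cvec.subspace_scale[OF assms])
  qed
qed

lemma subspace_closed_cspan:
  "cvec.subspace (closed_cspan S)" for S :: "'a::complex_normed_vector set"
  by (simp add: closed_cspan_def subspace_closure cvec.subspace_span)

lemma closed_closed_cspan: "closed (closed_cspan S)"
  by (simp add: closed_cspan_def)

lemma span_subset_closed_cspan: "cvec.span S \<subseteq> closed_cspan S"
  by (simp add: closed_cspan_def closure_subset)

lemma closed_cspan_base: "x \<in> S \<Longrightarrow> x \<in> closed_cspan S"
  using span_subset_closed_cspan cvec.span_base by blast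

lemma closed_cspan_minimal: "S \<subseteq> D \<Longrightarrow> closed_csubspace D \<Longrightarrow> closed_cspan S \<subseteq> D"
  unfolding closed_csubspace_def closed_cspan_def
  by (meson closure_minimal cvec.span_minimal)

lemma orthonormal_subset: "orthonormal I \<xi> \<Longrightarrow> J \<subseteq> I \<Longrightarrow> orthonormal J \<xi>"
  unfolding orthonormal_def by blast

lemma norm_sum_orthogonal:
  assumes "finite F" "\<And>i j. i \<in> F \<Longrightarrow> j \<in> F \<Longrightarrow> i \<noteq> j \<Longrightarrow> cinner (z i) (z j) = 0"
  shows "(norm (\<Sum>i\<in>F. c i *\<^sub>C z i))\<^sup>2 = (\<Sum>i\<in>F. (cmod (c i))\<^sup>2 * (norm (z i))\<^sup>2)"
proof -
  have "complex_of_real ((norm (\<Sum>i\<in>F. c i *\<^sub>C z i))\<^sup>2)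
      = (\<Sum>i\<in>F. \<Sum>j\<in>F. c i * (cnj (c j) * cinner (z i) (z j)))"
    unfolding cinner_self_norm[symmetric]
    by (simp add: cinner_sum_left) (simp add: cinner_sum_right cinner_scaleC_left
        cinner_scaleC_right sum_distrib_left mult.left_commute)
  also have "\<dots> = (\<Sum>i\<in>F. \<Sum>j\<in>F. if i = j then c i * (cnj (c i) * cinner (z i) (z i)) else 0)"
    using assms(2) by (intro sum.cong refl) auto
  also have "\<dots> = (\<Sum>i\<in>F. complex_of_real ((cmod (c i))\<^sup>2 * (norm (z i))\<^sup>2))"
    using assms(1) by (simp add: cinner_self_norm mult.assoc[symmetric] of_real_cmod_sq)
  finally show ?thesis
    by (simp only: of_real_sum[symmetric] of_real_eq_iff)
qed

lemma orthonormal_norm: "orthonormal I \<xi> \<Longrightarrow> i \<in> I \<Longrightarrow> norm (\<xi> i) = 1"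
  using cinner_self_norm[of "\<xi> i"] power2_eq_1_iff[of "norm (\<xi> i)"] norm_ge_zero[of "\<xi> i"]
  unfolding orthonormal_def
  by (auto simp del: of_real_power norm_ge_zero simp: of_real_eq_1_iff dest!: sym[of 1])

lemma norm_sum_orthonormal:
  assumes "finite F" "orthonormal F \<xi>"
  shows "(norm (\<Sum>i\<in>F. c i *\<^sub>C \<xi> i))\<^sup>2 = (\<Sum>i\<in>F. (cmod (c i))\<^sup>2)"
proof -
  have "(norm (\<Sum>i\<in>F. c i *\<^sub>C \<xi> i))\<^sup>2 = (\<Sum>i\<in>F. (cmod (c i))\<^sup>2 * (norm (\<xi> i))\<^sup>2)"
    using assms by (intro norm_sum_orthogonal) (auto simp: orthonormal_def)
  then show ?thesis
    using assms by (simp add: orthonormal_norm)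
qed

lemma cinner_orthonormal_sum_single:
  assumes "finite F" "F \<subseteq> I" "orthonormal I \<xi>" "k \<in> I"
  shows "cinner (\<Sum>i\<in>F. c i *\<^sub>C \<xi> i) (\<xi> k) = (if k \<in> F then c k else 0)"
proof -
  have "cinner (\<Sum>i\<in>F. c i *\<^sub>C \<xi> i) (\<xi> k) = (\<Sum>i\<in>F. if i = k then c i else 0)"
    using assms unfolding cinner_sum_left cinner_scaleC_left orthonormal_def
    by (intro sum.cong refl) auto
  then show ?thesis using assms(1) by simp
qed

lemma bessel_inequality:
  assumes "finite F" "orthonormal F \<xi>"
  shows "(\<Sum>i\<in>F. (cmod (cinner x (\<xi> i)))\<^sup>2) \<le> (norm x)\<^sup>2"
proof -
  define p where "p = (\<Sum>i\<in>F. cinner x (\<xi> i) *\<^sub>C \<xi> i)"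
  define S where "S = (\<Sum>i\<in>F. (cmod (cinner x (\<xi> i)))\<^sup>2)"
  have xp: "cinner x p = complex_of_real S"
    by (simp add: p_def S_def cinner_sum_right cinner_scaleC_right complex_norm_square mult.commute
        del: of_real_power)
  have pp: "cinner p p = complex_of_real S"
    using norm_sum_orthonormal[OF assms] by (simp add: cinner_self_norm p_def S_def)
  have "complex_of_real ((norm (x - p))\<^sup>2) = complex_of_real ((norm x)\<^sup>2 - S)"
    unfolding cinner_self_norm[symmetric] cinner_diff_left cinner_diff_right pp
    by (subst (2) cinner_commute) (simp add: xp cinner_self_norm)
  then have "(norm (x - p))\<^sup>2 = (norm x)\<^sup>2 - S" by (simp only: of_real_eq_iff)
  then show ?thesis using zero_le_power2[of "norm (x - p)"] by (simp add: S_def)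
qed

text \<open>Increments of the partial sums have squared norms equal to the increments of a bounded
  monotone real sequence, so the partial sums are Cauchy. Index sets inside \<open>nat\<close>
  supply the order of summation. The bound for \<open>norm v\<close> later makes an operator defined
  by its coefficients bounded.\<close>

lemma riesz_fischer:
  fixes I :: "nat set"
  assumes on: "orthonormal I \<xi>" and bd: "\<And>n. (\<Sum>i\<in>I \<inter> {..<n}. (cmod (a i))\<^sup>2) \<le> M"
  obtains v where "v \<in> closed_cspan (\<xi> ` I)" "\<And>i. i \<in> I \<Longrightarrow> cinner v (\<xi> i) = a i"
    "(norm v)\<^sup>2 \<le> M" "(\<lambda>n. \<Sum>i\<in>I \<inter> {..<n}. a i *\<^sub>C \<xi> i) \<longlonglongrightarrow> v"
proof -
  define p where "p = (\<lambda>n. \<Sum>i\<in>I \<inter> {..<n}. a i *\<^sub>C \<xi> i)"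
  define b where "b = (\<lambda>n. \<Sum>i\<in>I \<inter> {..<n}. (cmod (a i))\<^sup>2)"
  have diff: "(norm (p n - p m))\<^sup>2 = b n - b m" if "m \<le> n" for m n
  proof -
    have eq: "I \<inter> {..<n} = (I \<inter> {..<m}) \<union> (I \<inter> {m..<n})"
      "(I \<inter> {..<m}) \<inter> (I \<inter> {m..<n}) = {}" using that by auto
    have "p n - p m = (\<Sum>i\<in>I \<inter> {m..<n}. a i *\<^sub>C \<xi> i)"
      unfolding p_def eq(1) by (subst sum.union_disjoint) (use eq(2) in auto)
    moreover have "b n - b m = (\<Sum>i\<in>I \<inter> {m..<n}. (cmod (a i))\<^sup>2)"
      unfolding b_def eq(1) by (subst sum.union_disjoint) (use eq(2) in auto)
    ultimately show ?thesis
      using norm_sum_orthonormal[OF _ orthonormal_subset[OF on], of "I \<inter> {m..<n}" a] by simp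
  qed
  have "convergent b"
  proof (rule Bseq_mono_convergent)
    show "Bseq b"
      by (rule BseqI'[of _ M]) (use bd in \<open>auto simp: b_def sum_nonneg\<close>)
    show "\<forall>m n. m \<le> n \<longrightarrow> b m \<le> b n"
      using diff by (metis diff_ge_0_iff_ge zero_le_power2)
  qed
  then have Cb: "Cauchy b" by (rule convergent_Cauchy)
  have "Cauchy p"
  proof (rule metric_CauchyI)
    fix e :: real assume "e > 0"
    then have "e\<^sup>2 > 0" by simp
    then obtain N where N: "\<forall>m\<ge>N. \<forall>n\<ge>N. dist (b m) (b n) < e\<^sup>2"
      using Cb unfolding Cauchy_def by blast
    have le: "dist (p m) (p n) < e" if "m \<ge> N" "n \<ge> m" for m n
    proof -
      have "(norm (p n - p m))\<^sup>2 < e\<^sup>2"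
        using N that diff[OF that(2)] by (smt (verit) dist_real_def order_trans)
      then show ?thesis using \<open>e > 0\<close> power2_less_imp_less
        by (metis dist_commute dist_norm less_imp_le)
    qed
    then have "dist (p m) (p n) < e" if "m \<ge> N" "n \<ge> N" for m n
      using that by (metis dist_commute nle_le)
    then show "\<exists>N. \<forall>m\<ge>N. \<forall>n\<ge>N. dist (p m) (p n) < e" by blast
  qed
  then obtain v where v: "p \<longlonglongrightarrow> v"
    using Cauchy_convergent_iff convergent_def by blast
  have "p n \<in> cvec.span (\<xi> ` I)" for n
    unfolding p_def by (intro cvec.span_sum cvec.span_scale cvec.span_base) auto
  then have 1: "v \<in> closed_cspan (\<xi> ` I)"
    using v unfolding closed_cspan_def closure_sequential by blast
  have 2: "cinner v (\<xi> i) = a i" if "i \<in> I" for i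
  proof (rule LIMSEQ_unique)
    show "(\<lambda>n. cinner (p n) (\<xi> i)) \<longlonglongrightarrow> cinner v (\<xi> i)"
      by (intro tendsto_intros v)
    have "cinner (p n) (\<xi> i) = a i" if "n \<ge> Suc i" for n
      unfolding p_def using that \<open>i \<in> I\<close> by (subst cinner_orthonormal_sum_single[OF _ _ on]) auto
    then show "(\<lambda>n. cinner (p n) (\<xi> i)) \<longlonglongrightarrow> a i"
      by (intro tendsto_eventually) (auto simp: eventually_sequentially)
  qed
  have "(norm (p n))\<^sup>2 \<le> M" for n
    using norm_sum_orthonormal[OF _ orthonormal_subset[OF on], of "I \<inter> {..<n}" a] bd[of n]
    by (simp add: p_def)
  then have 3: "(norm v)\<^sup>2 \<le> M"
    by (intro LIMSEQ_le_const2[OF tendsto_power[OF tendsto_norm[OF v]]]) auto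
  show thesis using that[OF 1 2 3] v unfolding p_def by blast
qed

lemma orthogonal_closed_cspan:
  assumes "\<And>x. x \<in> S \<Longrightarrow> cinner x w = 0" "v \<in> closed_cspan S"
  shows "cinner v w = 0"
proof -
  have "cvec.subspace {v. cinner v w = 0}"
    by (rule cvec.subspaceI) (auto simp: cinner_add_left cinner_scaleC_left)
  moreover have "closed {v. cinner v w = 0}"
    by (rule closed_Collect_eq)
      (rule bounded_bilinear.continuous_on[OF bounded_bilinear_cinner] continuous_on_id
        continuous_on_const)+
  ultimately show ?thesis
    using closed_cspan_minimal[of S "{v. cinner v w = 0}"] assms
    unfolding closed_csubspace_def by auto
qed

text \<open>Riesz-Fischer provides a limit with the same coefficients; its difference from
  \<open>v\<close> lies in the closed span and is orthogonal to it.\<close>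

lemma fourier_expansion:
  fixes I :: "nat set"
  assumes on: "orthonormal I \<xi>" and v: "v \<in> closed_cspan (\<xi> ` I)"
  shows "(\<lambda>n. \<Sum>i\<in>I \<inter> {..<n}. cinner v (\<xi> i) *\<^sub>C \<xi> i) \<longlonglongrightarrow> v"
proof -
  have "(\<Sum>i\<in>I \<inter> {..<n}. (cmod (cinner v (\<xi> i)))\<^sup>2) \<le> (norm v)\<^sup>2" for n
    by (intro bessel_inequality orthonormal_subset[OF on]) auto
  from riesz_fischer[OF on this] obtain w where w: "w \<in> closed_cspan (\<xi> ` I)"
    "\<And>i. i \<in> I \<Longrightarrow> cinner w (\<xi> i) = cinner v (\<xi> i)"
    "(\<lambda>n. \<Sum>i\<in>I \<inter> {..<n}. cinner v (\<xi> i) *\<^sub>C \<xi> i) \<longlonglongrightarrow> w" by metis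
  have mem: "v - w \<in> closed_cspan (\<xi> ` I)"
    by (intro cvec.subspace_diff subspace_closed_cspan v w)
  have "cinner (v - w) (v - w) = 0"
  proof (rule orthogonal_closed_cspan[OF _ mem])
    fix x assume "x \<in> \<xi> ` I"
    then show "cinner x (v - w) = 0"
      using w(2) by (subst cinner_eq_zero_commute) (auto simp: cinner_diff_left)
  qed
  then have "v = w" by (simp add: cinner_self_norm)
  then show ?thesis using w by simp
qed

lemma orthogonal_decomposition:
  fixes I :: "nat set"
  assumes on: "orthonormal I \<xi>"
  obtains v where "v \<in> closed_cspan (\<xi> ` I)" "\<And>i. i \<in> I \<Longrightarrow> cinner (x - v) (\<xi> i) = 0"
proof -
  have "(\<Sum>i\<in>I \<inter> {..<n}. (cmod (cinner x (\<xi> i)))\<^sup>2) \<le> (norm x)\<^sup>2" for n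
    by (intro bessel_inequality orthonormal_subset[OF on]) auto
  from riesz_fischer[OF on this] show thesis
    using that by (metis cinner_diff_left eq_iff_diff_eq_0)
qed

lemma orthonormal_total:
  fixes I :: "nat set"
  assumes on: "orthonormal I \<xi>" and D: "closed_csubspace D" and sub: "\<xi> ` I \<subseteq> D"
    and tot: "\<And>x. x \<in> D \<Longrightarrow> (\<And>i. i \<in> I \<Longrightarrow> cinner x (\<xi> i) = 0) \<Longrightarrow> x = 0"
  shows "closed_cspan (\<xi> ` I) = D"
proof
  show *: "closed_cspan (\<xi> ` I) \<subseteq> D" by (rule closed_cspan_minimal[OF sub D])
  show "D \<subseteq> closed_cspan (\<xi> ` I)"
  proof
    fix x assume "x \<in> D"
    from orthogonal_decomposition[OF on] obtain v
      where v: "v \<in> closed_cspan (\<xi> ` I)" "\<And>i. i \<in> I \<Longrightarrow> cinner (x - v) (\<xi> i) = 0" by metis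
    have "x - v \<in> D"
      using D * v \<open>x \<in> D\<close> unfolding closed_csubspace_def by (blast intro: cvec.subspace_diff)
    then have "x = v" using tot v(2) by fastforce
    then show "x \<in> closed_cspan (\<xi> ` I)" using v by simp
  qed
qed

section \<open>Compact contractions\<close>

lemma clinear_on_subset: "clinear_on D A \<Longrightarrow> N \<subseteq> D \<Longrightarrow> clinear_on N A"
  unfolding clinear_on_def by blast

lemma compact_contraction_on_subset:
  assumes "compact_contraction_on D A" "N \<subseteq> D"
  shows "compact_contraction_on N A"
proof -
  have "closure (A ` (N \<inter> cball 0 1)) \<subseteq> closure (A ` (D \<inter> cball 0 1))"
    using assms(2) by (intro closure_mono) blast
  then have "compact (closure (A ` (N \<inter> cball 0 1)))"
    using assms(1) unfolding compact_contraction_on_def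
    by (metis closed_closure compact_Int_closed inf.absorb_iff2 inf.orderE)
  then show ?thesis
    using assms unfolding compact_contraction_on_def by (meson clinear_on_subset subset_iff)
qed

context
  fixes D :: "'a::complex_vector set" and A :: "'a \<Rightarrow> 'b::complex_vector"
  assumes D: "cvec.subspace D" and lin: "clinear_on D A"
begin

lemma clinear_on_scale: "x \<in> D \<Longrightarrow> A (c *\<^sub>C x) = c *\<^sub>C A x"
  using lin unfolding clinear_on_def by blast

lemma clinear_on_add: "x \<in> D \<Longrightarrow> y \<in> D \<Longrightarrow> A (x + y) = A x + A y"
  using lin unfolding clinear_on_def by blast

lemma clinear_on_0: "A 0 = 0"
  using clinear_on_scale[OF cvec.subspace_0[OF D], of 0] by simp

lemma clinear_on_diff: "x \<in> D \<Longrightarrow> y \<in> D \<Longrightarrow> A (x - y) = A x - A y"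
  using clinear_on_add[of "x - y" y] cvec.subspace_diff[OF D] by simp

lemma clinear_on_sum:
  assumes "\<And>i. i \<in> F \<Longrightarrow> z i \<in> D"
  shows "A (\<Sum>i\<in>F. c i *\<^sub>C z i) = (\<Sum>i\<in>F. c i *\<^sub>C A (z i))"
  using assms
proof (induction F rule: infinite_finite_induct)
  case (insert i F)
  have "(\<Sum>i\<in>F. c i *\<^sub>C z i) \<in> D"
    using insert by (intro cvec.subspace_sum[OF D] cvec.subspace_scale[OF D]) auto
  then show ?case
    using insert by (simp add: clinear_on_add clinear_on_scale cvec.subspace_scale[OF D])
qed (simp_all add: clinear_on_0)

end

text \<open>Operators are linear and bounded only on \<open>D\<close>, so continuity is stated for
  sequences that stay in \<open>D\<close> together with their limit.\<close>

lemma bounded_clinear_tendsto: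
  fixes A :: "'a::complex_normed_vector \<Rightarrow> 'b::complex_normed_vector"
  assumes D: "cvec.subspace D" and lin: "clinear_on D A"
    and bd: "\<And>x. x \<in> D \<Longrightarrow> norm (A x) \<le> M * norm x"
    and x: "\<And>n::nat. x n \<in> D" "l \<in> D" "x \<longlonglongrightarrow> l"
  shows "(\<lambda>n. A (x n)) \<longlonglongrightarrow> A l"
proof (rule Lim_null_comparison[THEN LIM_zero_cancel])
  show "\<forall>\<^sub>F n in sequentially. norm (A (x n) - A l) \<le> M * norm (x n - l)"
    using bd x by (intro always_eventually allI)
      (metis clinear_on_diff[OF D lin] cvec.subspace_diff[OF D])
  have "(\<lambda>n. M * norm (x n - l)) \<longlonglongrightarrow> M * norm (l - l)"
    by (intro tendsto_intros x)
  then show "(\<lambda>n. M * norm (x n - l)) \<longlonglongrightarrow> 0" by simp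
qed

lemma norm_add_scaleC_sq:
  "(norm (v + w *\<^sub>C x))\<^sup>2 = (norm v)\<^sup>2 + 2 * Re (w * cinner x v) + (cmod w)\<^sup>2 * (norm x)\<^sup>2"
proof -
  have "complex_of_real ((norm (v + w *\<^sub>C x))\<^sup>2)
      = complex_of_real ((norm v)\<^sup>2) + (w * cinner x v + cnj (w * cinner x v))
        + w * cnj w * complex_of_real ((norm x)\<^sup>2)"
    unfolding cinner_self_norm[symmetric] complex_cnj_mult cinner_commute[of x v, symmetric]
    by (subst cinner_commute[of x v])
      (simp add: cinner_add_left cinner_add_right cinner_scaleC_left cinner_scaleC_right algebra_simps)
  also have "\<dots> = complex_of_real ((norm v)\<^sup>2 + 2 * Re (w * cinner x v) + (cmod w)\<^sup>2 * (norm x)\<^sup>2)"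
    unfolding complex_add_cnj complex_norm_square[symmetric] by simp
  finally show ?thesis by (simp only: of_real_eq_iff)
qed

lemma parallelogram_identity:
  fixes a b :: "'a::real_inner"
  shows "(norm (a + b))\<^sup>2 + (norm (a - b))\<^sup>2 = 2 * (norm a)\<^sup>2 + 2 * (norm b)\<^sup>2"
  by (simp add: power2_norm_eq_inner inner_add_left inner_add_right inner_diff_left inner_diff_right)

text \<open>For a maximizing sequence \<open>w\<^sub>n\<close> along which \<open>A w\<^sub>n\<close> converges, \<open>\<parallel>w\<^sub>m + w\<^sub>n\<parallel>\<close> tends to \<open>2\<close>, so the
  parallelogram identity makes \<open>w\<^sub>n\<close> Cauchy. The orthogonality relation is the first order condition.\<close>

lemma maximizing_vector:
  assumes N: "closed_csubspace N" and A: "compact_contraction_on N A" and z: "z \<in> N" "A z \<noteq> 0"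
  obtains v where "v \<in> N" "norm v = 1" "A v \<noteq> 0"
    "\<And>x. x \<in> N \<Longrightarrow> cinner (A x) (A v) = (norm (A v))\<^sup>2 * cinner x v"
proof -
  have sub: "cvec.subspace N" and cl: "closed N"
    using N by (auto simp: closed_csubspace_def)
  have lin: "clinear_on N A" and con: "\<And>x. x \<in> N \<Longrightarrow> norm (A x) \<le> norm x"
    and cpt: "compact (closure (A ` (N \<inter> cball 0 1)))"
    using A by (auto simp: compact_contraction_on_def)
  note [simp] = clinear_on_scale[OF sub lin] clinear_on_add[OF sub lin]
  define S where "S = (\<lambda>x. norm (A x)) ` {x \<in> N. norm x = 1}"
  define \<sigma> where "\<sigma> = Sup S"
  have z0: "z \<noteq> 0" using z clinear_on_0[OF sub lin] by auto
  have zN: "(1 / norm z) *\<^sub>C z \<in> N" using z cvec.subspace_scale[OF sub] by blast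
  have zS: "norm (A z) / norm z \<in> S"
    unfolding S_def using z zN z0
    by (intro image_eqI[of _ _ "complex_of_real (1 / norm z) *\<^sub>C z"])
      (auto simp: norm_scaleC norm_divide)
  have bdd: "bdd_above S"
    by (rule bdd_aboveI[of _ 1]) (use con in \<open>fastforce simp: S_def\<close>)
  have "0 < norm (A z) / norm z" using z z0 by simp
  also have "\<dots> \<le> \<sigma>" unfolding \<sigma>_def by (rule cSup_upper[OF zS bdd])
  finally have \<sigma>: "\<sigma> > 0" .
  have le: "norm (A x) \<le> \<sigma> * norm x" if "x \<in> N" for x
  proof (cases "x = 0")
    case False
    have "complex_of_real (1 / norm x) *\<^sub>C x \<in> N" using that cvec.subspace_scale[OF sub] by blast
    then have "norm (A x) / norm x \<in> S"
      unfolding S_def using that False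
      by (intro image_eqI[of _ _ "complex_of_real (1 / norm x) *\<^sub>C x"])
        (auto simp: norm_scaleC norm_divide)
    then have "norm (A x) / norm x \<le> \<sigma>" unfolding \<sigma>_def by (rule cSup_upper[OF _ bdd])
    then show ?thesis using False by (simp add: divide_simps)
  qed (simp add: clinear_on_0[OF sub lin])
  have "\<exists>x. x \<in> N \<and> norm x = 1 \<and> \<sigma> - 1 / Suc n < norm (A x)" for n
  proof -
    have "\<exists>s\<in>S. \<sigma> - 1 / Suc n < s"
      unfolding \<sigma>_def by (rule less_cSup_iff[THEN iffD1]) (use zS bdd in auto)
    then show ?thesis by (auto simp: S_def)
  qed
  then obtain x where x: "\<And>n. x n \<in> N" "\<And>n. norm (x n) = 1"
    "\<And>n. \<sigma> - 1 / Suc n < norm (A (x n))" by metis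
  have "\<forall>n. A (x n) \<in> closure (A ` (N \<inter> cball 0 1))"
    using x(1,2) by (intro allI subsetD[OF closure_subset] imageI) (simp add: mem_cball)
  then obtain y r where r: "strict_mono r" "((\<lambda>n. A (x n)) \<circ> r) \<longlonglongrightarrow> y"
    using cpt unfolding compact_def by meson
  define w where "w = (\<lambda>n. x (r n))"
  have w: "w n \<in> N" "norm (w n) = 1" for n by (simp_all add: w_def x)
  have Aw: "(\<lambda>n. A (w n)) \<longlonglongrightarrow> y" using r(2) by (simp add: w_def o_def)
  have ny: "norm y = \<sigma>"
  proof (rule LIMSEQ_unique[OF tendsto_norm[OF Aw]])
    show "(\<lambda>n. norm (A (w n))) \<longlonglongrightarrow> \<sigma>"
    proof (rule tendsto_sandwich[of "\<lambda>n. \<sigma> - 1 / Suc n" _ _ "\<lambda>n. \<sigma>"])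
      have "\<sigma> - 1 / Suc n \<le> norm (A (w n))" for n
      proof -
        have "n \<le> r n" using r(1) by (simp add: seq_suble)
        then have "1 / real (Suc (r n)) \<le> 1 / real (Suc n)" by (intro divide_left_mono) auto
        then show ?thesis using x(3)[of "r n"] unfolding w_def by linarith
      qed
      then show "\<forall>\<^sub>F n in sequentially. \<sigma> - 1 / Suc n \<le> norm (A (w n))" by simp
      have "norm (A (w n)) \<le> \<sigma>" for n using le[of "w n"] w[of n] by simp
      then show "\<forall>\<^sub>F n in sequentially. norm (A (w n)) \<le> \<sigma>" by simp
      show "(\<lambda>n. \<sigma> - 1 / real (Suc n)) \<longlonglongrightarrow> \<sigma>"
        using tendsto_diff[OF tendsto_const LIMSEQ_inverse_real_of_nat, of \<sigma>]
        by (simp add: inverse_eq_divide)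
    qed simp
  qed
  have par: "\<sigma>\<^sup>2 * (norm (w m - w n))\<^sup>2 \<le> 4 * \<sigma> * (norm (A (w m) - y) + norm (A (w n) - y))" for m n
  proof -
    define \<delta> where "\<delta> = norm (A (w m) - y) + norm (A (w n) - y)"
    have "\<delta> \<ge> 0" by (simp add: \<delta>_def)
    have pl: "(norm (w m + w n))\<^sup>2 + (norm (w m - w n))\<^sup>2 = 4"
      using parallelogram_identity[of "w m" "w n"] w by simp
    have "2 * \<sigma> = norm (y + y)" using ny by (simp add: mult_2[symmetric] flip: scaleR_2)
    also have "\<dots> = norm ((A (w m) + A (w n)) - ((A (w m) - y) + (A (w n) - y)))" by simp
    also have "\<dots> \<le> norm (A (w m) + A (w n)) + \<delta>"
      unfolding \<delta>_def by (meson norm_triangle_ineq norm_triangle_ineq4 add_left_mono order_trans)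
    finally have a: "2 * \<sigma> - \<delta> \<le> norm (A (w m) + A (w n))" by simp
    also have "A (w m) + A (w n) = A (w m + w n)" using w by simp
    also have "norm \<dots> \<le> \<sigma> * norm (w m + w n)"
      using w by (intro le cvec.subspace_add[OF sub])
    finally have b: "2 * \<sigma> - \<delta> \<le> \<sigma> * norm (w m + w n)" .
    \<comment> \<open>If \<delta> exceeds 2 \<sigma>, the inequality \<open>b\<close> cannot be
      squared, but then the left side is already nonpositive.\<close>
    have "4 * \<sigma>\<^sup>2 - 4 * \<sigma> * \<delta> \<le> (\<sigma> * norm (w m + w n))\<^sup>2"
    proof (cases "\<delta> \<le> 2 * \<sigma>")
      case True
      then have "(2 * \<sigma> - \<delta>)\<^sup>2 \<le> (\<sigma> * norm (w m + w n))\<^sup>2" using b by (intro power_mono) auto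
      moreover have "(2 * \<sigma> - \<delta>)\<^sup>2 = 4 * \<sigma>\<^sup>2 - 4 * \<sigma> * \<delta> + \<delta>\<^sup>2"
        by (simp add: power2_eq_square algebra_simps)
      ultimately show ?thesis using zero_le_power2[of \<delta>] by linarith
    next
      case False
      then have "\<sigma> * \<sigma> \<le> \<sigma> * \<delta>" using \<sigma> by (intro mult_left_mono) auto
      then have "4 * \<sigma>\<^sup>2 - 4 * \<sigma> * \<delta> \<le> 0" by (simp add: power2_eq_square)
      then show ?thesis using zero_le_power2 order_trans by blast
    qed
    moreover have "(\<sigma> * norm (w m + w n))\<^sup>2 = \<sigma>\<^sup>2 * (4 - (norm (w m - w n))\<^sup>2)"
      using pl by (simp add: power_mult_distrib)
    ultimately show ?thesis unfolding \<delta>_def[symmetric] by (simp add: algebra_simps)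
  qed
  have "Cauchy w"
  proof (rule metric_CauchyI)
    fix e :: real assume "e > 0"
    then have "\<sigma> * e\<^sup>2 / 8 > 0" using \<sigma> by simp
    then obtain M where M: "\<And>n. n \<ge> M \<Longrightarrow> norm (A (w n) - y) < \<sigma> * e\<^sup>2 / 8"
      using LIMSEQ_D[OF Aw] by blast
    have "dist (w m) (w n) < e" if "m \<ge> M" "n \<ge> M" for m n
    proof -
      have "norm (A (w m) - y) + norm (A (w n) - y) < \<sigma> * e\<^sup>2 / 4"
        using M[OF that(1)] M[OF that(2)] by linarith
      then have "4 * \<sigma> * (norm (A (w m) - y) + norm (A (w n) - y)) < 4 * \<sigma> * (\<sigma> * e\<^sup>2 / 4)"
        using \<sigma> by simp
      then have "\<sigma>\<^sup>2 * (norm (w m - w n))\<^sup>2 < \<sigma>\<^sup>2 * e\<^sup>2"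
        using par[of m n] by (simp add: power2_eq_square mult.assoc)
      then have "(norm (w m - w n))\<^sup>2 < e\<^sup>2" using \<sigma> by simp
      then show ?thesis using \<open>e > 0\<close> by (simp add: dist_norm power2_less_imp_less)
    qed
    then show "\<exists>M. \<forall>m\<ge>M. \<forall>n\<ge>M. dist (w m) (w n) < e" by blast
  qed
  then obtain v where v: "w \<longlonglongrightarrow> v" using Cauchy_convergent_iff convergent_def by blast
  have vN: "v \<in> N" using closed_sequentially[OF cl _ v] w by blast
  have "norm v = 1"
    using LIMSEQ_unique[OF tendsto_norm[OF v], of 1] w by simp
  have "(\<lambda>n. A (w n)) \<longlonglongrightarrow> A v"
    by (rule bounded_clinear_tendsto[OF sub lin, where M = 1]) (use con w v vN in auto)
  then have "A v = y" using Aw LIMSEQ_unique by blast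
  then have Av: "norm (A v) = \<sigma>" using ny by simp
  have orth: "cinner (A x) (A v) = (norm (A v))\<^sup>2 * cinner x v" if x: "x \<in> N" for x
  proof -
    define c where "c = \<sigma>\<^sup>2 * cinner x v - cinner (A x) (A v)"
    define q where "q = \<sigma>\<^sup>2 * (norm x)\<^sup>2 - (norm (A x))\<^sup>2"
    have "0 \<le> - 2 * t * (cmod c)\<^sup>2 + t\<^sup>2 * (cmod c)\<^sup>2 * q" for t :: real
    proof -
      \<comment> \<open>The direction \<open>cnj c\<close> makes the first order term of the
        perturbation equal to -2 t times the square of \<open>cmod c\<close>.\<close>
      define u where "u = complex_of_real (- t) * cnj c"
      have ux: "u *\<^sub>C x \<in> N" using x cvec.subspace_scale[OF sub] by blast
      then have "norm (A (v + u *\<^sub>C x)) \<le> \<sigma> * norm (v + u *\<^sub>C x)"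
        using vN by (intro le cvec.subspace_add[OF sub])
      then have "(norm (A (v + u *\<^sub>C x)))\<^sup>2 \<le> (\<sigma> * norm (v + u *\<^sub>C x))\<^sup>2" by (intro power_mono) auto
      moreover have "A (v + u *\<^sub>C x) = A v + u *\<^sub>C A x" using ux vN x by simp
      ultimately have "(norm (A v))\<^sup>2 + 2 * Re (u * cinner (A x) (A v)) + (cmod u)\<^sup>2 * (norm (A x))\<^sup>2
          \<le> \<sigma>\<^sup>2 * ((norm v)\<^sup>2 + 2 * Re (u * cinner x v) + (cmod u)\<^sup>2 * (norm x)\<^sup>2)"
        by (simp add: norm_add_scaleC_sq power_mult_distrib)
      moreover have "Re (u * c) = \<sigma>\<^sup>2 * Re (u * cinner x v) - Re (u * cinner (A x) (A v))"
        by (simp add: c_def algebra_simps)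
      ultimately have "0 \<le> 2 * Re (u * c) + (cmod u)\<^sup>2 * q"
        using Av \<open>norm v = 1\<close> by (simp add: q_def algebra_simps)
      moreover have "Re (u * c) = - t * (cmod c)\<^sup>2"
        using complex_norm_square[of c] by (simp add: u_def mult.assoc mult.commute[of "cnj c"]
            del: of_real_power flip: complex_norm_square)
      moreover have "(cmod u)\<^sup>2 = t\<^sup>2 * (cmod c)\<^sup>2"
        by (simp add: u_def norm_mult power_mult_distrib)
      ultimately show ?thesis by simp
    qed
    \<comment> \<open>With this \<open>t\<close> the quadratic term is at most half of the linear
      one, which forces c = 0.\<close>
    from this[of "1 / (\<bar>q\<bar> + 1)"]
    have "2 * (1 / (\<bar>q\<bar> + 1)) * (cmod c)\<^sup>2 \<le> (1 / (\<bar>q\<bar> + 1))\<^sup>2 * (cmod c)\<^sup>2 * q" by simp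
    also have "\<dots> \<le> (1 / (\<bar>q\<bar> + 1))\<^sup>2 * (cmod c)\<^sup>2 * (\<bar>q\<bar> + 1)"
      by (intro mult_left_mono) auto
    also have "\<dots> = (1 / (\<bar>q\<bar> + 1)) * (cmod c)\<^sup>2"
      by (simp add: power2_eq_square divide_simps)
    finally have "(1 / (\<bar>q\<bar> + 1)) * (cmod c)\<^sup>2 \<le> 0" by simp
    then have "(cmod c)\<^sup>2 \<le> 0"
      using abs_ge_zero[of q] by (auto simp: mult_le_0_iff divide_le_0_iff)
    then show ?thesis using Av by (simp add: c_def)
  qed
  show thesis
    by (rule that[OF vN \<open>norm v = 1\<close> _ orth]) (use Av \<sigma> in auto)
qed

text \<open>If infinitely many images were large, compactness would give a subsequence along which
  \<open>A (f j)\<close> tends to some nonzero \<open>y\<close>. The image of a sum of m such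
  vectors then has norm of order m, while \<open>bd\<close> bounds the norm of the sum itself by a
  multiple of the square root of m. Orthonormal systems and Riesz bases both satisfy
  \<open>bd\<close>.\<close>

lemma finite_large_image:
  fixes M :: real
  assumes D: "cvec.subspace D" and A: "compact_contraction_on D A"
    and f: "\<And>j. j \<in> J \<Longrightarrow> f j \<in> D" "\<And>j. j \<in> J \<Longrightarrow> norm (f j) \<le> 1"
    and bd: "\<And>F. finite F \<Longrightarrow> F \<subseteq> J \<Longrightarrow> (norm (\<Sum>j\<in>F. f j))\<^sup>2 \<le> M * card F"
    and \<tau>: "\<tau> > 0"
  shows "finite {j \<in> J. norm (A (f j)) > \<tau>}"
proof (rule ccontr)
  assume "infinite {j \<in> J. norm (A (f j)) > \<tau>}"
  then obtain g :: "nat \<Rightarrow> _" where g: "inj g" "range g \<subseteq> {j \<in> J. norm (A (f j)) > \<tau>}"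
    using infinite_countable_subset by blast
  have gJ: "g n \<in> J" "norm (A (f (g n))) > \<tau>" for n using g(2) by auto
  have lin: "clinear_on D A" and con: "\<And>x. x \<in> D \<Longrightarrow> norm (A x) \<le> norm x"
    and cpt: "compact (closure (A ` (D \<inter> cball 0 1)))"
    using A by (auto simp: compact_contraction_on_def)
  have "\<forall>n. A (f (g n)) \<in> closure (A ` (D \<inter> cball 0 1))"
    using f[OF gJ(1)] by (intro allI subsetD[OF closure_subset] imageI) auto
  then obtain y r where r: "strict_mono r" "((\<lambda>n. A (f (g n))) \<circ> r) \<longlonglongrightarrow> y"
    using cpt unfolding compact_def by meson
  define a where "a = (\<lambda>n. f (g (r n)))"
  have ay: "(\<lambda>n. A (a n)) \<longlonglongrightarrow> y" using r(2) by (simp add: a_def o_def)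
  have "norm y \<ge> \<tau>"
    by (rule LIMSEQ_le_const[OF tendsto_norm[OF ay]]) (use gJ(2) less_imp_le in \<open>auto simp: a_def\<close>)
  then have y: "norm y > 0" using \<tau> by linarith
  have "(\<lambda>n. inner (A (a n)) y) \<longlonglongrightarrow> inner y y"
    by (intro tendsto_intros ay)
  moreover have "inner y y / 2 < inner y y"
    using y by (simp flip: power2_norm_eq_inner)
  ultimately have "\<forall>\<^sub>F n in sequentially. inner y y / 2 < inner (A (a n)) y"
    by (rule order_tendstoD(1))
  then obtain n0 where n0: "\<And>n. n \<ge> n0 \<Longrightarrow> inner y y / 2 < inner (A (a n)) y"
    unfolding eventually_sequentially by blast
  have M: "real m * (norm y)\<^sup>2 \<le> 4 * M" for m
  proof (cases "m = 0")
    case True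
    have "0 \<le> M" using order_trans[OF zero_le_power2 bd[of "{g 0}"]] gJ(1) by simp
    then show ?thesis using True by simp
  next
    case False
    define F where "F = (g \<circ> r) ` {n0..<n0 + m}"
    have inj: "inj (g \<circ> r)" using g(1) r(1) by (simp add: inj_compose strict_mono_imp_inj_on)
    have F: "finite F" "F \<subseteq> J" "card F = m"
      using gJ(1) card_image[OF inj_on_subset[OF inj subset_UNIV]] by (auto simp: F_def)
    define x where "x = (\<Sum>j\<in>F. f j)"
    have xa: "x = (\<Sum>n=n0..<n0 + m. a n)"
      unfolding x_def F_def by (subst sum.reindex[OF inj_on_subset[OF inj subset_UNIV]])
        (simp add: a_def)
    have aD: "a n \<in> D" for n using f(1) gJ(1) by (auto simp: a_def)
    then have xD: "x \<in> D" unfolding xa by (intro cvec.subspace_sum[OF D])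
    have "A x = (\<Sum>n=n0..<n0 + m. A (a n))"
      unfolding xa using clinear_on_sum[OF D lin, of "{n0..<n0 + m}" a "\<lambda>_. 1"] aD by simp
    then have "inner (A x) y = (\<Sum>n=n0..<n0 + m. inner (A (a n)) y)"
      by (simp add: inner_sum_left)
    also have "\<dots> \<ge> (\<Sum>n=n0..<n0 + m. inner y y / 2)"
      using n0 by (intro sum_mono less_imp_le) auto
    finally have "real m * (norm y)\<^sup>2 / 2 \<le> inner (A x) y"
      by (simp add: power2_norm_eq_inner)
    also have "\<dots> \<le> norm (A x) * norm y" by (rule norm_cauchy_schwarz)
    also have "\<dots> \<le> norm x * norm y" using con[OF xD] by (intro mult_right_mono) auto
    finally have "real m * norm y / 2 \<le> norm x"
      using y by (simp add: power2_eq_square field_simps)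
    then have "(real m * norm y / 2)\<^sup>2 \<le> (norm x)\<^sup>2" by (intro power_mono) auto
    also have "\<dots> \<le> M * real m" using bd[OF F(1,2)] F(3) by (simp add: x_def)
    finally have "real m * (real m * (norm y)\<^sup>2) \<le> real m * (4 * M)"
      by (simp add: power2_eq_square field_simps)
    then show ?thesis using False by simp
  qed
  obtain m :: nat where "real m > 4 * M / (norm y)\<^sup>2" using reals_Archimedean2 by blast
  then have "4 * M < real m * (norm y)\<^sup>2" using y by (simp add: field_simps)
  then show False using M[of m] by simp
qed

lemma coord_unit_ell2: "coord (unit_ell2 k) i = (if i = k then 1 else 0)"
  unfolding unit_ell2_def
  by (subst coord_Abs) (auto intro!: summable_finite[of "{k}"] split: if_splits)

lemma cinner_unit_ell2: "cinner x (unit_ell2 k) = coord x k"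
  unfolding cinner_def
  by (subst suminf_finite[of "{k}"]) (auto simp: coord_unit_ell2)

lemma norm_unit_ell2: "norm (unit_ell2 k) = 1"
proof -
  have "complex_of_real ((norm (unit_ell2 k))\<^sup>2) = complex_of_real 1"
    using cinner_unit_ell2[of "unit_ell2 k" k] by (simp add: cinner_self_norm coord_unit_ell2)
  then have "(norm (unit_ell2 k))\<^sup>2 = 1" by (simp only: of_real_eq_iff)
  then show ?thesis by (simp add: power2_eq_1_iff)
      (smt (verit) norm_ge_zero)
qed

text \<open>By Bessel's inequality for \<open>unit_ell2 k\<close>, at most \<open>(Suc m)^2\<close>
  members have a k-th coordinate above \<open>1 / Suc m\<close> in modulus, and every nonzero vector
  has a nonzero coordinate. This lets a maximal orthonormal set be indexed by natural
  numbers.\<close>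

lemma countable_orthonormal:
  assumes "orthonormal E (\<lambda>x. x)"
  shows "countable E"
proof -
  have fin: "finite {e \<in> E. cmod (coord e k) > 1 / Suc m}" for k m
  proof -
    have "card G \<le> (Suc m)\<^sup>2" if G: "G \<subseteq> {e \<in> E. cmod (coord e k) > 1 / Suc m}" "finite G" for G
    proof -
      have "(\<Sum>e\<in>G. (1 / Suc m)\<^sup>2) \<le> (\<Sum>e\<in>G. (cmod (cinner (unit_ell2 k) e))\<^sup>2)"
      proof (intro sum_mono power_mono)
        fix e assume "e \<in> G"
        have "cmod (cinner (unit_ell2 k) e) = cmod (coord e k)"
          by (subst cinner_commute) (simp add: cinner_unit_ell2)
        then show "1 / Suc m \<le> cmod (cinner (unit_ell2 k) e)" using G \<open>e \<in> G\<close> by fastforce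
      qed simp
      also have "\<dots> \<le> (norm (unit_ell2 k))\<^sup>2"
        by (rule bessel_inequality) (use G assms in \<open>auto intro: orthonormal_subset\<close>)
      finally have "real (card G) * (1 / Suc m)\<^sup>2 \<le> 1" by (simp add: norm_unit_ell2)
      then have "real (card G) \<le> (real (Suc m))\<^sup>2" by (simp add: power_divide divide_simps)
      then show ?thesis by (metis of_nat_le_iff of_nat_power)
    qed
    then show ?thesis using finite_if_finite_subsets_card_bdd by blast
  qed
  have "E \<subseteq> (\<Union>k. \<Union>m. {e \<in> E. cmod (coord e k) > 1 / Suc m})"
  proof
    fix e assume e: "e \<in> E"
    then have "e \<noteq> 0" using assms by (force simp: orthonormal_def)
    then obtain k where "coord e k \<noteq> 0" using ell2_eqI[of e 0] by auto
    then obtain m where "inverse (real (Suc m)) < cmod (coord e k)"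
      using reals_Archimedean[of "cmod (coord e k)"] by auto
    then show "e \<in> (\<Union>k. \<Union>m. {e \<in> E. cmod (coord e k) > 1 / Suc m})"
      using e by (auto simp: inverse_eq_divide)
  qed
  then show ?thesis
    by (rule countable_subset) (intro countable_UN countable_finite fin countableI_type)
qed

section \<open>Canonical systems\<close>

text \<open>For a unit vector this is the eigenvector equation of \<open>A\<close> followed by its
  adjoint, with eigenvalue the square of \<open>norm (A v)\<close>. The weak form makes sense before
  an adjoint has been constructed.\<close>

definition singular_vector :: "ell2 set \<Rightarrow> (ell2 \<Rightarrow> ell2) \<Rightarrow> ell2 \<Rightarrow> bool" where
  "singular_vector D A v \<longleftrightarrow> v \<in> D \<and>
     (\<forall>x\<in>D. cinner (A x) (A v) = (norm (A v))\<^sup>2 * cinner x v)"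

lemma closed_csubspace_orthogonal:
  assumes "closed_csubspace D"
  shows "closed_csubspace {x \<in> D. \<forall>e\<in>E. cinner x e = 0}"
proof -
  have "cvec.subspace {x \<in> D. \<forall>e\<in>E. cinner x e = 0}"
    using assms unfolding closed_csubspace_def
    by (intro cvec.subspaceI)
      (auto simp: cinner_add_left cinner_scaleC_left cvec.subspace_0 cvec.subspace_add
        cvec.subspace_scale)
  moreover have "closed {x. cinner x e = 0}" for e
    by (rule closed_Collect_eq)
      (rule bounded_bilinear.continuous_on[OF bounded_bilinear_cinner] continuous_on_id
        continuous_on_const)+
  then have "closed (D \<inter> (\<Inter>e\<in>E. {x. cinner x e = 0}))"
    using assms unfolding closed_csubspace_def by (intro closed_Int closed_INT) auto
  moreover have "D \<inter> (\<Inter>e\<in>E. {x. cinner x e = 0}) = {x \<in> D. \<forall>e\<in>E. cinner x e = 0}" by auto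
  ultimately show ?thesis by (simp add: closed_csubspace_def)
qed

text \<open>The relation is linear in \<open>p\<close> and survives limits by continuity of
  \<open>A\<close> on \<open>D\<close>, so relations of adjoint type need only be checked on a
  spanning set.\<close>

lemma cinner_closed_cspan_cong:
  assumes D: "closed_csubspace D" and A: "compact_contraction_on D A" and SD: "S \<subseteq> D"
    and S: "\<And>e. e \<in> S \<Longrightarrow> cinner (A e) y = cinner e z" and p: "p \<in> closed_cspan S"
  shows "cinner (A p) y = cinner p z"
proof -
  have sub: "cvec.subspace D" and lin: "clinear_on D A" and con: "\<And>x. x \<in> D \<Longrightarrow> norm (A x) \<le> norm x"
    using D A by (auto simp: closed_csubspace_def compact_contraction_on_def)
  have pD: "p \<in> D" using closed_cspan_minimal[OF SD D] p by blast
  have sub': "cvec.subspace {p \<in> D. cinner (A p) y = cinner p z}"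
    by (rule cvec.subspaceI)
      (auto simp: cinner_add_left cinner_scaleC_left cvec.subspace_0[OF sub] cvec.subspace_add[OF sub]
        cvec.subspace_scale[OF sub] clinear_on_0[OF sub lin] clinear_on_add[OF sub lin]
        clinear_on_scale[OF sub lin])
  have span: "cvec.span S \<subseteq> {p \<in> D. cinner (A p) y = cinner p z}"
    by (rule cvec.span_minimal[OF _ sub']) (use S SD in auto)
  obtain f where f: "\<And>n. f n \<in> cvec.span S" "f \<longlonglongrightarrow> p"
    using p unfolding closed_cspan_def closure_sequential by blast
  have f': "f n \<in> D" "cinner (A (f n)) y = cinner (f n) z" for n
    using f(1)[of n] span by auto
  have "(\<lambda>n. A (f n)) \<longlonglongrightarrow> A p"
    by (rule bounded_clinear_tendsto[OF sub lin, where M = 1]) (use con f f' pD in auto)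
  then have "(\<lambda>n. cinner (A (f n)) y) \<longlonglongrightarrow> cinner (A p) y"
    by (intro tendsto_intros)
  moreover have "(\<lambda>n. cinner (A (f n)) y) \<longlonglongrightarrow> cinner p z"
    unfolding f' by (intro tendsto_intros f)
  ultimately show ?thesis by (rule LIMSEQ_unique)
qed

text \<open>A maximal orthonormal set of singular vectors has to span \<open>D\<close>. On its
  orthogonal complement either \<open>A\<close> vanishes, and then every unit vector there is
  singular, or there is a maximizing vector; both would enlarge the set.\<close>

theorem singular_value_decomposition:
  assumes D: "closed_csubspace D" and A: "compact_contraction_on D A"
  obtains I :: "nat set" and \<xi> where "orthonormal I \<xi>" "closed_cspan (\<xi> ` I) = D"
    "\<And>i. i \<in> I \<Longrightarrow> singular_vector D A (\<xi> i)"
proof -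
  have sub: "cvec.subspace D" and lin: "clinear_on D A"
    using D A by (auto simp: closed_csubspace_def compact_contraction_on_def)
  \<comment> \<open>Sets instead of indexed families are used so that Zorn's lemma applies to
    inclusion; the index set is attached afterwards.\<close>
  define \<S> where "\<S> = {E. orthonormal E (\<lambda>x. x) \<and> (\<forall>e\<in>E. singular_vector D A e)}"
  have "\<exists>M\<in>\<S>. \<forall>X\<in>\<S>. M \<subseteq> X \<longrightarrow> X = M"
  proof (rule subset_Zorn')
    fix C assume C: "subset.chain \<S> C"
    have "cinner x y = (if x = y then 1 else 0)" if xy: "x \<in> \<Union>C" "y \<in> \<Union>C" for x y
    proof -
      obtain X Y where "X \<in> C" "x \<in> X" "Y \<in> C" "y \<in> Y" using xy by blast
      moreover from this have "X \<subseteq> Y \<or> Y \<subseteq> X" using C by (meson subset_chain_def)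
      ultimately obtain Z where "Z \<in> C" "x \<in> Z" "y \<in> Z" by blast
      then show ?thesis using C unfolding subset_chain_def \<S>_def orthonormal_def by blast
    qed
    moreover have "singular_vector D A e" if "e \<in> \<Union>C" for e
      using that C unfolding subset_chain_def \<S>_def by blast
    ultimately show "\<Union>C \<in> \<S>" unfolding \<S>_def orthonormal_def by blast
  qed
  then obtain E where E: "E \<in> \<S>" and max: "\<And>X. X \<in> \<S> \<Longrightarrow> E \<subseteq> X \<Longrightarrow> X = E" by blast
  have Eo: "orthonormal E (\<lambda>x. x)" and Esv: "\<And>e. e \<in> E \<Longrightarrow> singular_vector D A e"
    using E by (auto simp: \<S>_def)
  have ED: "E \<subseteq> D" using Esv by (auto simp: singular_vector_def)
  obtain f :: "ell2 \<Rightarrow> nat" where f: "inj_on f E"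
    using countable_orthonormal[OF Eo] unfolding countable_def by blast
  define I where "I = f ` E"
  define \<xi> where "\<xi> = inv_into E f"
  have \<xi>E: "\<xi> ` I = E" unfolding \<xi>_def I_def using f by simp
  have \<xi>inj: "inj_on \<xi> I" unfolding \<xi>_def I_def by (rule inj_on_inv_into) simp
  have on: "orthonormal I \<xi>"
    unfolding orthonormal_def
  proof (intro ballI)
    fix i j assume ij: "i \<in> I" "j \<in> I"
    then have "\<xi> i \<in> E" "\<xi> j \<in> E" using \<xi>E by auto
    then show "cinner (\<xi> i) (\<xi> j) = (if i = j then 1 else 0)"
      using Eo ij \<xi>inj by (auto simp: orthonormal_def inj_on_def)
  qed
  have "closed_cspan (\<xi> ` I) = D"
  proof (rule orthonormal_total[OF on D])
    show "\<xi> ` I \<subseteq> D" by (simp add: \<xi>E ED)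
    fix x assume x: "x \<in> D" and xo: "\<And>i. i \<in> I \<Longrightarrow> cinner x (\<xi> i) = 0"
    define N where "N = {x \<in> D. \<forall>e\<in>E. cinner x e = 0}"
    have N: "closed_csubspace N" unfolding N_def by (rule closed_csubspace_orthogonal[OF D])
    have ND: "N \<subseteq> D" by (auto simp: N_def)
    have xN: "x \<in> N" using x xo \<xi>E by (force simp: N_def)
    show "x = 0"
    proof (rule ccontr)
      assume x0: "x \<noteq> 0"
      have "\<exists>v\<in>N. norm v = 1 \<and> singular_vector D A v"
      proof (cases "\<exists>z\<in>N. A z \<noteq> 0")
        case True
        then obtain z where z: "z \<in> N" "A z \<noteq> 0" by blast
        obtain v where v: "v \<in> N" "norm v = 1" "A v \<noteq> 0"
          "\<And>x. x \<in> N \<Longrightarrow> cinner (A x) (A v) = (norm (A v))\<^sup>2 * cinner x v"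
          using maximizing_vector[OF N compact_contraction_on_subset[OF A ND] z] by metis
        \<comment> \<open>\<open>maximizing_vector\<close> tests only against \<open>N\<close>.
          Splitting \<open>x\<close> along the closed span of \<open>E\<close> extends the relation
          to \<open>D\<close>, because the images of \<open>E\<close> are orthogonal to
          \<open>A v\<close>.\<close>
        have "cinner (A x) (A v) = (norm (A v))\<^sup>2 * cinner x v" if x: "x \<in> D" for x
        proof -
          obtain p where p: "p \<in> closed_cspan (\<xi> ` I)" "\<And>i. i \<in> I \<Longrightarrow> cinner (x - p) (\<xi> i) = 0"
            using orthogonal_decomposition[OF on] by metis
          have pD: "p \<in> D" using closed_cspan_minimal[OF ED D] p(1) \<xi>E by auto
          have xp: "x - p \<in> N"
            using p(2) \<xi>E x pD cvec.subspace_diff[OF sub] by (force simp: N_def)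
          have "cinner (A p) (A v) = cinner p ((norm (A v))\<^sup>2 *\<^sub>C v)"
          proof (rule cinner_closed_cspan_cong[OF D A ED])
            fix e assume e: "e \<in> E"
            have ve: "cinner v e = 0" using v(1) e by (simp add: N_def)
            then have "cinner (A v) (A e) = 0"
              using Esv[OF e] v(1) ND by (auto simp: singular_vector_def)
            then have "cinner (A e) (A v) = 0" using cinner_eq_zero_commute by blast
            moreover have "cinner e v = 0" using ve cinner_eq_zero_commute by blast
            ultimately show "cinner (A e) (A v) = cinner e ((norm (A v))\<^sup>2 *\<^sub>C v)"
              by (simp add: cinner_scaleC_right)
          qed (use p \<xi>E in simp)
          moreover have "cinner (A (x - p)) (A v) = (norm (A v))\<^sup>2 * cinner (x - p) v"
            by (rule v(4)[OF xp])
          ultimately show ?thesis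
            by (simp add: clinear_on_diff[OF sub lin x pD] cinner_diff_left cinner_scaleC_right
                algebra_simps)
        qed
        then show ?thesis using v ND by (auto simp: singular_vector_def)
      next
        case False
        define v where "v = complex_of_real (1 / norm x) *\<^sub>C x"
        have vN: "v \<in> N" using xN N cvec.subspace_scale unfolding v_def closed_csubspace_def by blast
        moreover have "norm v = 1" using x0 by (simp add: v_def norm_scaleC norm_divide)
        moreover have "A v = 0" using False vN by blast
        ultimately show ?thesis using ND by (auto simp: singular_vector_def)
      qed
      then obtain v where v: "v \<in> N" "norm v = 1" "singular_vector D A v" by blast
      have ve: "cinner v e = 0" "cinner e v = 0" if "e \<in> E" for e
        using v(1) that cinner_eq_zero_commute by (auto simp: N_def)
      have vv: "cinner v v = 1" using v(2) by (simp add: cinner_self_norm)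
      have "v \<notin> E" using ve vv by fastforce
      moreover have "insert v E \<in> \<S>"
        using Eo Esv v(3) ve vv \<open>v \<notin> E\<close> unfolding \<S>_def orthonormal_def by auto
      ultimately show False using max[of "insert v E"] by blast
    qed
  qed
  then show thesis using that[OF on] Esv \<xi>E by blast
qed

lemma closed_cspan_ext:
  assumes "v \<in> closed_cspan S" "w \<in> closed_cspan S" "\<And>e. e \<in> S \<Longrightarrow> cinner v e = cinner w e"
  shows "v = w"
proof -
  have "cinner (v - w) (v - w) = 0"
  proof (rule orthogonal_closed_cspan)
    show "cinner e (v - w) = 0" if "e \<in> S" for e
      using assms(3)[OF that] by (subst cinner_eq_zero_commute) (simp add: cinner_diff_left)
    show "v - w \<in> closed_cspan S"
      by (intro cvec.subspace_diff subspace_closed_cspan assms)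
  qed
  then show ?thesis by (simp add: cinner_self_norm)
qed

text \<open>Everything is defined through coefficients in a basis of singular vectors: the modulus
  \<open>B\<close> multiplies them by the singular values, and the adjoint \<open>T\<close> has the
  coefficients \<open>cinner y (A (\<xi> i))\<close>. Identities in \<open>D\<close> are then
  checked coefficientwise by \<open>eqI\<close>.\<close>

lemma canonical_system_exists:
  assumes D: "closed_csubspace D" and A: "compact_contraction_on D A"
  obtains I :: "nat set" and \<xi> where "is_canonical_system D A I \<xi>"
proof -
  have sub: "cvec.subspace D" and cl: "closed D" and lin: "clinear_on D A"
    and con: "\<And>x. x \<in> D \<Longrightarrow> norm (A x) \<le> norm x"
    using D A by (auto simp: closed_csubspace_def compact_contraction_on_def)
  obtain I :: "nat set" and \<xi> where on: "orthonormal I \<xi>" and tot: "closed_cspan (\<xi> ` I) = D"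
    and sv: "\<And>i. i \<in> I \<Longrightarrow> singular_vector D A (\<xi> i)"
    using singular_value_decomposition[OF D A] by metis
  define s where "s = (\<lambda>i. norm (A (\<xi> i)))"
  have \<xi>D: "\<xi> i \<in> D" if "i \<in> I" for i using sv that by (simp add: singular_vector_def)
  have AA: "cinner (A x) (A (\<xi> i)) = (s i)\<^sup>2 * cinner x (\<xi> i)" if "i \<in> I" "x \<in> D" for i x
    using sv[OF that(1)] that by (simp add: singular_vector_def s_def)
  have s: "0 \<le> s i" for i by (simp add: s_def)
  have s1: "s i \<le> 1" if "i \<in> I" for i
    using con[OF \<xi>D[OF that]] orthonormal_norm[OF on that] by (simp add: s_def)
  have eqI: "v = w" if "v \<in> D" "w \<in> D" "\<And>i. i \<in> I \<Longrightarrow> cinner v (\<xi> i) = cinner w (\<xi> i)" for v w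
    by (rule closed_cspan_ext[of _ "\<xi> ` I"]) (use that tot in auto)
  have "\<exists>v. v \<in> D \<and> (\<forall>i\<in>I. cinner v (\<xi> i) = s i * cinner x (\<xi> i)) \<and> (norm v)\<^sup>2 \<le> (norm x)\<^sup>2"
    for x
  proof -
    have "(\<Sum>i\<in>I \<inter> {..<n}. (cmod (s i * cinner x (\<xi> i)))\<^sup>2) \<le> (norm x)\<^sup>2" for n
    proof -
      have "(\<Sum>i\<in>I \<inter> {..<n}. (cmod (s i * cinner x (\<xi> i)))\<^sup>2)
          \<le> (\<Sum>i\<in>I \<inter> {..<n}. (cmod (cinner x (\<xi> i)))\<^sup>2)"
        using s s1 by (intro sum_mono power_mono) (auto simp: norm_mult intro!: mult_left_le_one_le)
      also have "\<dots> \<le> (norm x)\<^sup>2"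
        by (intro bessel_inequality orthonormal_subset[OF on]) auto
      finally show ?thesis .
    qed
    from riesz_fischer[OF on this] tot show ?thesis by metis
  qed
  then obtain B where B: "\<And>x. B x \<in> D" "\<And>x i. i \<in> I \<Longrightarrow> cinner (B x) (\<xi> i) = s i * cinner x (\<xi> i)"
    "\<And>x. (norm (B x))\<^sup>2 \<le> (norm x)\<^sup>2" by metis
  have "\<exists>v. v \<in> D \<and> (\<forall>i\<in>I. cinner v (\<xi> i) = cinner y (A (\<xi> i)))" for y
  proof -
    \<comment> \<open>A duality argument: the partial sum \<open>S\<close> equals
      \<open>cinner y (A z)\<close> for a vector \<open>z\<close> whose squared norm is again
      \<open>S\<close>, so S^2 is at most S times the square of \<open>norm y\<close>.\<close>
    have "(\<Sum>i\<in>I \<inter> {..<n}. (cmod (cinner y (A (\<xi> i))))\<^sup>2) \<le> (norm y)\<^sup>2" for n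
    proof -
      define F where "F = I \<inter> {..<n}"
      define S where "S = (\<Sum>i\<in>F. (cmod (cinner y (A (\<xi> i))))\<^sup>2)"
      define z where "z = (\<Sum>i\<in>F. cinner y (A (\<xi> i)) *\<^sub>C \<xi> i)"
      have F: "finite F" "F \<subseteq> I" by (auto simp: F_def)
      have S0: "S \<ge> 0" by (simp add: S_def sum_nonneg)
      have zD: "z \<in> D" unfolding z_def
        using F \<xi>D by (intro cvec.subspace_sum[OF sub] cvec.subspace_scale[OF sub]) auto
      have "A z = (\<Sum>i\<in>F. cinner y (A (\<xi> i)) *\<^sub>C A (\<xi> i))"
        unfolding z_def using F \<xi>D by (intro clinear_on_sum[OF sub lin]) auto
      then have "cinner y (A z) = complex_of_real S"
        by (simp add: S_def cinner_sum_right cinner_scaleC_right complex_norm_square mult.commute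
            del: of_real_power)
      then have "S = cmod (cinner y (A z))" using S0 by simp
      also have "\<dots> \<le> norm y * norm z"
        using cinner_Cauchy_Schwarz[of y "A z"] con[OF zD] by (smt (verit) mult_left_mono norm_ge_zero)
      finally have "S\<^sup>2 \<le> (norm y * norm z)\<^sup>2" using S0 by (intro power_mono) auto
      also have "\<dots> = (norm y)\<^sup>2 * S"
        using norm_sum_orthonormal[OF F(1) orthonormal_subset[OF on F(2)]]
        by (simp add: power_mult_distrib z_def S_def)
      finally have "S * S \<le> (norm y)\<^sup>2 * S" by (simp add: power2_eq_square)
      then have "S \<le> (norm y)\<^sup>2" using S0 by (cases "S = 0") auto
      then show ?thesis by (simp add: S_def F_def)
    qed
    from riesz_fischer[OF on this] tot show ?thesis by metis
  qed
  then obtain T where T: "\<And>y. T y \<in> D" "\<And>y i. i \<in> I \<Longrightarrow> cinner (T y) (\<xi> i) = cinner y (A (\<xi> i))"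
    by metis
  have adj: "is_adjoint D A T"
    unfolding is_adjoint_def
  proof (intro conjI ballI allI)
    show "range T \<subseteq> D" using T by blast
    show "cinner (A x) y = cinner x (T y)" if "x \<in> D" for x y
    proof (rule cinner_closed_cspan_cong[OF D A])
      show "\<xi> ` I \<subseteq> D" using \<xi>D by blast
      show "x \<in> closed_cspan (\<xi> ` I)" using tot that by simp
      show "cinner (A e) y = cinner e (T y)" if "e \<in> \<xi> ` I" for e
        using that T(2)[of _ y] by (subst (1 2) cinner_commute) auto
    qed
  qed
  have BB: "B (B x) = T (A x)" if "x \<in> D" for x
    by (rule eqI) (use B T AA that in \<open>auto simp: power2_eq_square\<close>)
  have Blin: "clinear_on D B"
    unfolding clinear_on_def
    by (intro conjI ballI allI; rule eqI)
      (auto simp: B cinner_add_left cinner_scaleC_left algebra_simps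
        intro!: cvec.subspace_add[OF sub] cvec.subspace_scale[OF sub])
  have Bpos: "cinner (B x) x \<in> \<real>" "Re (cinner (B x) x) \<ge> 0" if x: "x \<in> D" for x
  proof -
    \<comment> \<open>Pairing with the Fourier partial sums of \<open>x\<close> exhibits the
      quadratic form of \<open>B\<close> as a limit of nonnegative real sums.\<close>
    have "(\<lambda>n. cinner (B x) (\<Sum>i\<in>I \<inter> {..<n}. cinner x (\<xi> i) *\<^sub>C \<xi> i)) \<longlonglongrightarrow> cinner (B x) x"
      by (intro tendsto_intros fourier_expansion[OF on]) (use tot x in simp)
    moreover have "cinner (B x) (\<Sum>i\<in>I \<inter> {..<n}. cinner x (\<xi> i) *\<^sub>C \<xi> i)
        = complex_of_real (\<Sum>i\<in>I \<inter> {..<n}. s i * (cmod (cinner x (\<xi> i)))\<^sup>2)" for n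
      by (simp add: cinner_sum_right cinner_scaleC_right B(2) of_real_cmod_sq mult.commute mult.assoc
          mult.left_commute)
    ultimately have lim: "(\<lambda>n. complex_of_real (\<Sum>i\<in>I \<inter> {..<n}. s i * (cmod (cinner x (\<xi> i)))\<^sup>2))
        \<longlonglongrightarrow> cinner (B x) x" by simp
    show "cinner (B x) x \<in> \<real>"
      by (rule closed_sequentially[OF closed_complex_Reals _ lim]) simp
    show "Re (cinner (B x) x) \<ge> 0"
      by (rule LIMSEQ_le_const[OF tendsto_Re[OF lim]])
        (auto intro!: exI[of _ 0] sum_nonneg mult_nonneg_nonneg s)
  qed
  have "is_modulus D A B"
    unfolding is_modulus_def
  proof (intro conjI)
    show "\<exists>M. \<forall>x\<in>D. norm (B x) \<le> M * norm x"
      using B(3) by (intro exI[of _ 1]) (auto intro: power2_le_imp_le)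
    show "\<exists>S. is_adjoint D A S \<and> (\<forall>x\<in>D. B (B x) = S (A x))"
      using adj BB by blast
  qed (use Blin Bpos B(1) in auto)
  moreover define I0 I1 where "I0 = {i \<in> I. s i = 0}" and "I1 = {i \<in> I. s i > 0}"
  have I: "I = I0 \<union> I1" "I0 \<inter> I1 = {}" using s by (auto simp: I0_def I1_def less_le)
  have B\<xi>: "B (\<xi> i) = s i *\<^sub>R \<xi> i" if i: "i \<in> I" for i
  proof (rule eqI)
    show "s i *\<^sub>R \<xi> i \<in> D"
      using \<xi>D[OF i] cvec.subspace_scale[OF sub] by (simp add: scaleR_scaleC)
    show "cinner (B (\<xi> i)) (\<xi> j) = cinner (s i *\<^sub>R \<xi> i) (\<xi> j)" if "j \<in> I" for j
      using on i that B(2)[OF that] by (auto simp: orthonormal_def scaleR_scaleC cinner_scaleC_left)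
  qed (rule B(1))
  have B\<xi>_iff: "B (\<xi> i) = t *\<^sub>R \<xi> i \<longleftrightarrow> s i = t" if "i \<in> I" for i t
    using B\<xi>[OF that] orthonormal_norm[OF on that] by auto
  have eig: "{x \<in> D. B x = t *\<^sub>R x} = cvec.span (\<xi> ` {i \<in> I1. B (\<xi> i) = t *\<^sub>R \<xi> i})"
    (is "_ = cvec.span (\<xi> ` ?K)") if t: "t > 0" for t
  proof
    have "cvec.subspace {x \<in> D. B x = t *\<^sub>R x}"
      by (rule cvec.subspaceI)
        (use Blin sub clinear_on_0[OF sub Blin] in
          \<open>auto simp: clinear_on_def cvec.subspace_0 cvec.subspace_add cvec.subspace_scale
            scaleR_add_right scaleR_scaleC scaleC_scaleC mult.commute scaleC_add_right\<close>)
    then show "cvec.span (\<xi> ` ?K) \<subseteq> {x \<in> D. B x = t *\<^sub>R x}"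
      by (intro cvec.span_minimal) (use \<xi>D in \<open>auto simp: I1_def\<close>)
    have K: "?K = {i \<in> I. s i = t}" using t B\<xi>_iff by (auto simp: I1_def)
    have bd: "(norm (\<Sum>j\<in>F. \<xi> j))\<^sup>2 \<le> 1 * real (card F)" if "finite F" "F \<subseteq> I" for F
      using norm_sum_orthonormal[OF that(1) orthonormal_subset[OF on that(2)], of "\<lambda>_. 1"]
      by (simp add: scaleC_one)
    \<comment> \<open>Finite multiplicity lets the algebraic span, without closure, exhaust the
      eigenspace. The threshold \<open>t / 2\<close> provides the strict inequality when
      \<open>s i = t\<close>.\<close>
    have "finite {i \<in> I. norm (A (\<xi> i)) > t / 2}"
      by (rule finite_large_image[OF sub A _ _ bd]) (use \<xi>D orthonormal_norm[OF on] t in auto)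
    then have fK: "finite ?K"
      unfolding K by (rule rev_finite_subset) (use t in \<open>auto simp: s_def\<close>)
    have KI: "?K \<subseteq> I" by (auto simp: I1_def)
    show "{x \<in> D. B x = t *\<^sub>R x} \<subseteq> cvec.span (\<xi> ` ?K)"
    proof clarify
      fix x assume x: "x \<in> D" "B x = t *\<^sub>R x"
      have "x = (\<Sum>i\<in>?K. cinner x (\<xi> i) *\<^sub>C \<xi> i)"
      proof (rule eqI[OF x(1)])
        show "(\<Sum>i\<in>?K. cinner x (\<xi> i) *\<^sub>C \<xi> i) \<in> D"
          using \<xi>D KI by (intro cvec.subspace_sum[OF sub] cvec.subspace_scale[OF sub]) auto
        fix j assume j: "j \<in> I"
        have "t * cinner x (\<xi> j) = s j * cinner x (\<xi> j)"
          using B(2)[OF j, of x] x(2) by (simp add: scaleR_scaleC cinner_scaleC_left)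
        then have "cinner x (\<xi> j) = 0" if "s j \<noteq> t" using that by auto
        then show "cinner x (\<xi> j) = cinner (\<Sum>i\<in>?K. cinner x (\<xi> i) *\<^sub>C \<xi> i) (\<xi> j)"
          unfolding cinner_orthonormal_sum_single[OF fK KI on j] unfolding K using j by auto
      qed
      then show "x \<in> cvec.span (\<xi> ` ?K)"
        by (metis (no_types, lifting) cvec.span_sum cvec.span_scale cvec.span_base imageI)
    qed
  qed
  have ker: "closed_cspan (\<xi> ` I0) = {x \<in> D. A x = 0}"
  proof
    have "cvec.subspace {x \<in> D. A x = 0}"
      by (rule cvec.subspaceI)
        (use lin sub clinear_on_0[OF sub lin] in
          \<open>auto simp: clinear_on_def cvec.subspace_0 cvec.subspace_add cvec.subspace_scale\<close>)
    moreover have "closed {x \<in> D. A x = 0}"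
      unfolding closed_sequential_limits
    proof (intro allI impI)
      fix x l assume xl: "(\<forall>n. x n \<in> {x \<in> D. A x = 0}) \<and> x \<longlonglongrightarrow> l"
      then have l: "l \<in> D" using closed_sequentially[OF cl, of x l] by blast
      have "(\<lambda>n. A (x n)) \<longlonglongrightarrow> A l"
        by (rule bounded_clinear_tendsto[OF sub lin, where M = 1]) (use con xl l in auto)
      then have "A l = 0" using xl by (simp add: LIMSEQ_const_iff)
      then show "l \<in> {x \<in> D. A x = 0}" using l by simp
    qed
    ultimately show "closed_cspan (\<xi> ` I0) \<subseteq> {x \<in> D. A x = 0}"
      by (intro closed_cspan_minimal) (use \<xi>D in \<open>auto simp: I0_def s_def closed_csubspace_def\<close>)
    show "{x \<in> D. A x = 0} \<subseteq> closed_cspan (\<xi> ` I0)"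
    proof clarify
      fix x assume x: "x \<in> D" "A x = 0"
      have z: "cinner x (\<xi> i) = 0" if "i \<in> I1" for i
        using AA[of i x] x that by (auto simp: I1_def)
      have "(\<Sum>i\<in>I \<inter> {..<n}. cinner x (\<xi> i) *\<^sub>C \<xi> i) \<in> cvec.span (\<xi> ` I0)" for n
      proof (intro cvec.span_sum)
        fix i assume i: "i \<in> I \<inter> {..<n}"
        show "cinner x (\<xi> i) *\<^sub>C \<xi> i \<in> cvec.span (\<xi> ` I0)"
        proof (cases "i \<in> I0")
          case True
          then show ?thesis by (intro cvec.span_scale cvec.span_base) auto
        next
          case False
          then have "cinner x (\<xi> i) = 0" using i I z by auto
          then show ?thesis by (simp add: cvec.span_zero)
        qed
      qed
      moreover have "(\<lambda>n. \<Sum>i\<in>I \<inter> {..<n}. cinner x (\<xi> i) *\<^sub>C \<xi> i) \<longlonglongrightarrow> x"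
        by (rule fourier_expansion[OF on]) (use tot x in simp)
      ultimately show "x \<in> closed_cspan (\<xi> ` I0)"
        unfolding closed_cspan_def closure_sequential
        by (intro exI[of _ "\<lambda>n. \<Sum>i\<in>I \<inter> {..<n}. cinner x (\<xi> i) *\<^sub>C \<xi> i"]) simp
    qed
  qed
  have pos: "\<forall>i\<in>I1. \<exists>s::real. s > 0 \<and> B (\<xi> i) = s *\<^sub>R \<xi> i"
    using B\<xi> by (auto simp: I1_def)
  have "orthonormal I0 \<xi>" "orthonormal I1 \<xi>" "\<xi> ` I1 \<subseteq> D"
    using on \<xi>D I by (auto intro: orthonormal_subset)
  ultimately have "is_canonical_system D A I \<xi>"
    unfolding is_canonical_system_def using I eig ker pos by blast
  then show thesis by (rule that)
qed

text \<open>Polarization: reality of the form at \<open>x + c *\<^sub>C y\<close> makes the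
  imaginary part of the cross terms vanish, and c = 1 and c = \<i> together give conjugate
  symmetry.\<close>

lemma positive_symmetric:
  assumes D: "cvec.subspace D" and lin: "clinear_on D B" and pos: "\<And>x. x \<in> D \<Longrightarrow> cinner (B x) x \<in> \<real>"
    and x: "x \<in> D" and y: "y \<in> D"
  shows "cinner (B x) y = cinner x (B y)"
proof -
  have im: "Im (cinner (B x) (c *\<^sub>C y) + cinner (B (c *\<^sub>C y)) x) = 0" for c
  proof -
    have cy: "c *\<^sub>C y \<in> D" using y cvec.subspace_scale[OF D] by blast
    have "cinner (B (x + c *\<^sub>C y)) (x + c *\<^sub>C y) \<in> \<real>" "cinner (B x) x \<in> \<real>"
      "cinner (B (c *\<^sub>C y)) (c *\<^sub>C y) \<in> \<real>"
      using x cy by (intro pos cvec.subspace_add[OF D]; simp)+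
    then show ?thesis
      by (simp add: clinear_on_add[OF D lin x cy] cinner_add_left cinner_add_right
          complex_is_Real_iff)
  qed
  have B: "B (c *\<^sub>C y) = c *\<^sub>C B y" for c by (rule clinear_on_scale[OF D lin y])
  have "Im (cinner (B x) y) = - Im (cinner (B y) x)"
    using im[of 1] by (simp add: scaleC_one)
  moreover have "Re (cinner (B x) y) = Re (cinner (B y) x)"
    using im[of \<i>] by (simp add: B cinner_scaleC_left cinner_scaleC_right)
  ultimately have "cinner (B x) y = cnj (cinner (B y) x)" by (simp add: complex_eq_iff)
  then show ?thesis by (subst (2) cinner_commute)
qed

text \<open>A canonical system is given through an abstract modulus \<open>B\<close> and is
  orthonormal only within each of its two parts. The link to \<open>A\<close> is
  \<open>cinner (A x) (A y) = cinner (B x) (B y)\<close>, which rests on the symmetry of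
  \<open>B\<close>. Symmetry also separates the kernel from the eigenvectors with positive
  eigenvalue.\<close>

lemma canonical_system_properties:
  fixes I :: "nat set"
  assumes D: "closed_csubspace D" and A: "compact_contraction_on D A"
    and can: "is_canonical_system D A I \<xi>"
  shows canonical_system_orthonormal: "orthonormal I \<xi>"
    and canonical_system_span: "closed_cspan (\<xi> ` I) = D"
    and canonical_system_image_orthogonal:
      "\<And>i j. i \<in> I \<Longrightarrow> j \<in> I \<Longrightarrow> i \<noteq> j \<Longrightarrow> cinner (A (\<xi> i)) (A (\<xi> j)) = 0"
proof -
  have sub: "cvec.subspace D" and lin: "clinear_on D A"
    using D A by (auto simp: closed_csubspace_def compact_contraction_on_def)
  obtain B I0 I1 where mod: "is_modulus D A B"
    and I: "I = I0 \<union> I1" "I0 \<inter> I1 = {}"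
    and on1: "orthonormal I1 \<xi>" and \<xi>1: "\<xi> ` I1 \<subseteq> D"
    and ev: "\<forall>i\<in>I1. \<exists>s::real. s > 0 \<and> B (\<xi> i) = s *\<^sub>R \<xi> i"
    and eig: "\<forall>s::real. s > 0 \<longrightarrow>
           {x\<in>D. B x = s *\<^sub>R x} = cvec.span (\<xi> ` {i\<in>I1. B (\<xi> i) = s *\<^sub>R \<xi> i})"
    and on0: "orthonormal I0 \<xi>" and ker: "closed_cspan (\<xi> ` I0) = {x\<in>D. A x = 0}"
    using can unfolding is_canonical_system_def by (elim exE conjE) (rule that)
  obtain T where Blin: "clinear_on D B" and BD: "B ` D \<subseteq> D"
    and Bre: "\<forall>x\<in>D. cinner (B x) x \<in> \<real> \<and> Re (cinner (B x) x) \<ge> 0"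
    and adj: "is_adjoint D A T" and BB': "\<forall>x\<in>D. B (B x) = T (A x)"
    using mod unfolding is_modulus_def by (elim exE conjE) (rule that)
  have Bpos: "cinner (B x) x \<in> \<real>" "Re (cinner (B x) x) \<ge> 0" and BB: "B (B x) = T (A x)"
    if "x \<in> D" for x using Bre BB' that by auto
  note sym = positive_symmetric[OF sub Blin Bpos(1)]
  have AA: "cinner (A x) (A y) = cinner (B x) (B y)" if x: "x \<in> D" "y \<in> D" for x y
  proof -
    have "cinner (A x) (A y) = cinner x (B (B y))"
      using adj x BB[OF x(2)] by (simp add: is_adjoint_def)
    also have "\<dots> = cinner (B x) (B y)" using sym[of x "B y"] x BD by auto
    finally show ?thesis .
  qed
  have kerB: "B x = 0 \<longleftrightarrow> A x = 0" if "x \<in> D" for x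
    using AA[OF that that] by (auto simp: cinner_self_norm)
  have A0: "A (\<xi> i) = 0" and \<xi>0: "\<xi> i \<in> D" if "i \<in> I0" for i
    using closed_cspan_base[of "\<xi> i" "\<xi> ` I0"] that ker by auto
  have \<xi>D: "\<xi> i \<in> D" if "i \<in> I" for i using that I \<xi>0 \<xi>1 by auto
  obtain s where s: "\<And>i. i \<in> I1 \<Longrightarrow> s i > (0::real) \<and> B (\<xi> i) = s i *\<^sub>R \<xi> i"
    using bchoice[OF ev] by blast
  have cross: "cinner (\<xi> i) (\<xi> j) = 0" if i: "i \<in> I0" and j: "j \<in> I1" for i j
  proof -
    have "cinner (B (\<xi> i)) (\<xi> j) = cinner (\<xi> i) (B (\<xi> j))"
      using i j \<xi>0 \<xi>1 by (intro sym) auto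
    moreover have "B (\<xi> i) = 0" using kerB \<xi>0[OF i] A0[OF i] by blast
    ultimately show ?thesis using s[OF j] by (simp add: scaleR_scaleC cinner_scaleC_right)
  qed
  show on: "orthonormal I \<xi>"
    unfolding orthonormal_def
  proof (intro ballI)
    fix i j assume "i \<in> I" "j \<in> I"
    then consider "i \<in> I0" "j \<in> I0" | "i \<in> I1" "j \<in> I1" | "i \<in> I0" "j \<in> I1" | "i \<in> I1" "j \<in> I0"
      using I by blast
    then show "cinner (\<xi> i) (\<xi> j) = (if i = j then 1 else 0)"
    proof cases
      case 3
      then show ?thesis using cross I(2) by auto
    next
      case 4
      then show ?thesis using cross[OF 4(2,1)] cinner_eq_zero_commute[of "\<xi> i" "\<xi> j"] I(2) by auto
    qed (use on0 on1 in \<open>auto simp: orthonormal_def\<close>)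
  qed
  show "cinner (A (\<xi> i)) (A (\<xi> j)) = 0" if ij: "i \<in> I" "j \<in> I" "i \<noteq> j" for i j
  proof (cases "i \<in> I0 \<or> j \<in> I0")
    case True
    then show ?thesis using A0 by auto
  next
    case False
    then have "i \<in> I1" "j \<in> I1" using ij I by auto
    then show ?thesis
      using s ij on \<xi>D
      by (simp add: AA scaleR_scaleC cinner_scaleC_left cinner_scaleC_right orthonormal_def)
  qed
  show "closed_cspan (\<xi> ` I) = D"
  proof (rule orthonormal_total[OF on D])
    show "\<xi> ` I \<subseteq> D" using \<xi>D by blast
    fix x assume x: "x \<in> D" and xo: "\<And>i. i \<in> I \<Longrightarrow> cinner x (\<xi> i) = 0"
    define N where "N = {x \<in> D. \<forall>e\<in>\<xi> ` I. cinner x e = 0}"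
    have N: "closed_csubspace N" unfolding N_def by (rule closed_csubspace_orthogonal[OF D])
    have subN: "cvec.subspace N" using N by (simp add: closed_csubspace_def)
    have ND: "N \<subseteq> D" by (auto simp: N_def)
    have xN: "x \<in> N" using x xo by (simp add: N_def)
    have N0: "v = 0" if v: "v \<in> N" "v \<in> cvec.span (\<xi> ` K) \<or> v \<in> closed_cspan (\<xi> ` K)" "K \<subseteq> I" for v K
    proof -
      have vK: "v \<in> closed_cspan (\<xi> ` K)" using v(2) span_subset_closed_cspan by blast
      have "cinner v v = 0"
      proof (rule orthogonal_closed_cspan[OF _ vK])
        fix e assume "e \<in> \<xi> ` K"
        then have "cinner v e = 0" using v by (auto simp: N_def)
        then show "cinner e v = 0" using cinner_eq_zero_commute by blast
      qed
      then show ?thesis by (simp add: cinner_self_norm)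
    qed
    \<comment> \<open>By symmetry \<open>B\<close> leaves the orthogonal complement of its
      eigenvectors invariant.\<close>
    have BN: "B v \<in> N" if "v \<in> N" for v
    proof -
      have v: "v \<in> D" using that ND by blast
      have "cinner (B v) (\<xi> i) = 0" if i: "i \<in> I" for i
      proof (cases "i \<in> I0")
        case True
        have "cinner (B v) (\<xi> i) = cinner v (B (\<xi> i))" using v \<xi>D[OF i] by (intro sym)
        then show ?thesis using kerB[OF \<xi>0[OF True]] A0[OF True] by simp
      next
        case False
        then have "i \<in> I1" using i I by blast
        moreover have "cinner (B v) (\<xi> i) = cinner v (B (\<xi> i))" using v \<xi>D[OF i] by (intro sym)
        ultimately show ?thesis
          using s \<open>v \<in> N\<close> i by (simp add: N_def scaleR_scaleC cinner_scaleC_right)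
      qed
      then show ?thesis using BD v by (auto simp: N_def)
    qed
    show "x = 0"
    proof (rule ccontr)
      assume "x \<noteq> 0"
      then have "A x \<noteq> 0" using N0[OF xN, of I0] x ker I by auto
      then obtain v where v: "v \<in> N" "norm v = 1" "A v \<noteq> 0"
          "\<And>x. x \<in> N \<Longrightarrow> cinner (A x) (A v) = (norm (A v))\<^sup>2 * cinner x v"
        using maximizing_vector[OF N compact_contraction_on_subset[OF A ND] xN] by metis
      define \<sigma> where "\<sigma> = norm (A v)"
      have \<sigma>: "\<sigma> > 0" using v by (simp add: \<sigma>_def)
      have vD: "v \<in> D" using v ND by blast
      define u where "u = B (B v) - complex_of_real (\<sigma>\<^sup>2) *\<^sub>C v"
      have uN: "u \<in> N" unfolding u_def
        using v BN by (intro cvec.subspace_diff[OF subN] cvec.subspace_scale[OF subN]) auto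
      have "cinner u u = cinner u (B (B v)) - complex_of_real (\<sigma>\<^sup>2) * cinner u v"
        by (subst (2) u_def) (simp add: cinner_diff_right cinner_scaleC_right)
      also have "cinner u (B (B v)) = cinner (A u) (A v)"
        using adj BB[OF vD] vD uN ND by (auto simp: is_adjoint_def)
      also have "\<dots> = complex_of_real (\<sigma>\<^sup>2) * cinner u v" using v(4)[OF uN] by (simp add: \<sigma>_def)
      finally have "u = 0" by (simp add: cinner_self_norm)
      then have BBv: "B (B v) = complex_of_real (\<sigma>\<^sup>2) *\<^sub>C v" by (simp add: u_def)
      \<comment> \<open>The product of \<open>B - \<sigma>\<close> and \<open>B + \<sigma>\<close>
        annihilates \<open>v\<close>, so \<open>y\<close> satisfies the eigenvector equation for
        \<sigma>. It then lies in the span of the system and also in its complement, hence is 0,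
        whereas positivity of \<open>B\<close> makes the real part of \<open>cinner y v\<close> at
        least \<sigma>.\<close>
      define y where "y = B v + complex_of_real \<sigma> *\<^sub>C v"
      have yN: "y \<in> N" unfolding y_def
        using v BN by (intro cvec.subspace_add[OF subN] cvec.subspace_scale[OF subN]) auto
      have "B y = B (B v) + complex_of_real \<sigma> *\<^sub>C B v"
        unfolding y_def using vD BD cvec.subspace_scale[OF sub]
        by (subst clinear_on_add[OF sub Blin]) (auto simp: clinear_on_scale[OF sub Blin])
      then have "B y = \<sigma> *\<^sub>R y"
        by (simp add: BBv y_def scaleR_scaleC scaleC_add_right scaleC_scaleC power2_eq_square)
      then have "y \<in> cvec.span (\<xi> ` {i\<in>I1. B (\<xi> i) = \<sigma> *\<^sub>R \<xi> i})"
        using eig \<sigma> yN ND by blast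
      then have "y = 0" using N0[OF yN, of "{i\<in>I1. B (\<xi> i) = \<sigma> *\<^sub>R \<xi> i}"] I by blast
      moreover have "Re (cinner y v) > 0"
        using Bpos(2)[OF vD] v(2) \<sigma>
        by (simp add: y_def cinner_add_left cinner_scaleC_left cinner_self_norm)
      ultimately show False by simp
    qed
  qed
qed

section \<open>Matrix norms and complete equivalence\<close>

lemma norm_sum_scaleC_le:
  fixes w :: "'i \<Rightarrow> 'a::complex_normed_vector"
  shows "norm (\<Sum>k\<in>F. v k *\<^sub>C w k) \<le> (\<Sum>k\<in>F. cmod (v k) * norm (w k))"
  by (rule order_trans[OF norm_sum]) (simp add: norm_scaleC)

lemma L2_set_cmod_sq: "(L2_set f A)\<^sup>2 = (\<Sum>k\<in>A. (f k)\<^sup>2)"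
  by (simp add: L2_set_def sum_nonneg)

lemma bdd_above_mat_norm:
  "bdd_above ((\<lambda>v::nat \<Rightarrow> complex. L2_set (\<lambda>k. cmod (\<Sum>l<n. a k l * v l)) {..<n}) `
     {v. L2_set (\<lambda>k. cmod (v k)) {..<n} \<le> 1})"
proof (rule bdd_aboveI2)
  fix v :: "nat \<Rightarrow> complex" assume "v \<in> {v. L2_set (\<lambda>k. cmod (v k)) {..<n} \<le> 1}"
  then have v: "cmod (v l) \<le> 1" if "l < n" for l
    using member_le_L2_set[of "{..<n}" l "\<lambda>k. cmod (v k)"] that by auto
  have "L2_set (\<lambda>k. cmod (\<Sum>l<n. a k l * v l)) {..<n} \<le> (\<Sum>k<n. cmod (\<Sum>l<n. a k l * v l))"
    by (rule L2_set_le_sum) auto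
  also have "\<dots> \<le> (\<Sum>k<n. \<Sum>l<n. cmod (a k l))"
    using v by (intro sum_mono order_trans[OF norm_sum])
      (auto simp: norm_mult intro: mult_right_le_one_le)
  finally show "L2_set (\<lambda>k. cmod (\<Sum>l<n. a k l * v l)) {..<n} \<le> (\<Sum>k<n. \<Sum>l<n. cmod (a k l))" .
qed

lemma mat_norm_ge:
  assumes "L2_set (\<lambda>k. cmod (v k)) {..<n} \<le> 1"
  shows "L2_set (\<lambda>k. cmod (\<Sum>l<n. a k l * v l)) {..<n} \<le> mat_norm n a"
  unfolding mat_norm_def by (rule cSUP_upper[OF _ bdd_above_mat_norm]) (use assms in simp)

lemma mat_norm_nonneg: "0 \<le> mat_norm n a"
  using mat_norm_ge[of "\<lambda>_. 0" n a] by (simp add: L2_set_def)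

lemma mat_norm_apply:
  "L2_set (\<lambda>k. cmod (\<Sum>l<n. a k l * v l)) {..<n} \<le> mat_norm n a * L2_set (\<lambda>k. cmod (v k)) {..<n}"
proof -
  define r where "r = L2_set (\<lambda>k. cmod (v k)) {..<n}"
  show ?thesis
  proof (cases "r = 0")
    case True
    then have "v l = 0" if "l < n" for l
      using that by (simp add: r_def L2_set_eq_0_iff)
    then have "(\<Sum>l<n. a k l * v l) = 0" for k by (intro sum.neutral) auto
    then show ?thesis using True by (simp add: r_def L2_set_def)
  next
    case False
    then have r: "r > 0" using L2_set_nonneg by (simp add: r_def less_le)
    have "L2_set (\<lambda>k. cmod (v k / r)) {..<n} = L2_set (\<lambda>k. cmod (v k)) {..<n} * (1 / r)"
      using r by (subst L2_set_left_distrib) (simp_all add: norm_divide)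
    then have "L2_set (\<lambda>k. cmod (v k / r)) {..<n} \<le> 1" using r by (simp add: r_def[symmetric])
    from mat_norm_ge[OF this, of a]
    have "L2_set (\<lambda>k. cmod (\<Sum>l<n. a k l * v l) * (1 / r)) {..<n} \<le> mat_norm n a"
      using r by (simp add: sum_divide_distrib[symmetric] norm_divide)
    then have "L2_set (\<lambda>k. cmod (\<Sum>l<n. a k l * v l)) {..<n} * (1 / r) \<le> mat_norm n a"
      by (subst L2_set_left_distrib) (use r in auto)
    then show ?thesis using r by (simp add: r_def[symmetric] divide_simps)
  qed
qed

text \<open>The Gram matrix of a column norm is the entrywise conjugate of the Gram matrix of the
  transposed entries, so this reduces column norms to row norms.\<close>

lemma mat_norm_cnj: "mat_norm n (\<lambda>k l. cnj (a k l)) = mat_norm n a"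
proof -
  have "mat_norm n (\<lambda>k l. cnj (a k l)) \<le> mat_norm n a" for a
    unfolding mat_norm_def[of n "\<lambda>k l. cnj (a k l)"]
  proof (rule cSUP_least)
    show "{v. L2_set (\<lambda>k. cmod (v k)) {..<n} \<le> 1} \<noteq> {}"
      by (auto intro!: exI[of _ "\<lambda>_. 0"] simp: L2_set_def)
    fix v :: "nat \<Rightarrow> complex" assume v: "v \<in> {v. L2_set (\<lambda>k. cmod (v k)) {..<n} \<le> 1}"
    have "cmod (\<Sum>l<n. cnj (a k l) * v l) = cmod (\<Sum>l<n. a k l * cnj (v l))" for k
      by (subst complex_mod_cnj[symmetric]) (simp del: complex_mod_cnj)
    then show "L2_set (\<lambda>k. cmod (\<Sum>l<n. cnj (a k l) * v l)) {..<n} \<le> mat_norm n a"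
      using mat_norm_ge[of "\<lambda>l. cnj (v l)" n a] v by simp
  qed
  from this[of a] this[of "\<lambda>k l. cnj (a k l)"] show ?thesis by simp
qed

text \<open>The norm of the row vector \<open>v\<close> times the matrix \<open>w\<close>, taken in
  the l2 sum of n copies of \<open>ell2\<close>. Its supremum over unit vectors \<open>v\<close> is
  the row norm of \<open>w\<close>.\<close>

definition gram_form :: "nat \<Rightarrow> (nat \<Rightarrow> nat \<Rightarrow> ell2) \<Rightarrow> (nat \<Rightarrow> complex) \<Rightarrow> real" where
  "gram_form n w v = L2_set (\<lambda>m. norm (\<Sum>k<n. v k *\<^sub>C w k m)) {..<n}"

lemma gram_form_cinner:
  "(\<Sum>k<n. (\<Sum>l<n. (\<Sum>m<n. cinner (w k m) (w l m)) * v l) * cnj (u k))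
    = (\<Sum>m<n. cinner (\<Sum>k<n. cnj (u k) *\<^sub>C w k m) (\<Sum>l<n. cnj (v l) *\<^sub>C w l m))"
proof -
  have "(\<Sum>k<n. (\<Sum>l<n. (\<Sum>m<n. cinner (w k m) (w l m)) * v l) * cnj (u k))
    = (\<Sum>k<n. \<Sum>l<n. \<Sum>m<n. cnj (u k) * (v l * cinner (w k m) (w l m)))"
    by (simp add: sum_distrib_left sum_distrib_right ac_simps)
  also have "\<dots> = (\<Sum>k<n. \<Sum>m<n. \<Sum>l<n. cnj (u k) * (v l * cinner (w k m) (w l m)))"
    by (intro sum.cong refl sum.swap)
  also have "\<dots> = (\<Sum>m<n. \<Sum>k<n. \<Sum>l<n. cnj (u k) * (v l * cinner (w k m) (w l m)))"
    by (rule sum.swap)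
  also have "\<dots> = (\<Sum>m<n. cinner (\<Sum>k<n. cnj (u k) *\<^sub>C w k m) (\<Sum>l<n. cnj (v l) *\<^sub>C w l m))"
    by (simp add: cinner_sum_left) (simp add: cinner_sum_right cinner_scaleC_left
        cinner_scaleC_right sum_distrib_left mult.left_commute)
  finally show ?thesis .
qed

text \<open>An instance of the identity that an operator times its adjoint has the squared norm of
  the operator. One direction evaluates the quadratic form at \<open>v\<close>; the other pairs the
  Gram matrix applied to \<open>v\<close> with itself and uses Cauchy-Schwarz.\<close>

lemma gram_mat_norm_le_iff:
  assumes c: "c \<ge> 0"
  shows "mat_norm n (\<lambda>k l. \<Sum>m<n. cinner (w k m) (w l m)) \<le> c\<^sup>2 \<longleftrightarrow>
    (\<forall>v. gram_form n w v \<le> c * L2_set (\<lambda>k. cmod (v k)) {..<n})"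
proof
  define G where "G = (\<lambda>k l. \<Sum>m<n. cinner (w k m) (w l m))"
  define a where "a = (\<lambda>v k. \<Sum>l<n. G k l * v l)"
  have ident: "(\<Sum>k<n. a v k * cnj (u k))
    = (\<Sum>m<n. cinner (\<Sum>k<n. cnj (u k) *\<^sub>C w k m) (\<Sum>l<n. cnj (v l) *\<^sub>C w l m))" for u v
    unfolding a_def G_def by (rule gram_form_cinner)
  have cs: "cmod (\<Sum>k<n. f k * g k) \<le> L2_set (\<lambda>k. cmod (f k)) {..<n} * L2_set (\<lambda>k. cmod (g k)) {..<n}"
    for f g :: "nat \<Rightarrow> complex"
    by (rule order_trans[OF norm_sum order_trans[OF _ L2_set_mult_ineq]]) (simp add: norm_mult)
  {
    assume le: "mat_norm n (\<lambda>k l. \<Sum>m<n. cinner (w k m) (w l m)) \<le> c\<^sup>2"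
    show "\<forall>v. gram_form n w v \<le> c * L2_set (\<lambda>k. cmod (v k)) {..<n}"
    proof
      fix v
      define r where "r = L2_set (\<lambda>k. cmod (v k)) {..<n}"
      have "complex_of_real ((gram_form n w v)\<^sup>2)
          = (\<Sum>m<n. cinner (\<Sum>k<n. v k *\<^sub>C w k m) (\<Sum>l<n. v l *\<^sub>C w l m))"
        by (simp add: gram_form_def L2_set_cmod_sq cinner_self_norm)
      also have "\<dots> = (\<Sum>k<n. a (\<lambda>k. cnj (v k)) k * v k)"
        using ident[of "\<lambda>k. cnj (v k)" "\<lambda>k. cnj (v k)"] by simp
      finally have "(gram_form n w v)\<^sup>2 = cmod (\<Sum>k<n. a (\<lambda>k. cnj (v k)) k * v k)"
        by (metis norm_of_real abs_of_nonneg zero_le_power2)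
      also have "\<dots> \<le> L2_set (\<lambda>k. cmod (a (\<lambda>k. cnj (v k)) k)) {..<n} * r"
        unfolding r_def by (rule cs)
      also have "L2_set (\<lambda>k. cmod (a (\<lambda>k. cnj (v k)) k)) {..<n} \<le> mat_norm n G * r"
        using mat_norm_apply[where a = G and v = "\<lambda>k. cnj (v k)"] by (simp add: a_def r_def)
      also have "mat_norm n G * r \<le> c\<^sup>2 * r"
        using le by (intro mult_right_mono) (auto simp: G_def r_def)
      finally have "(gram_form n w v)\<^sup>2 \<le> (c * r)\<^sup>2"
        by (simp add: r_def mult_right_mono power2_eq_square mult_ac)
      then show "gram_form n w v \<le> c * L2_set (\<lambda>k. cmod (v k)) {..<n}"
        unfolding r_def by (rule power2_le_imp_le) (simp add: c)
    qed
  }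
  {
    assume le: "\<forall>v. gram_form n w v \<le> c * L2_set (\<lambda>k. cmod (v k)) {..<n}"
    have "L2_set (\<lambda>k. cmod (a v k)) {..<n} \<le> c\<^sup>2" if v: "L2_set (\<lambda>k. cmod (v k)) {..<n} \<le> 1" for v
    proof -
      define r where "r = L2_set (\<lambda>k. cmod (a v k)) {..<n}"
      have r0: "r \<ge> 0" by (simp add: r_def)
      define p q where "p = (\<lambda>m. norm (\<Sum>k<n. cnj (a v k) *\<^sub>C w k m))"
        and "q = (\<lambda>m. norm (\<Sum>l<n. cnj (v l) *\<^sub>C w l m))"
      have "complex_of_real (r\<^sup>2) = (\<Sum>k<n. a v k * cnj (a v k))"
        by (simp add: r_def L2_set_cmod_sq of_real_cmod_sq)
      then have "r\<^sup>2 = cmod (\<Sum>m<n. cinner (\<Sum>k<n. cnj (a v k) *\<^sub>C w k m) (\<Sum>l<n. cnj (v l) *\<^sub>C w l m))"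
        unfolding ident by (metis norm_of_real abs_of_nonneg zero_le_power2)
      also have "\<dots> \<le> (\<Sum>m<n. p m * q m)"
        by (rule order_trans[OF norm_sum]) (auto simp: p_def q_def intro!: sum_mono cinner_Cauchy_Schwarz)
      also have "\<dots> \<le> L2_set p {..<n} * L2_set q {..<n}"
        using L2_set_mult_ineq[of p q "{..<n}"] by (simp add: p_def q_def)
      also have "L2_set p {..<n} \<le> c * r"
        using le[rule_format, of "\<lambda>k. cnj (a v k)"] by (simp add: gram_form_def p_def r_def)
      also have "L2_set q {..<n} \<le> c * L2_set (\<lambda>k. cmod (v k)) {..<n}"
        using le[rule_format, of "\<lambda>k. cnj (v k)"] by (simp add: gram_form_def q_def)
      also have "\<dots> \<le> c * 1" using v c by (rule mult_left_mono)
      finally have "r * r \<le> c\<^sup>2 * r"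
        using c r0 by (simp add: mult_left_mono mult_right_mono power2_eq_square mult_ac)
      then show "r \<le> c\<^sup>2" using r0 by (cases "r = 0") auto
    qed
    then show "mat_norm n (\<lambda>k l. \<Sum>m<n. cinner (w k m) (w l m)) \<le> c\<^sup>2"
      unfolding mat_norm_def G_def[symmetric] a_def
      by (intro cSUP_least) (auto intro!: exI[of _ "\<lambda>_. 0"] simp: L2_set_def)
  }
qed

lemma row_norm_le_iff:
  assumes c: "c \<ge> 0"
  shows "row_norm n z \<le> c \<longleftrightarrow>
    (\<forall>v. gram_form n z v \<le> c * L2_set (\<lambda>k. cmod (v k)) {..<n})"
proof -
  have "row_norm n z \<le> c \<longleftrightarrow> mat_norm n (\<lambda>k l. \<Sum>m<n. cinner (z k m) (z l m)) \<le> c\<^sup>2"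
    unfolding row_norm_def using c real_sqrt_le_iff[of _ "c\<^sup>2"] by simp
  then show ?thesis using gram_mat_norm_le_iff[OF c] by simp
qed

lemma col_norm_eq_row_norm: "col_norm n z = row_norm n (\<lambda>k l. z l k)"
proof -
  have "(\<lambda>k l. \<Sum>m<n. cinner (z m l) (z m k)) = (\<lambda>k l. cnj (\<Sum>m<n. cinner (z m k) (z m l)))"
    unfolding cnj_sum by (intro ext sum.cong refl cinner_commute)
  then show ?thesis by (simp add: col_norm_def row_norm_def mat_norm_cnj del: cnj_sum)
qed

lemma row_norm_nonneg: "row_norm n z \<ge> 0"
  by (simp add: row_norm_def mat_norm_nonneg)

lemma rc_norm_nonneg: "rc_norm n z \<ge> 0"
  by (simp add: rc_norm_def row_norm_nonneg le_max_iff_disj)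

lemma rc_norm_le_iff:
  assumes "c \<ge> 0"
  shows "rc_norm n z \<le> c \<longleftrightarrow>
    (\<forall>v. gram_form n (\<lambda>k l. fst (z k l)) v \<le> c * L2_set (\<lambda>k. cmod (v k)) {..<n}) \<and>
    (\<forall>v. gram_form n (\<lambda>k l. snd (z l k)) v \<le> c * L2_set (\<lambda>k. cmod (v k)) {..<n})"
  unfolding rc_norm_def col_norm_eq_row_norm by (simp add: row_norm_le_iff[OF assms])

lemma row_norm_single: "row_norm (Suc 0) (\<lambda>_ _. x) = norm x"
proof -
  have "row_norm (Suc 0) (\<lambda>_ _. x) \<le> c \<longleftrightarrow> norm x \<le> c" if c: "c \<ge> 0" for c
    unfolding row_norm_le_iff[OF c] gram_form_def
    by (auto simp: L2_set_def norm_scaleC mult.commute[of c] intro: mult_left_mono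
        dest: spec[of _ "\<lambda>_. 1"])
  from this[of "norm x"] this[OF row_norm_nonneg, of "Suc 0" "\<lambda>_ _. x"] show ?thesis by simp
qed

lemma rc_norm_single: "rc_norm (Suc 0) (\<lambda>_ _. p) = max (norm (fst p)) (norm (snd p))"
  by (simp add: rc_norm_def col_norm_eq_row_norm row_norm_single)

lemma gram_form_add_le:
  "gram_form n (\<lambda>k l. z k l + z' k l) v \<le> gram_form n z v + gram_form n z' v"
proof -
  have "gram_form n (\<lambda>k l. z k l + z' k l) v
      \<le> L2_set (\<lambda>m. norm (\<Sum>k<n. v k *\<^sub>C z k m) + norm (\<Sum>k<n. v k *\<^sub>C z' k m)) {..<n}"
    unfolding gram_form_def
    by (intro L2_set_mono) (auto simp: scaleC_add_right sum.distrib norm_triangle_ineq)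
  also have "\<dots> \<le> gram_form n z v + gram_form n z' v"
    unfolding gram_form_def by (rule L2_set_triangle_ineq)
  finally show ?thesis .
qed

text \<open>A crude entrywise bound; its purpose is continuity of the matrix norms in the
  entries.\<close>

lemma gram_form_le_sum:
  "gram_form n z v \<le> (\<Sum>k<n. \<Sum>l<n. norm (z k l)) * L2_set (\<lambda>k. cmod (v k)) {..<n}"
proof -
  define r where "r = L2_set (\<lambda>k. cmod (v k)) {..<n}"
  have v: "cmod (v k) \<le> r" if "k < n" for k
    unfolding r_def using that member_le_L2_set[of "{..<n}" k "\<lambda>k. cmod (v k)"] by auto
  have "gram_form n z v \<le> (\<Sum>m<n. norm (\<Sum>k<n. v k *\<^sub>C z k m))"
    unfolding gram_form_def by (rule L2_set_le_sum) auto
  also have "\<dots> \<le> (\<Sum>m<n. \<Sum>k<n. r * norm (z k m))"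
    using v by (intro sum_mono order_trans[OF norm_sum_scaleC_le]) (auto intro!: mult_right_mono)
  also have "\<dots> = (\<Sum>k<n. \<Sum>m<n. norm (z k m)) * r"
    by (subst sum.swap) (simp add: sum_distrib_left sum_distrib_right mult.commute)
  finally show ?thesis by (simp add: r_def)
qed

lemma row_norm_triangle:
  "row_norm n z \<le> row_norm n z' + (\<Sum>k<n. \<Sum>l<n. norm (z k l - z' k l))"
proof -
  have "gram_form n z v \<le> (row_norm n z' + (\<Sum>k<n. \<Sum>l<n. norm (z k l - z' k l)))
      * L2_set (\<lambda>k. cmod (v k)) {..<n}" for v
    using gram_form_add_le[of n z' "\<lambda>k l. z k l - z' k l" v]
      gram_form_le_sum[of n "\<lambda>k l. z k l - z' k l" v]
      row_norm_le_iff[OF row_norm_nonneg, THEN iffD1, rule_format, OF order_refl, of n z' v]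
    by (simp add: distrib_right)
  then show ?thesis
    by (subst row_norm_le_iff) (auto intro!: add_nonneg_nonneg row_norm_nonneg sum_nonneg)
qed

lemma tendsto_row_norm:
  fixes z :: "nat \<Rightarrow> nat \<Rightarrow> nat \<Rightarrow> ell2"
  assumes "\<And>k l. k < n \<Longrightarrow> l < n \<Longrightarrow> (\<lambda>i. z i k l) \<longlonglongrightarrow> w k l"
  shows "(\<lambda>i. row_norm n (z i)) \<longlonglongrightarrow> row_norm n w"
proof (rule Lim_null_comparison[THEN LIM_zero_cancel])
  define S where "S = (\<lambda>i. \<Sum>k<n. \<Sum>l<n. norm (z i k l - w k l))"
  have "norm (row_norm n (z i) - row_norm n w) \<le> S i" for i
    using row_norm_triangle[of n "z i" w] row_norm_triangle[of n w "z i"]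
    by (simp add: S_def norm_minus_commute abs_le_iff)
  then show "\<forall>\<^sub>F i in sequentially. norm (row_norm n (z i) - row_norm n w) \<le> S i" by simp
  have "S \<longlonglongrightarrow> (\<Sum>k<n. \<Sum>l<n. norm (w k l - w k l))"
    unfolding S_def using assms by (intro tendsto_intros) auto
  then show "S \<longlonglongrightarrow> 0" by simp
qed

lemma tendsto_rc_norm:
  assumes "\<And>k l. k < n \<Longrightarrow> l < n \<Longrightarrow> (\<lambda>i. z i k l) \<longlonglongrightarrow> w k l"
  shows "(\<lambda>i. rc_norm n (z i)) \<longlonglongrightarrow> rc_norm n w"
  unfolding rc_norm_def col_norm_eq_row_norm
  by (intro tendsto_max tendsto_row_norm tendsto_fst tendsto_snd assms)

section \<open>Approximation in closed spans and the criterion for equivalence\<close>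

lemma cspan_finite_sum:
  assumes "p \<in> cvec.span (h ` J)"
  obtains F a where "finite F" "F \<subseteq> J" "\<And>j. j \<notin> F \<Longrightarrow> a j = 0" "p = (\<Sum>j\<in>F. a j *\<^sub>C h j)"
proof -
  define Q where "Q = (\<lambda>p. \<exists>F a. finite F \<and> F \<subseteq> J \<and> (\<forall>j. j \<notin> F \<longrightarrow> a j = 0) \<and> p = (\<Sum>j\<in>F. a j *\<^sub>C h j))"
  have "Q p"
    using assms
  proof (rule cvec.span_induct)
    show "cvec.subspace (Collect Q)"
    proof (rule cvec.subspaceI)
      show "0 \<in> Collect Q" by (auto simp: Q_def intro!: exI[of _ "{}"])
      show "c *\<^sub>C x \<in> Collect Q" if "x \<in> Collect Q" for c x
      proof -
        obtain F a where Fa: "finite F" "F \<subseteq> J" "\<forall>j. j \<notin> F \<longrightarrow> a j = 0" "x = (\<Sum>j\<in>F. a j *\<^sub>C h j)"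
          using \<open>x \<in> Collect Q\<close> unfolding Q_def by blast
        then show ?thesis unfolding Q_def
          by (intro CollectI exI[of _ F] exI[of _ "\<lambda>j. c * a j"])
            (auto simp: cvec.scale_sum_right scaleC_scaleC)
      qed
      show "x + y \<in> Collect Q" if xy: "x \<in> Collect Q" "y \<in> Collect Q" for x y
      proof -
        obtain F a where F: "finite F" "F \<subseteq> J" "\<forall>j. j \<notin> F \<longrightarrow> a j = 0" "x = (\<Sum>j\<in>F. a j *\<^sub>C h j)"
          using \<open>x \<in> Collect Q\<close> unfolding Q_def by blast
        obtain G b where G: "finite G" "G \<subseteq> J" "\<forall>j. j \<notin> G \<longrightarrow> b j = 0" "y = (\<Sum>j\<in>G. b j *\<^sub>C h j)"
          using \<open>y \<in> Collect Q\<close> unfolding Q_def by blast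
        have "x = (\<Sum>j\<in>F \<union> G. a j *\<^sub>C h j)"
          unfolding F(4) using F G by (intro sum.mono_neutral_left) auto
        moreover have "y = (\<Sum>j\<in>F \<union> G. b j *\<^sub>C h j)"
          unfolding G(4) using F G by (intro sum.mono_neutral_left) auto
        ultimately show ?thesis unfolding Q_def using F G
          by (intro CollectI exI[of _ "F \<union> G"] exI[of _ "\<lambda>j. a j + b j"])
            (auto simp: scaleC_add_left sum.distrib)
      qed
    qed
    show "Q x" if x: "x \<in> h ` J" for x
    proof -
      obtain j where "j \<in> J" "x = h j" using x by blast
      then show ?thesis unfolding Q_def
        by (intro exI[of _ "{j}"] exI[of _ "\<lambda>i. if i = j then 1 else 0"]) (auto simp: scaleC_one)
    qed
  qed
  then show thesis using that unfolding Q_def by blast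
qed

text \<open>Coefficients vanishing off their finite index set allow each sum to be rewritten over a
  larger common index set.\<close>

lemma cspan_finite_sum_choice:
  assumes "\<And>i. p i \<in> cvec.span (h ` S i)"
  obtains F a where "\<And>i. finite (F i)" "\<And>i. F i \<subseteq> S i" "\<And>i j. j \<notin> F i \<Longrightarrow> a i j = 0"
    "\<And>i. p i = (\<Sum>j\<in>F i. a i j *\<^sub>C h j)"
proof -
  define P where "P = (\<lambda>i Fa. finite (fst Fa) \<and> fst Fa \<subseteq> S i \<and> (\<forall>j. j \<notin> fst Fa \<longrightarrow> snd Fa j = 0) \<and>
    p i = (\<Sum>j\<in>fst Fa. snd Fa j *\<^sub>C h j))"
  have "\<exists>Fa. P i Fa" for i
  proof -
    obtain F a where "finite F" "F \<subseteq> S i" "\<And>j. j \<notin> F \<Longrightarrow> a j = 0" "p i = (\<Sum>j\<in>F. a j *\<^sub>C h j)"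
      by (rule cspan_finite_sum[OF assms[of i]]) (rule that)
    then show ?thesis by (intro exI[of _ "(F, a)"]) (simp add: P_def)
  qed
  then obtain Fa where "\<And>i. P i (Fa i)" by metis
  then show thesis
    by (intro that[of "\<lambda>i. fst (Fa i)" "\<lambda>i. snd (Fa i)"]) (simp_all add: P_def)
qed

lemma fst_scaleC [simp]: "fst (c *\<^sub>C p) = c *\<^sub>C fst p"
  and snd_scaleC [simp]: "snd (c *\<^sub>C p) = c *\<^sub>C snd p"
  by (simp_all add: scaleC_prod_def)

lemma fst_tensor_sum: "fst (tensor_sum F a x k l) = (\<Sum>j\<in>F. a j k l *\<^sub>C fst (x j))"
  and snd_tensor_sum: "snd (tensor_sum F a x k l) = (\<Sum>j\<in>F. a j k l *\<^sub>C snd (x j))"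
  by (simp_all add: tensor_sum_def fst_sum snd_sum)

lemma sum_scaleC_swap:
  "(\<Sum>k\<in>N. v k *\<^sub>C (\<Sum>j\<in>F. b j k *\<^sub>C h j)) = (\<Sum>j\<in>F. (\<Sum>k\<in>N. v k * b j k) *\<^sub>C h j)"
  by (simp add: cvec.scale_sum_right cvec.scale_sum_left scaleC_scaleC) (rule sum.swap)

text \<open>Approximating in the span of the pairs \<open>(x j, y j)\<close> gives \<open>z\<close>
  and \<open>w\<close> the same coefficients. The finite index sets of all entries are united, so
  that a single \<open>tensor_sum\<close> serves the whole matrix.\<close>

lemma closed_cspan_matrix_approximation:
  fixes x y :: "'j \<Rightarrow> ell2 \<times> ell2"
  assumes "\<And>k l. k < n \<Longrightarrow> l < n \<Longrightarrow> (z k l, w k l) \<in> closed_cspan ((\<lambda>j. (x j, y j)) ` J)"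
  obtains F a where "\<And>i. finite (F i)" "\<And>i. F i \<subseteq> J"
    "\<And>k l. k < n \<Longrightarrow> l < n \<Longrightarrow> (\<lambda>i. tensor_sum (F i) (a i) x k l) \<longlonglongrightarrow> z k l"
    "\<And>k l. k < n \<Longrightarrow> l < n \<Longrightarrow> (\<lambda>i. tensor_sum (F i) (a i) y k l) \<longlonglongrightarrow> w k l"
proof -
  define h where "h = (\<lambda>j. (x j, y j))"
  have "\<exists>g. (\<forall>i. g i \<in> cvec.span (h ` J)) \<and> (k < n \<longrightarrow> l < n \<longrightarrow> g \<longlonglongrightarrow> (z k l, w k l))" for k l
  proof (cases "k < n \<and> l < n")
    case True
    then show ?thesis
      using assms[of k l] unfolding closed_cspan_def closure_sequential h_def by blast
  next
    case False
    then show ?thesis by (intro exI[of _ "\<lambda>_. 0"]) (auto simp: cvec.span_zero)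
  qed
  then obtain g where g: "\<And>k l i. g k l i \<in> cvec.span (h ` J)"
    "\<And>k l. k < n \<Longrightarrow> l < n \<Longrightarrow> g k l \<longlonglongrightarrow> (z k l, w k l)" by metis
  have "g (fst t) (fst (snd t)) (snd (snd t)) \<in> cvec.span (h ` J)" for t by (rule g(1))
  from cspan_finite_sum_choice[of "\<lambda>t. g (fst t) (fst (snd t)) (snd (snd t))", OF this]
  obtain F' a' where F': "\<And>t. finite (F' t)" "\<And>t. F' t \<subseteq> J" "\<And>t j. j \<notin> F' t \<Longrightarrow> a' t j = 0"
    "\<And>t. g (fst t) (fst (snd t)) (snd (snd t)) = (\<Sum>j\<in>F' t. a' t j *\<^sub>C h j)" by blast
  define F a where "F = (\<lambda>k l i. F' (k, l, i))" and "a = (\<lambda>k l i. a' (k, l, i))"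
  have F: "\<And>k l i. finite (F k l i)" "\<And>k l i. F k l i \<subseteq> J"
    "\<And>k l i j. j \<notin> F k l i \<Longrightarrow> a k l i j = 0"
    "\<And>k l i. g k l i = (\<Sum>j\<in>F k l i. a k l i j *\<^sub>C h j)"
    using F'(1-3) F'(4)[of "(_, _, _)"] by (simp_all add: F_def a_def)
  define G where "G = (\<lambda>i. \<Union>k<n. \<Union>l<n. F k l i)"
  define b where "b = (\<lambda>i j k l. a k l i j)"
  have fin: "finite (G i)" for i by (simp add: G_def F(1))
  have gG: "g k l i = (tensor_sum (G i) (b i) x k l, tensor_sum (G i) (b i) y k l)"
    if "k < n" "l < n" for k l i
  proof -
    have "g k l i = (\<Sum>j\<in>G i. a k l i j *\<^sub>C h j)"
      unfolding F(4) using F(1,3) fin that by (intro sum.mono_neutral_left) (auto simp: G_def)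
    then show ?thesis
      by (simp add: prod_eq_iff tensor_sum_def b_def h_def fst_sum snd_sum)
  qed
  show thesis
  proof (rule that[of G b])
    fix k l assume kl: "k < n" "l < n"
    show "(\<lambda>i. tensor_sum (G i) (b i) x k l) \<longlonglongrightarrow> z k l"
      using tendsto_fst[OF g(2)[OF kl]] by (simp add: gG[OF kl])
    show "(\<lambda>i. tensor_sum (G i) (b i) y k l) \<longlonglongrightarrow> w k l"
      using tendsto_snd[OF g(2)[OF kl]] by (simp add: gG[OF kl])
  next
    show "G i \<subseteq> J" for i using F(2) unfolding G_def by blast
  qed (rule fin)
qed

text \<open>Being bounded below on the closed span, \<open>f\<close> maps it onto a complete and
  hence closed subspace.\<close>

lemma image_closed_cspan:
  fixes f :: "'a::{complex_normed_vector, complete_space} \<Rightarrow> 'b::{complex_normed_vector, complete_space}"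
  assumes f: "bounded_linear f" and fC: "\<And>c x. f (c *\<^sub>C x) = c *\<^sub>C f x"
    and e: "e > 0" "\<And>x. x \<in> closed_cspan S \<Longrightarrow> e * norm x \<le> norm (f x)"
  shows "f ` closed_cspan S = closed_cspan (f ` S)"
proof
  interpret bounded_linear f by (rule f)
  have sub: "cvec.subspace (closed_cspan S)" by (rule subspace_closed_cspan)
  have "complete (f ` closed_cspan S)"
  proof (rule complete_isometric_image[OF e(1) _ f])
    show "subspace (closed_cspan S)"
      using sub by (auto simp: subspace_def scaleR_scaleC cvec.subspace_0 cvec.subspace_add
          cvec.subspace_scale)
    show "complete (closed_cspan S)" by (simp add: complete_eq_closed closed_closed_cspan)
  qed (use e in auto)
  then have cl: "closed (f ` closed_cspan S)" by (simp add: complete_eq_closed)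
  have "cvec.subspace (f ` closed_cspan S)"
  proof (rule cvec.subspaceI)
    show "0 \<in> f ` closed_cspan S"
      using cvec.subspace_0[OF sub] zero by (metis imageI)
    show "a + b \<in> f ` closed_cspan S" if "a \<in> f ` closed_cspan S" "b \<in> f ` closed_cspan S" for a b
      using that cvec.subspace_add[OF sub] add by (auto simp: image_iff) metis
    show "c *\<^sub>C a \<in> f ` closed_cspan S" if "a \<in> f ` closed_cspan S" for c a
      using that cvec.subspace_scale[OF sub] fC by (auto simp: image_iff) metis
  qed
  then show "closed_cspan (f ` S) \<subseteq> f ` closed_cspan S"
    using cl by (intro closed_cspan_minimal image_mono)
      (auto simp: closed_csubspace_def intro: closed_cspan_base)
  have "cvec.subspace (f -` closed_cspan (f ` S))"
    using subspace_closed_cspan[of "f ` S"]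
    by (intro cvec.subspaceI)
      (auto simp: zero add fC cvec.subspace_0 cvec.subspace_add cvec.subspace_scale)
  moreover have "closed (f -` closed_cspan (f ` S))"
    by (intro continuous_closed_vimage closed_closed_cspan continuous_at_imp_continuous_on)
      (auto intro: isCont)
  ultimately have "closed_cspan S \<subseteq> f -` closed_cspan (f ` S)"
    by (intro closed_cspan_minimal) (auto simp: closed_csubspace_def intro: closed_cspan_base)
  then show "f ` closed_cspan S \<subseteq> closed_cspan (f ` S)" by blast
qed

lemma norm_le_max_components:
  fixes p :: "'a::real_normed_vector \<times> 'b::real_normed_vector"
  shows "norm p \<le> 2 * max (norm (fst p)) (norm (snd p))"
  using norm_Pair_le[of "fst p" "snd p"] by (simp add: max_def split: if_splits)

lemma max_components_le_norm:
  fixes p :: "'a::real_normed_vector \<times> 'b::real_normed_vector"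
  shows "max (norm (fst p)) (norm (snd p)) \<le> norm p"
  using norm_fst_le[of "fst p" "snd p"] norm_snd_le[of "snd p" "fst p"] by simp

text \<open>The intertwining map is the one whose graph is the closed span of the pairs \<open>(x\<^sub>j, y\<^sub>j)\<close>.\<close>

lemma equivalent_if_tensor_bounds:
  fixes x y :: "'j \<Rightarrow> ell2 \<times> ell2"
  assumes K: "K \<ge> 0" "K' \<ge> 0"
    and xy: "\<And>n F a. finite F \<Longrightarrow> F \<subseteq> J \<Longrightarrow> rc_norm n (tensor_sum F a y) \<le> K * rc_norm n (tensor_sum F a x)"
    and yx: "\<And>n F a. finite F \<Longrightarrow> F \<subseteq> J \<Longrightarrow> rc_norm n (tensor_sum F a x) \<le> K' * rc_norm n (tensor_sum F a y)"
  shows "equivalent (K * K') J x y"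
proof -
  define \<Gamma> where "\<Gamma> = closed_cspan ((\<lambda>j. (x j, y j)) ` J)"
  have sub: "cvec.subspace \<Gamma>" unfolding \<Gamma>_def by (rule subspace_closed_cspan)
  have bounds: "rc_norm n w \<le> K * rc_norm n z" "rc_norm n z \<le> K' * rc_norm n w"
    if zw: "\<And>k l. k < n \<Longrightarrow> l < n \<Longrightarrow> (z k l, w k l) \<in> \<Gamma>" for n z w
  proof -
    obtain F a where Fa: "\<And>i. finite (F i)" "\<And>i. F i \<subseteq> J"
      "\<And>k l. k < n \<Longrightarrow> l < n \<Longrightarrow> (\<lambda>i. tensor_sum (F i) (a i) x k l) \<longlonglongrightarrow> z k l"
      "\<And>k l. k < n \<Longrightarrow> l < n \<Longrightarrow> (\<lambda>i. tensor_sum (F i) (a i) y k l) \<longlonglongrightarrow> w k l"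
      by (rule closed_cspan_matrix_approximation[where n = n and z = z and w = w and x = x and y = y
            and J = J, OF zw[unfolded \<Gamma>_def]]) (assumption, assumption, rule that)
    note tx = tendsto_rc_norm[of n "\<lambda>i. tensor_sum (F i) (a i) x", OF Fa(3)]
      and ty = tendsto_rc_norm[of n "\<lambda>i. tensor_sum (F i) (a i) y", OF Fa(4)]
    show "rc_norm n w \<le> K * rc_norm n z"
      by (rule LIMSEQ_le[OF ty tendsto_mult_left[OF tx]]) (use xy Fa in auto)
    show "rc_norm n z \<le> K' * rc_norm n w"
      by (rule LIMSEQ_le[OF tx tendsto_mult_left[OF ty]]) (use yx Fa in auto)
  qed
  define N where "N = (\<lambda>p::ell2 \<times> ell2. max (norm (fst p)) (norm (snd p)))"
  have N: "N q \<le> K * N p" "N p \<le> K' * N q" if "(p, q) \<in> \<Gamma>" for p q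
    using bounds[of "Suc 0" "\<lambda>_ _. p" "\<lambda>_ _. q"] that unfolding rc_norm_single N_def by auto
  have nN: "norm p \<le> 2 * N p" "N p \<le> norm p" "0 \<le> N p" for p
    using norm_le_max_components[of p] max_components_le_norm[of p]
    unfolding N_def by (simp_all add: le_max_iff_disj)
  have uniq1: "q = q'" if "(p, q) \<in> \<Gamma>" "(p, q') \<in> \<Gamma>" for p q q'
  proof -
    have "(0, q - q') \<in> \<Gamma>" using cvec.subspace_diff[OF sub that] by simp
    from N(1)[OF this] have "N (q - q') \<le> 0" by (simp add: N_def)
    then have "norm (q - q') \<le> 0" using nN(1)[of "q - q'"] by linarith
    then show ?thesis by simp
  qed
  have uniq2: "p = p'" if "(p, q) \<in> \<Gamma>" "(p', q) \<in> \<Gamma>" for p p' q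
  proof -
    have "(p - p', 0) \<in> \<Gamma>" using cvec.subspace_diff[OF sub that] by simp
    from N(2)[OF this] have "N (p - p') \<le> 0" by (simp add: N_def)
    then have "norm (p - p') \<le> 0" using nN(1)[of "p - p'"] by linarith
    then show ?thesis by simp
  qed
  \<comment> \<open>Each component of a point of \<Gamma> controls the other, so both projections
    are bounded below and map \<Gamma> onto the full closed spans. The factor 2 compares the product
    norm with the maximum of the components.\<close>
  have \<Gamma>_norm: "norm g \<le> 2 * (1 + K') * norm (snd g)" "norm g \<le> 2 * (1 + K) * norm (fst g)"
    if "g \<in> \<Gamma>" for g
  proof -
    have g: "norm g \<le> 2 * N (fst g) + 2 * N (snd g)"
      using norm_Pair_le[of "fst g" "snd g"] nN(1)[of "fst g"] nN(1)[of "snd g"] by simp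
    have "N (snd g) \<le> K * N (fst g)" "N (fst g) \<le> K' * N (snd g)" using N that by simp_all
    with g have "norm g \<le> 2 * (1 + K') * N (snd g)" "norm g \<le> 2 * (1 + K) * N (fst g)"
      by (simp_all add: algebra_simps)
    moreover have "2 * (1 + K') * N (snd g) \<le> 2 * (1 + K') * norm (snd g)"
      "2 * (1 + K) * N (fst g) \<le> 2 * (1 + K) * norm (fst g)"
      using nN(2) K by (intro mult_left_mono; simp)+
    ultimately show "norm g \<le> 2 * (1 + K') * norm (snd g)" "norm g \<le> 2 * (1 + K) * norm (fst g)"
      by linarith+
  qed
  have "fst ` \<Gamma> = closed_cspan (fst ` ((\<lambda>j. (x j, y j)) ` J))"
    unfolding \<Gamma>_def
    by (rule image_closed_cspan[OF bounded_linear_fst, of "1 / (2 * (1 + K))"])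
      (use K \<Gamma>_norm in \<open>auto simp: \<Gamma>_def divide_simps mult.commute\<close>)
  then have fst\<Gamma>: "fst ` \<Gamma> = closed_cspan (x ` J)" by (simp add: image_image)
  have "snd ` \<Gamma> = closed_cspan (snd ` ((\<lambda>j. (x j, y j)) ` J))"
    unfolding \<Gamma>_def
    by (rule image_closed_cspan[OF bounded_linear_snd, of "1 / (2 * (1 + K'))"])
      (use K \<Gamma>_norm in \<open>auto simp: \<Gamma>_def divide_simps mult.commute\<close>)
  then have snd\<Gamma>: "snd ` \<Gamma> = closed_cspan (y ` J)" by (simp add: image_image)
  define u where "u = (\<lambda>p. THE q. (p, q) \<in> \<Gamma>)"
  define E F where "E = closed_cspan (x ` J)" and "F = closed_cspan (y ` J)"
  have u: "u p = q" if "(p, q) \<in> \<Gamma>" for p q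
    unfolding u_def using that uniq1 by blast
  have uE: "(p, u p) \<in> \<Gamma>" if p: "p \<in> E" for p
  proof -
    have "p \<in> fst ` \<Gamma>" using p by (simp add: fst\<Gamma> E_def)
    then obtain q where "(p, q) \<in> \<Gamma>" by force
    then show ?thesis using u by metis
  qed
  have lin: "clinear_on E u"
    unfolding clinear_on_def
  proof (intro conjI ballI allI u)
    show "(p + p', u p + u p') \<in> \<Gamma>" if "p \<in> E" "p' \<in> E" for p p'
      using cvec.subspace_add[OF sub uE[OF that(1)] uE[OF that(2)]] by simp
    show "(c *\<^sub>C p, c *\<^sub>C u p) \<in> \<Gamma>" if "p \<in> E" for c p
      using cvec.subspace_scale[OF sub uE[OF that], of c] by (simp add: scaleC_prod_def)
  qed
  have inj: "inj_on u E"
    by (rule inj_onI) (metis uE uniq2)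
  have im: "u ` E = F"
  proof
    show "u ` E \<subseteq> F" unfolding F_def snd\<Gamma>[symmetric] using uE by force
    show "F \<subseteq> u ` E"
    proof
      fix q assume "q \<in> F"
      then have "q \<in> snd ` \<Gamma>" by (simp add: snd\<Gamma> F_def)
      then obtain p where p: "(p, q) \<in> \<Gamma>" by force
      then have "p \<in> E" unfolding E_def fst\<Gamma>[symmetric] by force
      then show "q \<in> u ` E" using u[OF p] by blast
    qed
  qed
  have cbu: "cb_norm E u \<le> ennreal K"
    unfolding cb_norm_def
  proof (intro SUP_least)
    fix n z assume "z \<in> {z. (\<forall>k<n. \<forall>l<n. z k l \<in> E) \<and> rc_norm n z \<le> 1}"
    then have z: "\<And>k l. k < n \<Longrightarrow> l < n \<Longrightarrow> z k l \<in> E" "rc_norm n z \<le> 1" by auto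
    have "rc_norm n (\<lambda>k l. u (z k l)) \<le> K * rc_norm n z" using uE z by (intro bounds) auto
    also have "\<dots> \<le> K * 1" using z K by (intro mult_left_mono)
    finally show "ennreal (rc_norm n (\<lambda>k l. u (z k l))) \<le> ennreal K" by (simp add: ennreal_leI)
  qed
  have cbi: "cb_norm F (inv_into E u) \<le> ennreal K'"
    unfolding cb_norm_def
  proof (intro SUP_least)
    fix n z assume "z \<in> {z. (\<forall>k<n. \<forall>l<n. z k l \<in> F) \<and> rc_norm n z \<le> 1}"
    then have z: "\<And>k l. k < n \<Longrightarrow> l < n \<Longrightarrow> z k l \<in> F" "rc_norm n z \<le> 1" by auto
    have "(inv_into E u q, q) \<in> \<Gamma>" if "q \<in> F" for q
      using uE[of "inv_into E u q"] inv_into_into[of q u E] f_inv_into_f[of q u E] that im by simp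
    then have "rc_norm n (\<lambda>k l. inv_into E u (z k l)) \<le> K' * rc_norm n z" using z by (intro bounds) auto
    also have "\<dots> \<le> K' * 1" using z K by (intro mult_left_mono)
    finally show "ennreal (rc_norm n (\<lambda>k l. inv_into E u (z k l))) \<le> ennreal K'" by (simp add: ennreal_leI)
  qed
  have "cb_norm E u * cb_norm F (inv_into E u) \<le> ennreal K * ennreal K'"
    using cbu cbi by (rule mult_mono) auto
  then have "cb_norm E u * cb_norm F (inv_into E u) \<le> ennreal (K * K')"
    using K by (simp add: ennreal_mult)
  moreover have "u (x j) = y j" if "j \<in> J" for j
    by (rule u) (use that in \<open>auto simp: \<Gamma>_def intro!: closed_cspan_base\<close>)
  ultimately show ?thesis
    unfolding equivalent_def Let_def E_def[symmetric] F_def[symmetric]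
    using lin inj im by (auto simp: bij_betw_def)
qed

section \<open>Completely unconditional bases\<close>

lemma rc_norm_le_iff_squares:
  assumes c: "c \<ge> 0"
  shows "rc_norm n z \<le> c \<longleftrightarrow>
    (\<forall>v. (\<Sum>m<n. (norm (\<Sum>k<n. v k *\<^sub>C fst (z k m)))\<^sup>2) \<le> c\<^sup>2 * (\<Sum>k<n. (cmod (v k))\<^sup>2)) \<and>
    (\<forall>v. (\<Sum>m<n. (norm (\<Sum>k<n. v k *\<^sub>C snd (z m k)))\<^sup>2) \<le> c\<^sup>2 * (\<Sum>k<n. (cmod (v k))\<^sup>2))"
proof -
  have "gram_form n w v \<le> c * L2_set (\<lambda>k. cmod (v k)) {..<n} \<longleftrightarrow>
      (\<Sum>m<n. (norm (\<Sum>k<n. v k *\<^sub>C w k m))\<^sup>2) \<le> c\<^sup>2 * (\<Sum>k<n. (cmod (v k))\<^sup>2)" for w v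
  proof -
    have "gram_form n w v \<le> c * L2_set (\<lambda>k. cmod (v k)) {..<n} \<longleftrightarrow>
        (gram_form n w v)\<^sup>2 \<le> (c * L2_set (\<lambda>k. cmod (v k)) {..<n})\<^sup>2"
      using c by (subst power_mono_iff) (auto simp: gram_form_def)
    then show ?thesis by (simp add: power_mult_distrib L2_set_cmod_sq gram_form_def)
  qed
  then show ?thesis unfolding rc_norm_le_iff[OF c] by simp
qed

lemma rc_norm_row_bound:
    "(\<Sum>m<n. (norm (\<Sum>k<n. v k *\<^sub>C fst (z k m)))\<^sup>2) \<le> (rc_norm n z)\<^sup>2 * (\<Sum>k<n. (cmod (v k))\<^sup>2)"
  and rc_norm_column_bound:
    "(\<Sum>m<n. (norm (\<Sum>k<n. v k *\<^sub>C snd (z m k)))\<^sup>2) \<le> (rc_norm n z)\<^sup>2 * (\<Sum>k<n. (cmod (v k))\<^sup>2)"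
  using rc_norm_le_iff_squares[OF rc_norm_nonneg, of n z n z] by simp_all

section \<open>Choice of signs, linear systems and matrix inequalities\<close>

lemma sum_parallelogram:
  fixes z S :: "nat \<Rightarrow> ell2"
  shows "(\<Sum>m<n. (norm (1 *\<^sub>C z m + S m))\<^sup>2) + (\<Sum>m<n. (norm (- 1 *\<^sub>C z m + S m))\<^sup>2)
    = 2 * ((\<Sum>m<n. (norm (S m))\<^sup>2) + (\<Sum>m<n. (norm (z m))\<^sup>2))"
proof -
  have "(norm (1 *\<^sub>C z m + S m))\<^sup>2 + (norm (- 1 *\<^sub>C z m + S m))\<^sup>2
      = 2 * (norm (S m))\<^sup>2 + 2 * (norm (z m))\<^sup>2" for m
    using parallelogram_identity[of "S m" "z m"]
    by (simp add: scaleC_one add.commute cvec.scale_minus_left)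
  then show ?thesis
    unfolding sum.distrib[symmetric] by (simp add: sum.distrib sum_distrib_left)
qed

text \<open>Averaging without probability: signs are fixed one term at a time. By the parallelogram
  identity, of the two choices for a new term one is not below the mean and one is not above it. The
  same signs serve all \<open>m\<close>, and \<open>R\<close> treats both inequalities at
  once.\<close>

lemma exists_signs:
  fixes z :: "'i \<Rightarrow> nat \<Rightarrow> ell2" and R :: "real \<Rightarrow> real \<Rightarrow> bool"
  assumes "finite F" and R: "R = (\<le>) \<or> R = (\<ge>)"
  shows "\<exists>\<epsilon>::'i \<Rightarrow> complex. (\<forall>j. \<epsilon> j = 1 \<or> \<epsilon> j = - 1) \<and>
    R (\<Sum>m<n. \<Sum>j\<in>F. (norm (z j m))\<^sup>2) (\<Sum>m<n. (norm (\<Sum>j\<in>F. \<epsilon> j *\<^sub>C z j m))\<^sup>2)"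
  using assms(1)
proof (induction F)
  case empty
  then show ?case using R by (intro exI[of _ "\<lambda>_. 1"]) auto
next
  case (insert i F)
  then obtain \<epsilon> :: "'i \<Rightarrow> complex" where \<epsilon>: "\<forall>j. \<epsilon> j = 1 \<or> \<epsilon> j = - 1"
    "R (\<Sum>m<n. \<Sum>j\<in>F. (norm (z j m))\<^sup>2) (\<Sum>m<n. (norm (\<Sum>j\<in>F. \<epsilon> j *\<^sub>C z j m))\<^sup>2)" by blast
  define S where "S = (\<lambda>m. \<Sum>j\<in>F. \<epsilon> j *\<^sub>C z j m)"
  define P where "P = (\<lambda>s::complex. \<Sum>m<n. (norm (s *\<^sub>C z i m + S m))\<^sup>2)"
  define a b where "a = (\<Sum>m<n. (norm (S m))\<^sup>2)" and "b = (\<Sum>m<n. (norm (z i m))\<^sup>2)"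
  have "P 1 + P (- 1) = 2 * (a + b)"
    unfolding P_def a_def b_def by (rule sum_parallelogram)
  then have "R (a + b) (P 1) \<or> R (a + b) (P (- 1))" using R by auto
  then obtain s where s: "s = 1 \<or> s = - 1" "R (a + b) (P s)" by blast
  have "(\<Sum>m<n. \<Sum>j\<in>insert i F. (norm (z j m))\<^sup>2) = b + (\<Sum>m<n. \<Sum>j\<in>F. (norm (z j m))\<^sup>2)"
    using insert by (simp add: sum.distrib b_def)
  moreover have "P s = (\<Sum>m<n. (norm (\<Sum>j\<in>insert i F. (\<epsilon>(i := s)) j *\<^sub>C z j m))\<^sup>2)"
    unfolding P_def S_def using insert
    by (intro sum.cong refl arg_cong[of _ _ "\<lambda>x. (norm x)\<^sup>2"]) (auto intro!: sum.cong)
  moreover have "R (\<Sum>m<n. \<Sum>j\<in>F. (norm (z j m))\<^sup>2) a" using \<epsilon>(2) by (simp add: a_def S_def)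
  ultimately show ?case
    using \<epsilon>(1) s R by (intro exI[of _ "\<epsilon>(i := s)"]) auto
qed

lemmas exists_signs_ge = exists_signs[where R = "(\<le>)", OF _ disjI1[OF refl]]
lemmas exists_signs_le = exists_signs[where R = "(\<ge>)", OF _ disjI2[OF refl]]

text \<open>Gaussian elimination: an unknown with nonzero coefficient in one equation is solved for
  and substituted into the others.\<close>

lemma homogeneous_system_solution:
  fixes L :: "'e \<Rightarrow> 'i \<Rightarrow> complex"
  assumes "finite E" "finite U" "card E < card U"
  shows "\<exists>\<alpha>. (\<exists>j\<in>U. \<alpha> j \<noteq> 0) \<and> (\<forall>e\<in>E. (\<Sum>j\<in>U. \<alpha> j * L e j) = 0)"
  using assms
proof (induction E arbitrary: U L)
  case empty
  then obtain j where "j \<in> U" by fastforce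
  then show ?case by (intro exI[of _ "\<lambda>_. 1"]) auto
next
  case (insert e E)
  show ?case
  proof (cases "\<forall>j\<in>U. L e j = 0")
    case True
    from insert.IH[of U L] insert.prems insert.hyps obtain \<alpha> where
      "\<exists>j\<in>U. \<alpha> j \<noteq> 0" "\<forall>e\<in>E. (\<Sum>j\<in>U. \<alpha> j * L e j) = 0" by auto
    then show ?thesis using True by (intro exI[of _ \<alpha>]) auto
  next
    case False
    then obtain j0 where j0: "j0 \<in> U" "L e j0 \<noteq> 0" by blast
    define U' where "U' = U - {j0}"
    have U': "finite U'" "card E < card U'" "U = insert j0 U'" "j0 \<notin> U'"
      using insert.prems insert.hyps j0 by (auto simp: U'_def)
    define L' where "L' = (\<lambda>e' j. L e' j - L e' j0 * L e j / L e j0)"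
    from insert.IH[OF U'(1,2), of L'] obtain \<alpha> where
      \<alpha>: "\<exists>j\<in>U'. \<alpha> j \<noteq> 0" "\<And>e'. e' \<in> E \<Longrightarrow> (\<Sum>j\<in>U'. \<alpha> j * L' e' j) = 0" by auto
    define a0 where "a0 = - (\<Sum>j\<in>U'. \<alpha> j * L e j) / L e j0"
    define \<beta> where "\<beta> = \<alpha>(j0 := a0)"
    have sum: "(\<Sum>j\<in>U. \<beta> j * L e' j) = a0 * L e' j0 + (\<Sum>j\<in>U'. \<alpha> j * L e' j)" for e'
      unfolding U'(3) using U'(1,4) by (auto simp: \<beta>_def intro!: sum.cong)
    have "(\<Sum>j\<in>U. \<beta> j * L e' j) = 0" if e': "e' \<in> insert e E" for e'
    proof (cases "e' = e")
      case True
      then show ?thesis using j0 by (simp add: sum a0_def)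
    next
      case False
      then have "0 = (\<Sum>j\<in>U'. \<alpha> j * L' e' j)" using \<alpha>(2) e' by simp
      also have "\<dots> = (\<Sum>j\<in>U'. \<alpha> j * L e' j) - (\<Sum>j\<in>U'. \<alpha> j * L e j * (L e' j0 / L e j0))"
        by (simp add: L'_def algebra_simps sum_subtractf)
      also have "(\<Sum>j\<in>U'. \<alpha> j * L e j * (L e' j0 / L e j0)) = - (a0 * L e' j0)"
        unfolding sum_distrib_right[symmetric] a0_def by simp
      finally show ?thesis by (simp add: sum add.commute)
    qed
    moreover have "\<exists>j\<in>U. \<beta> j \<noteq> 0" using \<alpha>(1) U' by (auto simp: \<beta>_def)
    ultimately show ?thesis by blast
  qed
qed

lemma cmod_sum_mult_sq_le:
  fixes v b :: "nat \<Rightarrow> complex"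
  shows "(cmod (\<Sum>k<n. v k * b k))\<^sup>2 \<le> (\<Sum>k<n. (cmod (v k))\<^sup>2) * (\<Sum>k<n. (cmod (b k))\<^sup>2)"
proof -
  have "cmod (\<Sum>k<n. v k * b k) \<le> L2_set (\<lambda>k. cmod (v k)) {..<n} * L2_set (\<lambda>k. cmod (b k)) {..<n}"
    by (rule order_trans[OF norm_sum order_trans[OF _ L2_set_mult_ineq]]) (simp add: norm_mult)
  then have "(cmod (\<Sum>k<n. v k * b k))\<^sup>2
      \<le> (L2_set (\<lambda>k. cmod (v k)) {..<n} * L2_set (\<lambda>k. cmod (b k)) {..<n})\<^sup>2"
    by (intro power_mono) auto
  then show ?thesis by (simp add: power_mult_distrib L2_set_cmod_sq)
qed

lemma sum_half_powers_le: "finite F \<Longrightarrow> (\<Sum>j\<in>F. (1 / 2) ^ Suc j) \<le> (1 :: real)"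
  using sums_unique[OF power_half_series] sum_le_suminf[OF sums_summable[OF power_half_series], of F]
  by (metis zero_le_power zero_le_divide_1_iff zero_le_numeral)

text \<open>The matrix \<open>(c\<^sub>m\<^sub>j)\<close>, as an operator into \<open>\<ell>\<^sub>2(F)\<close>, has squared norm at most \<open>R\<close>. For the column
  matrices \<open>a\<^sub>j\<close> with entries \<open>c\<^sub>m\<^sub>j\<close> this bounds the row norm.\<close>

definition row_bounded :: "real \<Rightarrow> nat \<Rightarrow> nat set \<Rightarrow> (nat \<Rightarrow> nat \<Rightarrow> complex) \<Rightarrow> bool" where
  "row_bounded R n F c \<longleftrightarrow>
     (\<forall>w. (\<Sum>j\<in>F. (cmod (\<Sum>m<n. w m * c m j))\<^sup>2) \<le> R * (\<Sum>m<n. (cmod (w m))\<^sup>2))"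

text \<open>Testing with the conjugate of the column bounds the square of its squared length by
  \<open>R\<close> times that squared length.\<close>

lemma row_bounded_column:
  assumes rb: "row_bounded R n F c" and F: "finite F" "j \<in> F" and R: "R \<ge> 0"
  shows "(\<Sum>m<n. (cmod (c m j))\<^sup>2) \<le> R"
proof -
  define S where "S = (\<Sum>m<n. (cmod (c m j))\<^sup>2)"
  have S0: "S \<ge> 0" by (simp add: S_def sum_nonneg)
  have "(\<Sum>m<n. cnj (c m j) * c m j) = complex_of_real S"
    by (simp add: S_def of_real_cmod_sq mult.commute)
  then have "S\<^sup>2 = (cmod (\<Sum>m<n. cnj (c m j) * c m j))\<^sup>2" by simp
  also have "\<dots> \<le> (\<Sum>j'\<in>F. (cmod (\<Sum>m<n. cnj (c m j) * c m j'))\<^sup>2)"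
    by (rule member_le_sum) (use F in auto)
  also have "\<dots> \<le> R * (\<Sum>m<n. (cmod (cnj (c m j)))\<^sup>2)"
    using rb[unfolded row_bounded_def, rule_format, of "\<lambda>m. cnj (c m j)"] .
  finally have "S * S \<le> R * S" by (simp add: S_def power2_eq_square)
  then have "S \<le> R" using S0 R by (cases "S = 0") auto
  then show ?thesis by (simp add: S_def)
qed

text \<open>\<open>f j\<close> stands for the first component of a basis vector. Since
  \<open>A\<close> is a contraction, \<open>norm (f j) = 1\<close> says exactly that
  \<open>(f j, A (f j))\<close> is normalized in the operator space.\<close>

locale unconditional_basis =
  fixes D :: "ell2 set" and A :: "ell2 \<Rightarrow> ell2" and C :: real and J :: "nat set"
    and f :: "nat \<Rightarrow> ell2"
  assumes D: "closed_csubspace D" and A: "compact_contraction_on D A"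
    and f_D: "\<And>j. j \<in> J \<Longrightarrow> f j \<in> D" and norm_f: "\<And>j. j \<in> J \<Longrightarrow> norm (f j) = 1"
    and span_f: "closed_cspan (f ` J) = D"
    and cu: "cu_basic_sequence C J (\<lambda>j. (f j, A (f j)))"
begin

section \<open>Estimates for a single unconditional basis\<close>

lemma C_ge_1: "C \<ge> 1"
  using cu by (simp add: cu_basic_sequence_def)

lemma C_power_mono: "m \<le> n \<Longrightarrow> C ^ m \<le> C ^ n"
  by (rule power_increasing[OF _ C_ge_1])

lemma C_power_ge_1: "C ^ m \<ge> 1"
  using C_ge_1 by (rule one_le_power)

lemma subspace_D: "cvec.subspace D" and closed_D: "closed D" and lin: "clinear_on D A"
  and contraction: "x \<in> D \<Longrightarrow> norm (A x) \<le> norm x"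
  using D A by (auto simp: closed_csubspace_def compact_contraction_on_def)

lemma sum_in_D: "F \<subseteq> J \<Longrightarrow> (\<Sum>j\<in>F. \<alpha> j *\<^sub>C f j) \<in> D"
  using f_D by (intro cvec.subspace_sum[OF subspace_D] cvec.subspace_scale[OF subspace_D]) auto

lemma A_sum: "F \<subseteq> J \<Longrightarrow> A (\<Sum>j\<in>F. \<alpha> j *\<^sub>C f j) = (\<Sum>j\<in>F. \<alpha> j *\<^sub>C A (f j))"
  using f_D by (intro clinear_on_sum[OF subspace_D lin]) auto

lemmas complete_unconditionality = cu[unfolded cu_basic_sequence_def, THEN conjunct2, rule_format]

text \<open>The case of 1 by 1 matrices, where the contraction property makes the row component
  dominate.\<close>

lemma unconditional:
  assumes F: "finite F" "F \<subseteq> J" and \<epsilon>: "\<And>j. j \<in> F \<Longrightarrow> cmod (\<epsilon> j) \<le> 1"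
  shows "norm (\<Sum>j\<in>F. (\<epsilon> j * \<alpha> j) *\<^sub>C f j) \<le> C * norm (\<Sum>j\<in>F. \<alpha> j *\<^sub>C f j)"
proof -
  have rc: "rc_norm (Suc 0) (tensor_sum F (\<lambda>i k l. \<beta> i) (\<lambda>j. (f j, A (f j))))
      = norm (\<Sum>j\<in>F. \<beta> j *\<^sub>C f j)" for \<beta> :: "nat \<Rightarrow> complex"
  proof -
    have "tensor_sum F (\<lambda>i k l. \<beta> i) (\<lambda>j. (f j, A (f j)))
        = (\<lambda>_ _. (\<Sum>j\<in>F. \<beta> j *\<^sub>C f j, A (\<Sum>j\<in>F. \<beta> j *\<^sub>C f j)))"
      by (intro ext) (simp add: tensor_sum_def prod_eq_iff fst_sum snd_sum A_sum[OF F(2)])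
    then show ?thesis
      using contraction[OF sum_in_D[OF F(2), of \<beta>]] by (simp add: rc_norm_single)
  qed
  have "rc_norm (Suc 0) (tensor_sum F (\<lambda>i k l. \<epsilon> i * \<alpha> i) (\<lambda>j. (f j, A (f j))))
      \<le> C * rc_norm (Suc 0) (tensor_sum F (\<lambda>i k l. \<alpha> i) (\<lambda>j. (f j, A (f j))))"
    using F \<epsilon> by (intro complete_unconditionality)
  then show ?thesis by (simp only: rc)
qed

text \<open>Some choice of signs makes the signed sum at least as large as in the orthogonal case,
  and unconditionality removes the signs at the cost of a factor C in norm.\<close>

lemma riesz_lower:
  assumes F: "finite F" "F \<subseteq> J"
  shows "(\<Sum>j\<in>F. (cmod (\<alpha> j))\<^sup>2) \<le> C\<^sup>2 * (norm (\<Sum>j\<in>F. \<alpha> j *\<^sub>C f j))\<^sup>2"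
proof -
  obtain \<epsilon> :: "nat \<Rightarrow> complex" where \<epsilon>: "\<And>j. \<epsilon> j = 1 \<or> \<epsilon> j = - 1"
    "(\<Sum>m<Suc 0. \<Sum>j\<in>F. (norm (\<alpha> j *\<^sub>C f j))\<^sup>2) \<le> (\<Sum>m<Suc 0. (norm (\<Sum>j\<in>F. \<epsilon> j *\<^sub>C \<alpha> j *\<^sub>C f j))\<^sup>2)"
    using exists_signs_ge[OF F(1), where n = "Suc 0" and z = "\<lambda>j m. \<alpha> j *\<^sub>C f j"] by blast
  have \<epsilon>1: "cmod (\<epsilon> j) \<le> 1" for j using \<epsilon>(1)[of j] by auto
  have "(\<Sum>j\<in>F. (cmod (\<alpha> j))\<^sup>2) = (\<Sum>j\<in>F. (norm (\<alpha> j *\<^sub>C f j))\<^sup>2)"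
    using F norm_f by (intro sum.cong refl) (auto simp: norm_scaleC)
  also have "\<dots> \<le> (norm (\<Sum>j\<in>F. (\<epsilon> j * \<alpha> j) *\<^sub>C f j))\<^sup>2"
    using \<epsilon>(2) by (simp add: scaleC_scaleC)
  also have "\<dots> \<le> (C * norm (\<Sum>j\<in>F. \<alpha> j *\<^sub>C f j))\<^sup>2"
    by (intro power_mono unconditional F \<epsilon>1) auto
  finally show ?thesis by (simp add: power_mult_distrib)
qed

text \<open>The given sum is a sign change of a signed sum that is small by averaging, because signs
  square to 1.\<close>

lemma riesz_upper:
  assumes F: "finite F" "F \<subseteq> J"
  shows "(norm (\<Sum>j\<in>F. \<alpha> j *\<^sub>C f j))\<^sup>2 \<le> C\<^sup>2 * (\<Sum>j\<in>F. (cmod (\<alpha> j))\<^sup>2)"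
proof -
  obtain \<epsilon> :: "nat \<Rightarrow> complex" where \<epsilon>: "\<And>j. \<epsilon> j = 1 \<or> \<epsilon> j = - 1"
    "(\<Sum>m<Suc 0. (norm (\<Sum>j\<in>F. \<epsilon> j *\<^sub>C \<alpha> j *\<^sub>C f j))\<^sup>2) \<le> (\<Sum>m<Suc 0. \<Sum>j\<in>F. (norm (\<alpha> j *\<^sub>C f j))\<^sup>2)"
    using exists_signs_le[OF F(1), where n = "Suc 0" and z = "\<lambda>j m. \<alpha> j *\<^sub>C f j"] by blast
  have \<epsilon>\<epsilon>: "\<epsilon> j * (\<epsilon> j * b) = b" "cmod (\<epsilon> j) \<le> 1" for j b using \<epsilon>(1)[of j] by auto
  have "(norm (\<Sum>j\<in>F. \<alpha> j *\<^sub>C f j))\<^sup>2 = (norm (\<Sum>j\<in>F. (\<epsilon> j * (\<epsilon> j * \<alpha> j)) *\<^sub>C f j))\<^sup>2"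
    by (simp only: \<epsilon>\<epsilon>)
  also have "\<dots> \<le> (C * norm (\<Sum>j\<in>F. (\<epsilon> j * \<alpha> j) *\<^sub>C f j))\<^sup>2"
    by (intro power_mono unconditional F \<epsilon>\<epsilon>) auto
  also have "\<dots> \<le> C\<^sup>2 * (\<Sum>j\<in>F. (norm (\<alpha> j *\<^sub>C f j))\<^sup>2)"
    using \<epsilon>(2) by (simp add: power_mult_distrib scaleC_scaleC mult_left_mono)
  also have "(\<Sum>j\<in>F. (norm (\<alpha> j *\<^sub>C f j))\<^sup>2) = (\<Sum>j\<in>F. (cmod (\<alpha> j))\<^sup>2)"
    using F norm_f by (intro sum.cong refl) (auto simp: norm_scaleC)
  finally show ?thesis .
qed

text \<open>For matrices supported in one column, the column norm is the l2 sum of the images, which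
  is the quantity of interest. Unconditionality controls it only by the full norm, whose row part is
  the operator norm of \<open>c\<close> up to the Riesz constant. This is the origin of the additive
  term with \<open>R\<close>.\<close>

lemma column_sign_change:
  assumes F: "finite F" "F \<subseteq> J" and \<epsilon>: "\<And>j. j \<in> F \<Longrightarrow> cmod (\<epsilon> j) \<le> 1"
    and R: "R \<ge> 0" "row_bounded R n F c"
  shows "(\<Sum>m<n. (norm (\<Sum>j\<in>F. (\<epsilon> j * c m j) *\<^sub>C A (f j)))\<^sup>2)
    \<le> C\<^sup>2 * (C\<^sup>2 * R + (\<Sum>m<n. (norm (\<Sum>j\<in>F. c m j *\<^sub>C A (f j)))\<^sup>2))"
proof (cases "n = 0")
  case True
  then show ?thesis using R by simp
next
  case n: False
  define x where "x = (\<lambda>j. (f j, A (f j)))"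
  define a :: "nat \<Rightarrow> nat \<Rightarrow> nat \<Rightarrow> complex" where "a = (\<lambda>j k l. if l = 0 then c k j else 0)"
  \<comment> \<open>\<open>M\<close> bounds the squares of both the row norm and the column
    norm.\<close>
  define M where "M = C\<^sup>2 * R + (\<Sum>m<n. (norm (\<Sum>j\<in>F. c m j *\<^sub>C A (f j)))\<^sup>2)"
  have M0: "M \<ge> 0" using R by (simp add: M_def sum_nonneg)
  have fst_z: "fst (tensor_sum F a x k l) = (if l = 0 then \<Sum>j\<in>F. c k j *\<^sub>C f j else 0)" for k l
    by (simp add: tensor_sum_def fst_sum a_def x_def)
  have snd_z: "snd (tensor_sum F (\<lambda>j k l. e j * a j k l) x k l)
      = (if l = 0 then \<Sum>j\<in>F. (e j * c k j) *\<^sub>C A (f j) else 0)" for e k l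
    by (simp add: tensor_sum_def snd_sum a_def x_def)
  have col: "(\<Sum>k<n. v k *\<^sub>C (if k = 0 then y else (0::ell2))) = v 0 *\<^sub>C y" for v y
  proof -
    have "(\<Sum>k<n. v k *\<^sub>C (if k = 0 then y else 0)) = (\<Sum>k<n. if k = 0 then v k *\<^sub>C y else 0)"
      by (intro sum.cong) auto
    then show ?thesis using n by simp
  qed
  have "rc_norm n (tensor_sum F a x) \<le> sqrt M"
  proof (subst rc_norm_le_iff_squares, simp add: M0, intro conjI allI)
    fix v :: "nat \<Rightarrow> complex"
    have "(\<Sum>m<n. (norm (\<Sum>k<n. v k *\<^sub>C fst (tensor_sum F a x k m)))\<^sup>2)
        = (\<Sum>m<n. if m = 0 then (norm (\<Sum>k<n. v k *\<^sub>C (\<Sum>j\<in>F. c k j *\<^sub>C f j)))\<^sup>2 else 0)"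
      by (intro sum.cong) (auto simp: fst_z)
    also have "\<dots> = (norm (\<Sum>k<n. v k *\<^sub>C (\<Sum>j\<in>F. c k j *\<^sub>C f j)))\<^sup>2" using n by simp
    also have "(\<Sum>k<n. v k *\<^sub>C (\<Sum>j\<in>F. c k j *\<^sub>C f j)) = (\<Sum>j\<in>F. (\<Sum>k<n. v k * c k j) *\<^sub>C f j)"
      by (rule sum_scaleC_swap)
    also have "(norm \<dots>)\<^sup>2 \<le> C\<^sup>2 * (\<Sum>j\<in>F. (cmod (\<Sum>k<n. v k * c k j))\<^sup>2)"
      by (rule riesz_upper[OF F])
    also have "\<dots> \<le> C\<^sup>2 * (R * (\<Sum>k<n. (cmod (v k))\<^sup>2))"
      using R(2) by (intro mult_left_mono) (auto simp: row_bounded_def)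
    also have "\<dots> \<le> M * (\<Sum>k<n. (cmod (v k))\<^sup>2)"
      unfolding mult.assoc[symmetric] by (intro mult_right_mono) (auto simp: M_def sum_nonneg)
    finally show "(\<Sum>m<n. (norm (\<Sum>k<n. v k *\<^sub>C fst (tensor_sum F a x k m)))\<^sup>2)
        \<le> (sqrt M)\<^sup>2 * (\<Sum>k<n. (cmod (v k))\<^sup>2)" using M0 by simp
  next
    fix v :: "nat \<Rightarrow> complex"
    have "(\<Sum>m<n. (norm (\<Sum>k<n. v k *\<^sub>C snd (tensor_sum F a x m k)))\<^sup>2)
        = (\<Sum>m<n. (cmod (v 0))\<^sup>2 * (norm (\<Sum>j\<in>F. c m j *\<^sub>C A (f j)))\<^sup>2)"
      using snd_z[of "\<lambda>_. 1"] by (simp add: col norm_scaleC power_mult_distrib)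
    also have "\<dots> = (cmod (v 0))\<^sup>2 * (\<Sum>m<n. (norm (\<Sum>j\<in>F. c m j *\<^sub>C A (f j)))\<^sup>2)"
      by (simp add: sum_distrib_left)
    also have "\<dots> \<le> (\<Sum>k<n. (cmod (v k))\<^sup>2) * M"
      using n R member_le_sum[of 0 "{..<n}" "\<lambda>k. (cmod (v k))\<^sup>2"]
      by (intro mult_mono) (auto simp: M_def sum_nonneg)
    finally show "(\<Sum>m<n. (norm (\<Sum>k<n. v k *\<^sub>C snd (tensor_sum F a x m k)))\<^sup>2)
        \<le> (sqrt M)\<^sup>2 * (\<Sum>k<n. (cmod (v k))\<^sup>2)" using M0 by (simp add: mult.commute)
  qed
  then have "C * rc_norm n (tensor_sum F a x) \<le> C * sqrt M"
    using C_ge_1 by (intro mult_left_mono) auto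
  moreover have "rc_norm n (tensor_sum F (\<lambda>i k l. \<epsilon> i * a i k l) x) \<le> C * rc_norm n (tensor_sum F a x)"
    unfolding x_def using F \<epsilon> by (intro complete_unconditionality)
  ultimately have "rc_norm n (tensor_sum F (\<lambda>i k l. \<epsilon> i * a i k l) x) \<le> C * sqrt M" by linarith
  then have "(\<Sum>m<n. (norm (\<Sum>k<n. v k *\<^sub>C snd (tensor_sum F (\<lambda>i k l. \<epsilon> i * a i k l) x m k)))\<^sup>2)
      \<le> (C * sqrt M)\<^sup>2 * (\<Sum>k<n. (cmod (v k))\<^sup>2)" for v
    using rc_norm_le_iff_squares[of "C * sqrt M"] C_ge_1 M0 by simp
  \<comment> \<open>The unit vector at index 0 picks out the only nonzero column.\<close>
  from this[of "\<lambda>k. if k = 0 then 1 else 0"]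
  have "(\<Sum>m<n. (norm (\<Sum>j\<in>F. (\<epsilon> j * c m j) *\<^sub>C A (f j)))\<^sup>2)
      \<le> (C * sqrt M)\<^sup>2 * (\<Sum>k<n. (cmod (if k = 0 then 1 else 0))\<^sup>2)"
    by (simp add: snd_z col scaleC_one)
  also have "(\<Sum>k<n. (cmod (if k = 0 then 1 else 0))\<^sup>2) = (\<Sum>k<n. if k = 0 then 1 else (0::real))"
    by (intro sum.cong) auto
  also have "\<dots> = 1" using n by simp
  finally show ?thesis using M0 by (simp add: M_def power_mult_distrib)
qed

text \<open>For a suitable choice of signs the signed images are at least as large as the diagonal
  sum, and \<open>column_sign_change\<close> compares them with the unsigned images.\<close>

lemma weights_le_image:
  assumes F: "finite F" "F \<subseteq> J" and R: "R \<ge> 0" "row_bounded R n F c"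
  shows "(\<Sum>m<n. \<Sum>j\<in>F. (norm (A (f j)))\<^sup>2 * (cmod (c m j))\<^sup>2)
    \<le> C\<^sup>2 * (C\<^sup>2 * R + (\<Sum>m<n. (norm (\<Sum>j\<in>F. c m j *\<^sub>C A (f j)))\<^sup>2))"
proof -
  obtain \<epsilon> :: "nat \<Rightarrow> complex" where \<epsilon>: "\<And>j. \<epsilon> j = 1 \<or> \<epsilon> j = - 1"
    "(\<Sum>m<n. \<Sum>j\<in>F. (norm (c m j *\<^sub>C A (f j)))\<^sup>2)
      \<le> (\<Sum>m<n. (norm (\<Sum>j\<in>F. \<epsilon> j *\<^sub>C c m j *\<^sub>C A (f j)))\<^sup>2)"
    using exists_signs_ge[OF F(1), where n = n and z = "\<lambda>j m. c m j *\<^sub>C A (f j)"] by blast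
  have "cmod (\<epsilon> j) \<le> 1" for j using \<epsilon>(1)[of j] by auto
  from column_sign_change[where \<epsilon> = \<epsilon>, OF F this R] \<epsilon>(2) show ?thesis
    by (simp add: norm_scaleC power_mult_distrib scaleC_scaleC mult.commute)
qed

text \<open>Signs making the images small are moved into the coefficients, which leaves the row
  bound unchanged, and are then removed by \<open>column_sign_change\<close>.\<close>

lemma image_le_weights:
  assumes F: "finite F" "F \<subseteq> J" and R: "R \<ge> 0" "row_bounded R n F c"
  shows "(\<Sum>m<n. (norm (\<Sum>j\<in>F. c m j *\<^sub>C A (f j)))\<^sup>2)
    \<le> C\<^sup>2 * (C\<^sup>2 * R + (\<Sum>m<n. \<Sum>j\<in>F. (norm (A (f j)))\<^sup>2 * (cmod (c m j))\<^sup>2))"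
proof -
  obtain \<epsilon> :: "nat \<Rightarrow> complex" where \<epsilon>: "\<And>j. \<epsilon> j = 1 \<or> \<epsilon> j = - 1"
    "(\<Sum>m<n. (norm (\<Sum>j\<in>F. \<epsilon> j *\<^sub>C c m j *\<^sub>C A (f j)))\<^sup>2)
      \<le> (\<Sum>m<n. \<Sum>j\<in>F. (norm (c m j *\<^sub>C A (f j)))\<^sup>2)"
    using exists_signs_le[OF F(1), where n = n and z = "\<lambda>j m. c m j *\<^sub>C A (f j)"] by blast
  have \<epsilon>\<epsilon>: "\<epsilon> j * (\<epsilon> j * b) = b" "cmod (\<epsilon> j * b) = cmod b" "cmod (\<epsilon> j) \<le> 1" for j b
    using \<epsilon>(1)[of j] by (auto simp: norm_mult)
  have "row_bounded R n F (\<lambda>m j. \<epsilon> j * c m j)"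
    unfolding row_bounded_def
  proof
    fix w :: "nat \<Rightarrow> complex"
    have "(\<Sum>m<n. w m * (\<epsilon> j * c m j)) = \<epsilon> j * (\<Sum>m<n. w m * c m j)" for j
      by (simp add: sum_distrib_left mult.left_commute)
    then show "(\<Sum>j\<in>F. (cmod (\<Sum>m<n. w m * (\<epsilon> j * c m j)))\<^sup>2) \<le> R * (\<Sum>m<n. (cmod (w m))\<^sup>2)"
      using R(2) unfolding row_bounded_def by (simp only: \<epsilon>\<epsilon>)
  qed
  from column_sign_change[where \<epsilon> = \<epsilon>, OF F \<epsilon>\<epsilon>(3) R(1) this]
  have "(\<Sum>m<n. (norm (\<Sum>j\<in>F. c m j *\<^sub>C A (f j)))\<^sup>2)
      \<le> C\<^sup>2 * (C\<^sup>2 * R + (\<Sum>m<n. (norm (\<Sum>j\<in>F. (\<epsilon> j * c m j) *\<^sub>C A (f j)))\<^sup>2))"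
    by (simp only: \<epsilon>\<epsilon>)
  also have "\<dots> \<le> C\<^sup>2 * (C\<^sup>2 * R + (\<Sum>m<n. \<Sum>j\<in>F. (norm (A (f j)))\<^sup>2 * (cmod (c m j))\<^sup>2))"
    using \<epsilon>(2) by (intro mult_left_mono add_left_mono)
      (simp_all add: norm_scaleC power_mult_distrib scaleC_scaleC mult.commute)
  finally show ?thesis .
qed

text \<open>The summable perturbation makes all weights positive. Since they tend to zero, their decreasing
  order then has all initial segments finite, even when \<open>A\<close> has a kernel.\<close>

definition weight :: "nat \<Rightarrow> real" where
  "weight j = (norm (A (f j)))\<^sup>2 + (1 / 2) ^ Suc j"

lemma weight_pos: "weight j > 0"
  by (simp add: weight_def add_nonneg_pos)

lemma weight_le_2: "j \<in> J \<Longrightarrow> weight j \<le> 2"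
proof -
  assume j: "j \<in> J"
  have "(norm (A (f j)))\<^sup>2 \<le> 1\<^sup>2"
    using contraction[OF f_D[OF j]] norm_f[OF j] by (intro power_mono) auto
  moreover have "(1 / 2 :: real) ^ Suc j \<le> 1" by (intro power_le_one) auto
  ultimately show ?thesis by (simp add: weight_def)
qed

text \<open>A weight above \<tau> has a summand of size at least \<tau> / 2. Compactness of
  \<open>A\<close> together with the upper Riesz bound leaves finitely many such indices for the
  first summand, and decay of the powers does so for the second.\<close>

lemma finite_large_weight:
  assumes "\<tau> > 0"
  shows "finite {j \<in> J. weight j > \<tau>}"
proof -
  have bd: "(norm (\<Sum>j\<in>F. f j))\<^sup>2 \<le> C\<^sup>2 * real (card F)" if "finite F" "F \<subseteq> J" for F
    using riesz_upper[OF that, of "\<lambda>_. 1"] by (simp add: scaleC_one)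
  have "finite {j \<in> J. norm (A (f j)) > sqrt (\<tau> / 2)}"
    by (rule finite_large_image[OF subspace_D A _ _ bd]) (use f_D norm_f assms in auto)
  moreover have "\<exists>N. \<forall>j\<ge>N. (1 / 2 :: real) ^ Suc j < \<tau> / 2"
    using order_tendstoD(2)[OF LIMSEQ_Suc[OF LIMSEQ_power_zero[of "1 / 2 :: real"]], of "\<tau> / 2"] assms
    by (simp add: eventually_sequentially)
  then obtain N where N: "\<And>j. j \<ge> N \<Longrightarrow> (1 / 2 :: real) ^ Suc j < \<tau> / 2" by blast
  have "{j \<in> J. weight j > \<tau>} \<subseteq> {j \<in> J. norm (A (f j)) > sqrt (\<tau> / 2)} \<union> {..<N}"
  proof
    fix j assume j: "j \<in> {j \<in> J. weight j > \<tau>}"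
    show "j \<in> {j \<in> J. norm (A (f j)) > sqrt (\<tau> / 2)} \<union> {..<N}"
    proof (cases "j < N")
      case False
      then have "(norm (A (f j)))\<^sup>2 > \<tau> / 2" using N[of j] j by (simp add: weight_def)
      then have "norm (A (f j)) > sqrt (\<tau> / 2)"
        using real_sqrt_less_mono[of "\<tau> / 2" "(norm (A (f j)))\<^sup>2"] by simp
      then show ?thesis using j by simp
    qed simp
  qed
  ultimately show ?thesis by (meson finite_UnI finite_lessThan finite_subset)
qed

text \<open>Each column of \<open>c\<close> has squared length at most \<open>R\<close>, so the
  perturbations, whose sum is at most 1, only add another multiple of \<open>R\<close>.\<close>

lemma perturbed_weights_le_image:
  assumes F: "finite F" "F \<subseteq> J" and R: "R \<ge> 0" "row_bounded R n F c"
  shows "(\<Sum>m<n. \<Sum>j\<in>F. weight j * (cmod (c m j))\<^sup>2)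
    \<le> 2 * C ^ 4 * R + C\<^sup>2 * (\<Sum>m<n. (norm (\<Sum>j\<in>F. c m j *\<^sub>C A (f j)))\<^sup>2)"
proof -
  have "(\<Sum>m<n. \<Sum>j\<in>F. (1 / 2) ^ Suc j * (cmod (c m j))\<^sup>2)
      = (\<Sum>j\<in>F. (1 / 2) ^ Suc j * (\<Sum>m<n. (cmod (c m j))\<^sup>2))"
    by (subst sum.swap) (simp add: sum_distrib_left)
  also have "\<dots> \<le> (\<Sum>j\<in>F. (1 / 2) ^ Suc j * R)"
    using row_bounded_column[OF R(2) F(1) _ R(1)] by (intro sum_mono mult_left_mono) auto
  also have "\<dots> \<le> 1 * R"
    unfolding sum_distrib_right[symmetric] by (intro mult_right_mono sum_half_powers_le F R)
  also have "\<dots> \<le> C ^ 4 * R" using C_power_ge_1 R by (intro mult_right_mono) auto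
  finally have "(\<Sum>m<n. \<Sum>j\<in>F. (1 / 2) ^ Suc j * (cmod (c m j))\<^sup>2) \<le> C ^ 4 * R" .
  moreover have "C\<^sup>2 * (C\<^sup>2 * R) = C ^ 4 * R" by (simp add: power2_eq_square power4_eq_xxxx)
  ultimately show ?thesis
    using weights_le_image[OF F R] by (simp add: weight_def distrib_left distrib_right sum.distrib)
qed

text \<open>\<open>riesz_lower\<close> makes the coefficient functionals continuous, so the
  coefficients of approximating finite sums converge. Once the part over \<open>V\<close> is
  subtracted, the approximants involve only \<open>J - V\<close>.\<close>

lemma decompose:
  assumes V: "finite V" "V \<subseteq> J" and x: "x \<in> D"
  shows "\<exists>c. x - (\<Sum>i\<in>V. c i *\<^sub>C f i) \<in> closed_cspan (f ` (J - V))"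
proof -
  obtain g where g: "\<And>m. g m \<in> cvec.span (f ` J)" "g \<longlonglongrightarrow> x"
    using x unfolding span_f[symmetric] closed_cspan_def closure_sequential by blast
  obtain F a where F: "\<And>m. finite (F m)" "\<And>m. F m \<subseteq> J" "\<And>m j. j \<notin> F m \<Longrightarrow> a m j = 0"
    "\<And>m. g m = (\<Sum>j\<in>F m. a m j *\<^sub>C f j)"
    using cspan_finite_sum_choice[of g f "\<lambda>_. J"] g(1) by blast
  have ext: "g m = (\<Sum>j\<in>G. a m j *\<^sub>C f j)" if "finite G" "F m \<subseteq> G" for m G
    unfolding F(4) using that F(3) by (intro sum.mono_neutral_left) auto
  have diff: "cmod (a m i - a p i) \<le> C * norm (g m - g p)" if i: "i \<in> V" for m p i
  proof -
    define G where "G = F m \<union> F p \<union> V"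
    have G: "finite G" "G \<subseteq> J" using F V by (auto simp: G_def)
    have "g m - g p = (\<Sum>j\<in>G. (a m j - a p j) *\<^sub>C f j)"
      unfolding cvec.scale_left_diff_distrib sum_subtractf
      by (intro arg_cong2[of _ _ _ _ minus] ext G) (auto simp: G_def)
    then have "(\<Sum>j\<in>G. (cmod (a m j - a p j))\<^sup>2) \<le> (C * norm (g m - g p))\<^sup>2"
      using riesz_lower[OF G, of "\<lambda>j. a m j - a p j"] by (simp add: power_mult_distrib)
    moreover have "(cmod (a m i - a p i))\<^sup>2 \<le> (\<Sum>j\<in>G. (cmod (a m j - a p j))\<^sup>2)"
      using i G(1) by (intro member_le_sum) (auto simp: G_def)
    ultimately have "(cmod (a m i - a p i))\<^sup>2 \<le> (C * norm (g m - g p))\<^sup>2" by linarith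
    then show ?thesis by (rule power2_le_imp_le) (use C_ge_1 in auto)
  qed
  have "\<exists>l. (\<lambda>m. a m i) \<longlonglongrightarrow> l" if i: "i \<in> V" for i
  proof -
    have "Cauchy (\<lambda>m. a m i)"
    proof (rule metric_CauchyI)
      fix e :: real assume e: "e > 0"
      then have "e / C > 0" using C_ge_1 by simp
      then obtain M where M: "\<forall>m\<ge>M. \<forall>p\<ge>M. dist (g m) (g p) < e / C"
        using LIMSEQ_imp_Cauchy[OF g(2)] unfolding Cauchy_def by blast
      have "dist (a m i) (a p i) < e" if "m \<ge> M" "p \<ge> M" for m p
      proof -
        have "C * norm (g m - g p) < e"
          using M that C_ge_1 by (simp add: dist_norm field_simps)
        then show ?thesis using diff[OF i, of m p] by (simp add: dist_norm)
      qed
      then show "\<exists>M. \<forall>m\<ge>M. \<forall>p\<ge>M. dist (a m i) (a p i) < e" by blast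
    qed
    then show ?thesis using Cauchy_convergent_iff convergent_def by blast
  qed
  then obtain c where c: "\<And>i. i \<in> V \<Longrightarrow> (\<lambda>m. a m i) \<longlonglongrightarrow> c i" by metis
  have "g m - (\<Sum>i\<in>V. a m i *\<^sub>C f i) \<in> cvec.span (f ` (J - V))" for m
  proof -
    have "g m = (\<Sum>j\<in>(F m - V) \<union> V. a m j *\<^sub>C f j)"
      by (rule ext) (use F V in auto)
    also have "\<dots> = (\<Sum>j\<in>F m - V. a m j *\<^sub>C f j) + (\<Sum>i\<in>V. a m i *\<^sub>C f i)"
      by (rule sum.union_disjoint) (use F V in auto)
    finally have "g m - (\<Sum>i\<in>V. a m i *\<^sub>C f i) = (\<Sum>j\<in>F m - V. a m j *\<^sub>C f j)" by simp
    also have "\<dots> \<in> cvec.span (f ` (J - V))"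
      using F(2) by (intro cvec.span_sum cvec.span_scale cvec.span_base) auto
    finally show ?thesis .
  qed
  moreover have "(\<lambda>m. g m - (\<Sum>i\<in>V. a m i *\<^sub>C f i)) \<longlonglongrightarrow> x - (\<Sum>i\<in>V. c i *\<^sub>C f i)"
    by (intro tendsto_intros g c)
  ultimately show ?thesis
    unfolding closed_cspan_def closure_sequential
    by (intro exI[of _ c] exI[of _ "\<lambda>m. g m - (\<Sum>i\<in>V. a m i *\<^sub>C f i)"]) simp
qed

text \<open>A combination of the \<open>g k\<close> with scalars \<open>w\<close> has the
  coefficients that result from applying \<open>c\<close> to \<open>w\<close>. The lower Riesz bound
  thus turns an upper bound for such combinations into an operator bound for
  \<open>c\<close>.\<close>

lemma row_bounded_coefficients:
  assumes F: "finite F" "F \<subseteq> J" and g: "\<And>k. k < n \<Longrightarrow> g k = (\<Sum>j\<in>F. c k j *\<^sub>C f j)"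
    and \<rho>: "\<And>w. (norm (\<Sum>k<n. w k *\<^sub>C g k))\<^sup>2 \<le> \<rho> * (\<Sum>k<n. (cmod (w k))\<^sup>2)"
  shows "row_bounded (C\<^sup>2 * \<rho>) n F c"
  unfolding row_bounded_def
proof
  fix w :: "nat \<Rightarrow> complex"
  have "(\<Sum>j\<in>F. (cmod (\<Sum>m<n. w m * c m j))\<^sup>2)
      \<le> C\<^sup>2 * (norm (\<Sum>j\<in>F. (\<Sum>m<n. w m * c m j) *\<^sub>C f j))\<^sup>2"
    by (rule riesz_lower[OF F, where \<alpha> = "\<lambda>j. \<Sum>m<n. w m * c m j"])
  also have "(\<Sum>j\<in>F. (\<Sum>m<n. w m * c m j) *\<^sub>C f j) = (\<Sum>m<n. w m *\<^sub>C g m)"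
    unfolding sum_scaleC_swap[symmetric] using g by (intro sum.cong) auto
  also have "C\<^sup>2 * (norm \<dots>)\<^sup>2 \<le> C\<^sup>2 * (\<rho> * (\<Sum>m<n. (cmod (w m))\<^sup>2))"
    using \<rho> by (intro mult_left_mono) auto
  finally show "(\<Sum>j\<in>F. (cmod (\<Sum>m<n. w m * c m j))\<^sup>2) \<le> C\<^sup>2 * \<rho> * (\<Sum>m<n. (cmod (w m))\<^sup>2)"
    by (simp add: mult.assoc)
qed

text \<open>The coefficients of a unit vector have squared length at least 1 / C^2, so if they sit
  where the weight is at least \<open>\<kappa> k\<close>, the weighted sum is at least
  \<open>\<kappa> k\<close> / C^2. For an orthonormal system the row bound is C^2 however many
  vectors there are, and so the error term does not depend on \<open>n\<close>.\<close>

lemma orthonormal_weights_le_image: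
  fixes n :: nat
  assumes on: "orthonormal {..<n} g" and F: "finite F" "F \<subseteq> J"
    and g: "\<And>k. k < n \<Longrightarrow> g k = (\<Sum>j\<in>F. c k j *\<^sub>C f j)"
    and \<kappa>: "\<And>k j. k < n \<Longrightarrow> j \<in> F \<Longrightarrow> c k j \<noteq> 0 \<Longrightarrow> \<kappa> k \<le> weight j"
  shows "(\<Sum>k<n. \<kappa> k) \<le> 2 * C ^ 8 + C ^ 4 * (\<Sum>k<n. (norm (A (g k)))\<^sup>2)"
proof -
  have "row_bounded (C\<^sup>2 * 1) n F c"
    by (rule row_bounded_coefficients[OF F g]) (simp_all add: norm_sum_orthonormal[OF _ on])
  from perturbed_weights_le_image[OF F _ this]
  have "(\<Sum>m<n. \<Sum>j\<in>F. weight j * (cmod (c m j))\<^sup>2)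
      \<le> 2 * C ^ 4 * C\<^sup>2 + C\<^sup>2 * (\<Sum>m<n. (norm (\<Sum>j\<in>F. c m j *\<^sub>C A (f j)))\<^sup>2)" by simp
  also have "(\<Sum>m<n. (norm (\<Sum>j\<in>F. c m j *\<^sub>C A (f j)))\<^sup>2) = (\<Sum>k<n. (norm (A (g k)))\<^sup>2)"
    using g A_sum[OF F(2)] by (intro sum.cong) auto
  finally have 1: "(\<Sum>m<n. \<Sum>j\<in>F. weight j * (cmod (c m j))\<^sup>2)
      \<le> 2 * C ^ 4 * C\<^sup>2 + C\<^sup>2 * (\<Sum>k<n. (norm (A (g k)))\<^sup>2)" .
  have "(\<Sum>k<n. \<kappa> k) \<le> (\<Sum>k<n. C\<^sup>2 * (\<Sum>j\<in>F. weight j * (cmod (c k j))\<^sup>2))"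
  proof (intro sum_mono)
    fix k assume k: "k \<in> {..<n}"
    show "\<kappa> k \<le> C\<^sup>2 * (\<Sum>j\<in>F. weight j * (cmod (c k j))\<^sup>2)"
    proof (cases "\<kappa> k \<le> 0")
      case True
      also have "0 \<le> C\<^sup>2 * (\<Sum>j\<in>F. weight j * (cmod (c k j))\<^sup>2)"
        using weight_pos by (intro mult_nonneg_nonneg sum_nonneg) (auto simp: less_imp_le)
      finally show ?thesis .
    next
      case False
      have "1 = (norm (g k))\<^sup>2" using orthonormal_norm[OF on k] by simp
      also have "\<dots> \<le> C\<^sup>2 * (\<Sum>j\<in>F. (cmod (c k j))\<^sup>2)"
        using riesz_upper[OF F, of "c k"] g k by simp
      finally have "\<kappa> k * 1 \<le> \<kappa> k * (C\<^sup>2 * (\<Sum>j\<in>F. (cmod (c k j))\<^sup>2))"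
        using False by (intro mult_left_mono) auto
      also have "\<dots> = C\<^sup>2 * (\<Sum>j\<in>F. \<kappa> k * (cmod (c k j))\<^sup>2)"
        by (simp add: sum_distrib_left mult.left_commute)
      also have "\<dots> \<le> C\<^sup>2 * (\<Sum>j\<in>F. weight j * (cmod (c k j))\<^sup>2)"
      proof (intro mult_left_mono sum_mono)
        fix j assume "j \<in> F"
        then show "\<kappa> k * (cmod (c k j))\<^sup>2 \<le> weight j * (cmod (c k j))\<^sup>2"
          using \<kappa>[of k j] k by (cases "c k j = 0") (auto intro: mult_right_mono)
      qed simp
      finally show ?thesis by simp
    qed
  qed
  also have "\<dots> = C\<^sup>2 * (\<Sum>m<n. \<Sum>j\<in>F. weight j * (cmod (c m j))\<^sup>2)"
    by (simp add: sum_distrib_left)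
  also have "\<dots> \<le> C\<^sup>2 * (2 * C ^ 4 * C\<^sup>2 + C\<^sup>2 * (\<Sum>k<n. (norm (A (g k)))\<^sup>2))"
    using 1 by (intro mult_left_mono) auto
  also have "\<dots> = 2 * C ^ 8 + C ^ 4 * (\<Sum>k<n. (norm (A (g k)))\<^sup>2)"
    by (simp add: algebra_simps power_add[symmetric])
  finally show ?thesis .
qed

text \<open>A general constant \<rho> replaces orthonormality, because the estimate will be applied
  to finite sums that only approximate an orthonormal system.\<close>

lemma span_image_le_weights:
  fixes n :: nat
  assumes F: "finite F" "F \<subseteq> J" and g: "\<And>k. k < n \<Longrightarrow> g k = (\<Sum>j\<in>F. c k j *\<^sub>C f j)"
    and \<tau>: "\<And>k j. k < n \<Longrightarrow> j \<in> F \<Longrightarrow> c k j \<noteq> 0 \<Longrightarrow> weight j \<le> \<tau> k"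
    and \<tau>0: "\<And>k. k < n \<Longrightarrow> \<tau> k \<ge> 0"
    and \<rho>: "\<rho> \<ge> 0" "\<And>w. (norm (\<Sum>k<n. w k *\<^sub>C g k))\<^sup>2 \<le> \<rho> * (\<Sum>k<n. (cmod (w k))\<^sup>2)"
  shows "(\<Sum>k<n. (norm (A (g k)))\<^sup>2) \<le> C ^ 6 * \<rho> + C ^ 4 * (\<Sum>k<n. \<tau> k * (norm (g k))\<^sup>2)"
proof -
  have "row_bounded (C\<^sup>2 * \<rho>) n F c" by (rule row_bounded_coefficients[OF F g \<rho>(2)])
  from image_le_weights[OF F _ this] \<rho>
  have 1: "(\<Sum>m<n. (norm (\<Sum>j\<in>F. c m j *\<^sub>C A (f j)))\<^sup>2)
    \<le> C\<^sup>2 * (C\<^sup>2 * (C\<^sup>2 * \<rho>) + (\<Sum>m<n. \<Sum>j\<in>F. (norm (A (f j)))\<^sup>2 * (cmod (c m j))\<^sup>2))" by simp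
  have "(\<Sum>m<n. \<Sum>j\<in>F. (norm (A (f j)))\<^sup>2 * (cmod (c m j))\<^sup>2) \<le> (\<Sum>m<n. \<tau> m * (C\<^sup>2 * (norm (g m))\<^sup>2))"
  proof (intro sum_mono)
    fix m assume m: "m \<in> {..<n}"
    have "(\<Sum>j\<in>F. (norm (A (f j)))\<^sup>2 * (cmod (c m j))\<^sup>2) \<le> (\<Sum>j\<in>F. \<tau> m * (cmod (c m j))\<^sup>2)"
    proof (intro sum_mono)
      fix j assume j: "j \<in> F"
      show "(norm (A (f j)))\<^sup>2 * (cmod (c m j))\<^sup>2 \<le> \<tau> m * (cmod (c m j))\<^sup>2"
      proof (cases "c m j = 0")
        case False
        have "(norm (A (f j)))\<^sup>2 \<le> weight j" by (simp add: weight_def)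
        also have "\<dots> \<le> \<tau> m" using \<tau>[of m j] m j False by simp
        finally show ?thesis by (intro mult_right_mono) auto
      qed simp
    qed
    also have "\<dots> = \<tau> m * (\<Sum>j\<in>F. (cmod (c m j))\<^sup>2)" by (simp add: sum_distrib_left)
    also have "\<dots> \<le> \<tau> m * (C\<^sup>2 * (norm (g m))\<^sup>2)"
      using riesz_lower[OF F, of "c m"] g[of m] \<tau>0[of m] m by (intro mult_left_mono) auto
    finally show "(\<Sum>j\<in>F. (norm (A (f j)))\<^sup>2 * (cmod (c m j))\<^sup>2) \<le> \<tau> m * (C\<^sup>2 * (norm (g m))\<^sup>2)" .
  qed
  also have "\<dots> = C\<^sup>2 * (\<Sum>m<n. \<tau> m * (norm (g m))\<^sup>2)"
    by (simp add: sum_distrib_left mult.left_commute)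
  finally have "C\<^sup>2 * (C\<^sup>2 * (C\<^sup>2 * \<rho>) + (\<Sum>m<n. \<Sum>j\<in>F. (norm (A (f j)))\<^sup>2 * (cmod (c m j))\<^sup>2))
      \<le> C\<^sup>2 * (C\<^sup>2 * (C\<^sup>2 * \<rho>) + C\<^sup>2 * (\<Sum>m<n. \<tau> m * (norm (g m))\<^sup>2))"
    by (intro mult_left_mono add_left_mono) auto
  also have "\<dots> = C ^ 6 * \<rho> + C ^ 4 * (\<Sum>k<n. \<tau> k * (norm (g k))\<^sup>2)"
    by (simp add: algebra_simps power_add[symmetric])
  finally show ?thesis using 1 g A_sum[OF F(2)] by simp
qed

text \<open>Vectors obtained from \<open>decompose\<close> lie only in closed spans. The finite sums
  \<open>h k i\<close> approximate them and satisfy the preceding estimate with \<rho> = (1 + \<eta>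
  i)^2, where \<eta> tends to 0.\<close>

lemma orthonormal_image_le_weights:
  fixes n :: nat
  assumes on: "orthonormal {..<n} g" and \<tau>0: "\<And>k. k < n \<Longrightarrow> \<tau> k \<ge> 0"
    and g: "\<And>k. k < n \<Longrightarrow> g k \<in> closed_cspan (f ` {j \<in> J. weight j \<le> \<tau> k})"
  shows "(\<Sum>k<n. (norm (A (g k)))\<^sup>2) \<le> C ^ 6 + C ^ 4 * (\<Sum>k<n. \<tau> k)"
proof -
  define S where "S = (\<lambda>k. {j \<in> J. weight j \<le> \<tau> k})"
  have "\<exists>h. (\<forall>i. h i \<in> cvec.span (f ` S k)) \<and> (k < n \<longrightarrow> h \<longlonglongrightarrow> g k)" for k
  proof (cases "k < n")
    case True
    then show ?thesis using g[of k] unfolding closed_cspan_def closure_sequential S_def by blast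
  next
    case False
    then show ?thesis by (intro exI[of _ "\<lambda>_. 0"]) (auto simp: cvec.span_zero)
  qed
  then obtain h where h: "\<And>k i. h k i \<in> cvec.span (f ` S k)" "\<And>k. k < n \<Longrightarrow> h k \<longlonglongrightarrow> g k" by metis
  have "h (fst t) (snd t) \<in> cvec.span (f ` S (fst t))" for t by (rule h(1))
  from cspan_finite_sum_choice[of "\<lambda>t. h (fst t) (snd t)" f "\<lambda>t. S (fst t)", OF this]
  obtain F' a' where F': "\<And>t. finite (F' t)" "\<And>t. F' t \<subseteq> S (fst t)" "\<And>t j. j \<notin> F' t \<Longrightarrow> a' t j = 0"
    "\<And>t. h (fst t) (snd t) = (\<Sum>j\<in>F' t. a' t j *\<^sub>C f j)" by blast
  define F a where "F = (\<lambda>k i. F' (k, i))" and "a = (\<lambda>k i. a' (k, i))"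
  have F: "\<And>k i. finite (F k i)" "\<And>k i. F k i \<subseteq> S k" "\<And>k i j. j \<notin> F k i \<Longrightarrow> a k i j = 0"
    "\<And>k i. h k i = (\<Sum>j\<in>F k i. a k i j *\<^sub>C f j)"
    using F'(1,3) F'(2,4)[of "(_, _)"] by (simp_all add: F_def a_def)
  define \<eta> where "\<eta> = (\<lambda>i. \<Sum>k<n. norm (h k i - g k))"
  have SJ: "S k \<subseteq> J" for k by (auto simp: S_def)
  have hD: "h k i \<in> D" for k i
    unfolding F(4) using F(2) SJ by (intro sum_in_D) blast
  have gD: "g k \<in> D" if "k < n" for k
    using closed_sequentially[OF closed_D _ h(2)[OF that]] hD by blast
  have le: "(\<Sum>k<n. (norm (A (h k i)))\<^sup>2) \<le> C ^ 6 * (1 + \<eta> i)\<^sup>2 + C ^ 4 * (\<Sum>k<n. \<tau> k * (norm (h k i))\<^sup>2)" for i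
  proof -
    define G where "G = (\<Union>k<n. F k i)"
    show ?thesis
    proof (rule span_image_le_weights[where F = G and c = "\<lambda>k. a k i"])
      show "finite G" by (simp add: G_def F)
      show "G \<subseteq> J" using F(2) SJ unfolding G_def by blast
      show "h k i = (\<Sum>j\<in>G. a k i j *\<^sub>C f j)" if "k < n" for k
        unfolding F(4) using that F(3) \<open>finite G\<close> by (intro sum.mono_neutral_left) (auto simp: G_def)
      show "weight j \<le> \<tau> k" if "k < n" "j \<in> G" "a k i j \<noteq> 0" for k j
        using that F(3)[of j k i] F(2)[of k i] by (auto simp: S_def)
      show "(1 + \<eta> i)\<^sup>2 \<ge> 0" by simp
      fix w :: "nat \<Rightarrow> complex"
      define r where "r = L2_set (\<lambda>k. cmod (w k)) {..<n}"
      have w: "cmod (w k) \<le> r" if "k < n" for k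
        unfolding r_def using that member_le_L2_set[of "{..<n}" k "\<lambda>k. cmod (w k)"] by auto
      have "norm (\<Sum>k<n. w k *\<^sub>C g k) = r"
        using norm_sum_orthonormal[OF _ on, of w] by (simp add: r_def L2_set_def real_sqrt_unique)
      moreover have "norm (\<Sum>k<n. w k *\<^sub>C (h k i - g k)) \<le> (\<Sum>k<n. r * norm (h k i - g k))"
        using w by (intro order_trans[OF norm_sum_scaleC_le] sum_mono mult_right_mono) auto
      moreover have "(\<Sum>k<n. w k *\<^sub>C h k i) = (\<Sum>k<n. w k *\<^sub>C g k) + (\<Sum>k<n. w k *\<^sub>C (h k i - g k))"
        by (simp add: sum.distrib[symmetric] scaleC_add_right[symmetric])
      ultimately have "norm (\<Sum>k<n. w k *\<^sub>C h k i) \<le> r + r * \<eta> i"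
        using norm_triangle_ineq[of "\<Sum>k<n. w k *\<^sub>C g k" "\<Sum>k<n. w k *\<^sub>C (h k i - g k)"]
        by (simp add: \<eta>_def sum_distrib_left)
      then have "(norm (\<Sum>k<n. w k *\<^sub>C h k i))\<^sup>2 \<le> ((1 + \<eta> i) * r)\<^sup>2"
        by (intro power_mono) (auto simp: algebra_simps)
      then show "(norm (\<Sum>k<n. w k *\<^sub>C h k i))\<^sup>2 \<le> (1 + \<eta> i)\<^sup>2 * (\<Sum>k<n. (cmod (w k))\<^sup>2)"
        by (simp add: power_mult_distrib r_def L2_set_cmod_sq)
    qed (use \<tau>0 in auto)
  qed
  have \<eta>: "\<eta> \<longlonglongrightarrow> (\<Sum>k<n. norm (g k - g k))"
    unfolding \<eta>_def using h(2) by (intro tendsto_intros) auto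
  have "(\<lambda>i. C ^ 6 * (1 + \<eta> i)\<^sup>2 + C ^ 4 * (\<Sum>k<n. \<tau> k * (norm (h k i))\<^sup>2))
      \<longlonglongrightarrow> C ^ 6 * (1 + (\<Sum>k<n. norm (g k - g k)))\<^sup>2 + C ^ 4 * (\<Sum>k<n. \<tau> k * (norm (g k))\<^sup>2)"
    using h(2) by (intro tendsto_intros \<eta>) auto
  moreover have "(\<Sum>k<n. \<tau> k * (norm (g k))\<^sup>2) = (\<Sum>k<n. \<tau> k)"
    using orthonormal_norm[OF on] by (intro sum.cong) auto
  ultimately have lim: "(\<lambda>i. C ^ 6 * (1 + \<eta> i)\<^sup>2 + C ^ 4 * (\<Sum>k<n. \<tau> k * (norm (h k i))\<^sup>2))
      \<longlonglongrightarrow> C ^ 6 + C ^ 4 * (\<Sum>k<n. \<tau> k)" by simp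
  have "(\<lambda>i. A (h k i)) \<longlonglongrightarrow> A (g k)" if "k < n" for k
    by (rule bounded_clinear_tendsto[OF subspace_D lin, where M = 1])
      (use contraction hD gD h(2) that in auto)
  then have "(\<lambda>i. \<Sum>k<n. (norm (A (h k i)))\<^sup>2) \<longlonglongrightarrow> (\<Sum>k<n. (norm (A (g k)))\<^sup>2)"
    by (intro tendsto_intros) auto
  then show ?thesis by (rule LIMSEQ_le[OF _ lim]) (use le in auto)
qed

end

section \<open>Matching the weights of two bases\<close>

text \<open>An initial segment of the natural numbers is determined by its cardinality, being
  everything if it is infinite. This will identify the sets of ranks of two bases.\<close>

lemma initial_segment_eq:
  fixes S T :: "nat set"
  assumes S: "\<And>k k'. k \<in> S \<Longrightarrow> k' < k \<Longrightarrow> k' \<in> S" and T: "\<And>k k'. k \<in> T \<Longrightarrow> k' < k \<Longrightarrow> k' \<in> T"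
    and fin: "finite S \<longleftrightarrow> finite T" "card S = card T"
  shows "S = T"
proof -
  have *: "S = (if finite S then {..<card S} else UNIV)"
    if S: "\<And>k k'. k \<in> S \<Longrightarrow> k' < k \<Longrightarrow> k' \<in> S" for S :: "nat set"
  proof (cases "finite S")
    case True
    have "S \<subseteq> {..<card S}"
    proof
      fix x assume "x \<in> S"
      then have "{..x} \<subseteq> S" using S by (auto simp: le_less)
      then have "card {..x} \<le> card S" using True by (intro card_mono)
      then show "x \<in> {..<card S}" by simp
    qed
    then show ?thesis using True card_subset_eq[of "{..<card S}" S] by simp
  next
    case False
    have "k \<in> S" for k
      using False S unfolding infinite_nat_iff_unbounded by blast
    then show ?thesis using False by auto
  qed
  have "S = (if finite S then {..<card S} else UNIV)" by (rule *) (rule S)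
  also have "\<dots> = (if finite T then {..<card T} else UNIV)" using fin by simp
  also have "\<dots> = T" by (rule sym, rule *) (rule T)
  finally show ?thesis .
qed

lemma sum_half_powers_from_le:
  "(\<Sum>l<N. if p \<le> l then (1 / 2) ^ l else 0) \<le> 2 * (1 / 2 :: real) ^ p"
proof -
  have "(\<Sum>l<N. if p \<le> l then (1 / 2) ^ l else 0) =
      (if p \<le> N then 2 * (1 / 2) ^ p - 2 * (1 / 2) ^ N else 0 :: real)"
    by (induction N) (auto simp: le_Suc_eq)
  then show ?thesis by simp
qed

context unconditional_basis
begin

text \<open>The predecessors of \<open>j\<close> in the order of decreasing weight. Breaking ties by
  the index makes the order strict and total, so that \<open>rank\<close> is injective.\<close>

definition before :: "nat \<Rightarrow> nat set" where
  "before j = {j' \<in> J. weight j' > weight j \<or> weight j' = weight j \<and> j' < j}"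

definition rank :: "nat \<Rightarrow> nat" where
  "rank j = card (before j)"

lemma finite_before: "finite (before j)"
proof (rule finite_subset)
  show "before j \<subseteq> {j' \<in> J. weight j' > weight j / 2}"
    using weight_pos[of j] by (auto simp: before_def)
  show "finite {j' \<in> J. weight j' > weight j / 2}"
    using weight_pos[of j] by (intro finite_large_weight) simp
qed

lemma rank_less:
  assumes "j' \<in> before j" "j \<in> J"
  shows "rank j' < rank j"
  unfolding rank_def
proof (rule psubset_card_mono[OF finite_before])
  show "before j' \<subset> before j"
    using assms by (auto simp: before_def)
qed

lemma inj_on_rank: "inj_on rank J"
proof (rule inj_onI, rule ccontr)
  fix i j assume ij: "i \<in> J" "j \<in> J" "rank i = rank j" "i \<noteq> j"
  then have "i \<in> before j \<or> j \<in> before i" by (auto simp: before_def)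
  then show False using rank_less ij by fastforce
qed

lemma rank_image_before: "j \<in> J \<Longrightarrow> rank ` before j = {..<rank j}"
proof (rule card_subset_eq)
  assume j: "j \<in> J"
  show "rank ` before j \<subseteq> {..<rank j}" using rank_less j by auto
  have "inj_on rank (before j)" by (rule inj_on_subset[OF inj_on_rank]) (auto simp: before_def)
  from card_image[OF this] show "card (rank ` before j) = card {..<rank j}"
    by (simp add: rank_def[of j])
qed simp

lemma rank_initial_segment:
  assumes "k \<in> rank ` J" "k' < k"
  shows "k' \<in> rank ` J"
proof -
  obtain j where j: "j \<in> J" "k = rank j" using assms by blast
  then have "k' \<in> rank ` before j" using rank_image_before assms by auto
  then show ?thesis by (auto simp: before_def)
qed

end

section \<open>Comparison of two bases of the same space\<close>

locale two_unconditional_bases =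
  f: unconditional_basis D A C J f + e: unconditional_basis D A C I e
  for D A C J f I e
begin

text \<open>The assumptions are symmetric, so every estimate is available in both
  directions.\<close>

lemma swap: "two_unconditional_bases D A C I e J f"
  by unfold_locales

text \<open>A count of unknowns: the coefficients over \<open>U\<close> have to satisfy
  \<open>card V\<close> equations that remove the coordinates along \<open>e\<close> in
  \<open>V\<close>, and \<open>m\<close> equations for orthogonality to the \<open>h p\<close>. The
  lower Riesz bound keeps the resulting combination nonzero, so it can be normalized.\<close>

lemma exists_orthogonal_vector:
  assumes U: "finite U" "U \<subseteq> J" and V: "finite V" "V \<subseteq> I" and card: "card V + m < card U"
  shows "\<exists>g. norm g = 1 \<and> (\<exists>\<alpha>. g = (\<Sum>j\<in>U. \<alpha> j *\<^sub>C f j)) \<and> g \<in> closed_cspan (e ` (I - V)) \<and>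
    (\<forall>p<m. cinner g (h p) = 0)"
proof -
  have "\<exists>c. f j - (\<Sum>i\<in>V. c i *\<^sub>C e i) \<in> closed_cspan (e ` (I - V))" if "j \<in> U" for j
    using e.decompose[OF V f.f_D] that U by blast
  then obtain c where c: "\<And>j. j \<in> U \<Longrightarrow> f j - (\<Sum>i\<in>V. c j i *\<^sub>C e i) \<in> closed_cspan (e ` (I - V))"
    by metis
  define L where "L = (\<lambda>x j. case x of Inl i \<Rightarrow> c j i | Inr p \<Rightarrow> cinner (f j) (h p))"
  have "card (V <+> {..<m}) < card U" using card V by (simp add: card_Plus)
  then obtain \<alpha> where \<alpha>: "\<exists>j\<in>U. \<alpha> j \<noteq> 0" "\<forall>x\<in>V <+> {..<m}. (\<Sum>j\<in>U. \<alpha> j * L x j) = 0"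
    using homogeneous_system_solution[of "V <+> {..<m}" U L] U V by auto
  have \<alpha>1: "(\<Sum>j\<in>U. \<alpha> j * c j i) = 0" if "i \<in> V" for i
    using \<alpha>(2)[rule_format, OF InlI[OF that]] by (simp add: L_def)
  have \<alpha>2: "(\<Sum>j\<in>U. \<alpha> j * cinner (f j) (h p)) = 0" if "p < m" for p
    using \<alpha>(2)[rule_format, of "Inr p"] that by (simp add: L_def InrI)
  define g where "g = (\<Sum>j\<in>U. \<alpha> j *\<^sub>C f j)"
  obtain j0 where j0: "j0 \<in> U" "\<alpha> j0 \<noteq> 0" using \<alpha>(1) by blast
  have "0 < (cmod (\<alpha> j0))\<^sup>2" using j0 by simp
  also have "\<dots> \<le> (\<Sum>j\<in>U. (cmod (\<alpha> j))\<^sup>2)"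
    by (rule member_le_sum) (use j0 U in auto)
  also have "\<dots> \<le> C\<^sup>2 * (norm g)\<^sup>2" unfolding g_def by (rule f.riesz_lower[OF U])
  finally have g0: "g \<noteq> 0" by auto
  \<comment> \<open>The parts over \<open>V\<close> cancel, so \<open>g\<close> is a combination of
    the remainders alone, and these lie in the closed span over \<open>I - V\<close>.\<close>
  have "(\<Sum>j\<in>U. \<alpha> j *\<^sub>C (\<Sum>i\<in>V. c j i *\<^sub>C e i)) = (\<Sum>i\<in>V. (\<Sum>j\<in>U. \<alpha> j * c j i) *\<^sub>C e i)"
    using sum_scaleC_swap[of \<alpha> "\<lambda>i j. c j i" e V U] by simp
  also have "\<dots> = 0" using \<alpha>1 by simp
  finally have "g = (\<Sum>j\<in>U. \<alpha> j *\<^sub>C (f j - (\<Sum>i\<in>V. c j i *\<^sub>C e i)))"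
    by (simp add: g_def cvec.scale_right_diff_distrib sum_subtractf)
  also have "\<dots> \<in> closed_cspan (e ` (I - V))"
    using c by (intro cvec.subspace_sum cvec.subspace_scale subspace_closed_cspan) auto
  finally have gV: "g \<in> closed_cspan (e ` (I - V))" .
  define s where "s = complex_of_real (1 / norm g)"
  show ?thesis
  proof (intro exI[of _ "s *\<^sub>C g"] conjI allI impI)
    show "norm (s *\<^sub>C g) = 1" using g0 by (simp add: s_def norm_scaleC norm_divide)
    show "\<exists>\<alpha>. s *\<^sub>C g = (\<Sum>j\<in>U. \<alpha> j *\<^sub>C f j)"
      by (rule exI[of _ "\<lambda>j. s * \<alpha> j"]) (simp add: g_def cvec.scale_sum_right scaleC_scaleC)
    show "s *\<^sub>C g \<in> closed_cspan (e ` (I - V))"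
      by (intro cvec.subspace_scale subspace_closed_cspan gV)
    show "cinner (s *\<^sub>C g) (h p) = 0" if "p < m" for p
      using \<alpha>2[OF that] by (simp add: g_def cinner_scaleC_left cinner_sum_left)
  qed
qed

text \<open>With V = I and m = 0, a larger \<open>J\<close> would put a unit vector into the closed
  span of the empty set.\<close>

lemma finite_index_card:
  assumes "finite I"
  shows "finite J \<and> card J \<le> card I"
proof (rule ccontr)
  assume "\<not> (finite J \<and> card J \<le> card I)"
  then have "\<exists>U. finite U \<and> U \<subseteq> J \<and> card U = Suc (card I)"
  proof (cases "finite J")
    case True
    then show ?thesis
      using \<open>\<not> (finite J \<and> card J \<le> card I)\<close> obtain_subset_with_card_n[of "Suc (card I)" J]
      by (metis not_less_eq_eq)
  next
    case False
    then show ?thesis using infinite_arbitrarily_large[OF False, of "Suc (card I)"] by blast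
  qed
  then obtain U where U: "finite U" "U \<subseteq> J" "card U = Suc (card I)" by blast
  have "card I + 0 < card U" using U(3) by simp
  from exists_orthogonal_vector[OF U(1,2) assms order_refl this]
  obtain g where "norm g = 1" "g \<in> closed_cspan (e ` (I - I))" by blast
  then show False by (simp add: closed_cspan_def)
qed

text \<open>Both sets of ranks are initial segments of equal cardinality; this is what allows
  indices of equal rank to be paired.\<close>

lemma rank_images_eq: "f.rank ` J = e.rank ` I"
proof (rule initial_segment_eq)
  show "k' \<in> f.rank ` J" if "k \<in> f.rank ` J" "k' < k" for k k'
    using f.rank_initial_segment that by blast
  show "k' \<in> e.rank ` I" if "k \<in> e.rank ` I" "k' < k" for k k'
    using e.rank_initial_segment that by blast
  interpret sw: two_unconditional_bases D A C I e J f by (rule swap)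
  have fin: "finite J \<longleftrightarrow> finite I" using finite_index_card sw.finite_index_card by blast
  then show "finite (f.rank ` J) \<longleftrightarrow> finite (e.rank ` I)"
    by (simp add: finite_image_iff[OF f.inj_on_rank] finite_image_iff[OF e.inj_on_rank])
  have "card J = card I"
    using fin finite_index_card sw.finite_index_card by (cases "finite I") (auto intro: antisym)
  then show "card (f.rank ` J) = card (e.rank ` I)"
    by (simp add: card_image f.inj_on_rank e.inj_on_rank)
qed

text \<open>With T the sum of the thresholds in \<open>packing\<close>, the two estimates there
  combine to K T \<le> 3 C^10 + C^10 T. The factor 4 turns this into T \<le> 1.\<close>

definition K :: real where "K = 4 * C ^ 10"

lemma K_ge_4: "K \<ge> 4"
  using f.C_power_ge_1[of 10] by (simp add: K_def)

text \<open>The vector \<open>g k\<close> involves only weights of \<open>f\<close> that are at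
  least \<open>K * \<tau> k\<close> and only weights of \<open>e\<close> that are at most
  \<open>\<tau> k\<close>. The former bounds the sum of the squares of \<open>norm (A (g k))\<close>
  from below, the latter from above.\<close>

lemma packing:
  fixes n :: nat
  assumes on: "orthonormal {..<n} g" and F: "finite F" "F \<subseteq> J"
    and g: "\<And>k. k < n \<Longrightarrow> g k = (\<Sum>j\<in>F. c k j *\<^sub>C f j)"
    and \<kappa>: "\<And>k j. k < n \<Longrightarrow> j \<in> F \<Longrightarrow> c k j \<noteq> 0 \<Longrightarrow> K * \<tau> k \<le> f.weight j"
    and \<tau>0: "\<And>k. k < n \<Longrightarrow> \<tau> k \<ge> 0"
    and ge: "\<And>k. k < n \<Longrightarrow> g k \<in> closed_cspan (e ` {i \<in> I. e.weight i \<le> \<tau> k})"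
  shows "(\<Sum>k<n. \<tau> k) \<le> 1"
proof -
  define T where "T = (\<Sum>k<n. \<tau> k)"
  define S where "S = (\<Sum>k<n. (norm (A (g k)))\<^sup>2)"
  have "T \<ge> 0" using \<tau>0 by (auto simp: T_def intro: sum_nonneg)
  have "K * T \<le> 2 * C ^ 8 + C ^ 4 * S"
    using f.orthonormal_weights_le_image[where \<kappa> = "\<lambda>k. K * \<tau> k" and c = c, OF on F g \<kappa>]
    by (simp add: T_def S_def sum_distrib_left)
  moreover have "S \<le> C ^ 6 + C ^ 4 * T"
    using e.orthonormal_image_le_weights[OF on \<tau>0 ge] by (simp add: T_def S_def)
  then have "C ^ 4 * S \<le> C ^ 4 * (C ^ 6 + C ^ 4 * T)"
    using f.C_ge_1 by (intro mult_left_mono) auto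
  moreover have "C ^ 4 * (C ^ 6 + C ^ 4 * T) = C ^ 10 + C ^ 8 * T"
    by (simp add: algebra_simps power_add[symmetric])
  moreover have "2 * C ^ 8 \<le> 2 * C ^ 10" using f.C_power_mono[of 8 10] by simp
  moreover have "C ^ 8 * T \<le> C ^ 10 * T"
    using f.C_power_mono[of 8 10] \<open>T \<ge> 0\<close> by (intro mult_right_mono) auto
  ultimately have "C ^ 10 * T \<le> C ^ 10 * 1" by (simp add: K_def)
  moreover have "C ^ 10 > 0" using f.C_power_ge_1[of 10] by linarith
  ultimately show ?thesis using mult_le_cancel_left_pos T_def by blast
qed

definition U :: "nat \<Rightarrow> nat set" where "U l = {j \<in> J. f.weight j > K * (1 / 2) ^ l}"
definition V :: "nat \<Rightarrow> nat set" where "V l = {i \<in> I. e.weight i > (1 / 2) ^ l}"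
text \<open>Truncated subtraction makes this 0 where \<open>V l\<close> is at least as large as
  \<open>U l\<close>. Otherwise it is the number of orthonormal vectors that the dimension count
  yields at level \<open>l\<close>.\<close>

definition excess :: "nat \<Rightarrow> nat" where "excess l = card (U l) - card (V l)"

lemma U: "finite (U l)" "U l \<subseteq> J"
  using K_ge_4 by (auto simp: U_def intro!: f.finite_large_weight)

lemma V: "finite (V l)" "V l \<subseteq> I" "I - V l = {i \<in> I. e.weight i \<le> (1 / 2) ^ l}"
  by (auto simp: V_def intro!: e.finite_large_weight)

text \<open>An admissible unit vector at level \<open>l\<close> sees only large weights of \<open>f\<close> and only small weights of \<open>e\<close>,
  so \<open>packing\<close> limits how many of them can be orthonormal.\<close>

definition admissible :: "ell2 \<Rightarrow> nat \<Rightarrow> bool" where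
  "admissible g l \<longleftrightarrow> (\<exists>\<alpha>. g = (\<Sum>j\<in>U l. \<alpha> j *\<^sub>C f j)) \<and> g \<in> closed_cspan (e ` (I - V l))"

text \<open>Orthogonality to the \<open>n\<close> vectors already present costs \<open>n\<close>
  equations, so vectors of level \<open>l\<close> can be added as long as \<open>n\<close> is below
  \<open>excess l\<close>. Earlier vectors are kept, since all levels must share one orthonormal
  system.\<close>

lemma extend_admissible:
  fixes n :: nat
  assumes "orthonormal {..<n} g" "\<And>k. k < n \<Longrightarrow> admissible (g k) (lev k)"
  shows "\<exists>n' g' lev'. n \<le> n' \<and> excess l \<le> n' \<and> orthonormal {..<n'} g' \<and>
    (\<forall>k<n'. admissible (g' k) (lev' k)) \<and> (\<forall>k<n. lev' k = lev k) \<and> (\<forall>k. n \<le> k \<and> k < n' \<longrightarrow> lev' k = l)"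
  using assms
proof (induction "excess l - n" arbitrary: n g lev)
  case 0
  then show ?case by (intro exI[of _ n] exI[of _ g] exI[of _ lev]) auto
next
  case (Suc d)
  then have "card (V l) + n < card (U l)" by (simp add: excess_def)
  from exists_orthogonal_vector[OF U V(1,2) this, of g] obtain y where
    y: "norm y = 1" "admissible y l" "\<And>p. p < n \<Longrightarrow> cinner y (g p) = 0"
    unfolding admissible_def by blast
  define g1 lev1 where "g1 = g(n := y)" and "lev1 = lev(n := l)"
  have "orthonormal {..<Suc n} g1"
    unfolding orthonormal_def
  proof (intro ballI)
    fix i j assume "i \<in> {..<Suc n}" "j \<in> {..<Suc n}"
    then consider "i < n" "j < n" | "i = n" "j < n" | "i < n" "j = n" | "i = n" "j = n" by fastforce
    then show "cinner (g1 i) (g1 j) = (if i = j then 1 else 0)"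
    proof cases
      case 1
      then show ?thesis using Suc.prems(1) by (simp add: g1_def orthonormal_def)
    next
      case 3
      then show ?thesis using y(3)[of i] cinner_eq_zero_commute[of y] by (simp add: g1_def)
    qed (use y in \<open>auto simp: g1_def cinner_self_norm\<close>)
  qed
  moreover have "admissible (g1 k) (lev1 k)" if "k < Suc n" for k
    using that y(2) Suc.prems(2) by (auto simp: g1_def lev1_def less_Suc_eq)
  moreover have "d = excess l - Suc n" using Suc.hyps(2) by simp
  ultimately obtain n' g' lev' where
    n': "Suc n \<le> n'" "excess l \<le> n'" "orthonormal {..<n'} g'"
    "\<forall>k<n'. admissible (g' k) (lev' k)" "\<forall>k<Suc n. lev' k = lev1 k"
    "\<forall>k. Suc n \<le> k \<and> k < n' \<longrightarrow> lev' k = l"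
    using Suc.hyps(1)[of "Suc n" g1 lev1] by blast
  show ?case
  proof (intro exI conjI)
    show "\<forall>k<n. lev' k = lev k" using n'(5) by (simp add: lev1_def)
    show "\<forall>k. n \<le> k \<and> k < n' \<longrightarrow> lev' k = l"
      using n'(5,6) by (metis fun_upd_same lessI lev1_def not_less_eq_eq order_antisym)
    show "n \<le> n'" using n'(1) by simp
  qed (use n' in auto)
qed

text \<open>The count is over levels up to \<open>l\<close> instead of exactly \<open>l\<close>,
  because vectors chosen at earlier levels reduce the number that can be added at level
  \<open>l\<close>.\<close>

lemma admissible_family:
  "\<exists>(n::nat) g lev. orthonormal {..<n} g \<and> (\<forall>k<n. admissible (g k) (lev k)) \<and> (\<forall>k<n. lev k < N) \<and>
    (\<forall>l<N. excess l \<le> card {k. k < n \<and> lev k \<le> l})"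
proof (induction N)
  case 0
  show ?case by (rule exI[of _ 0]) (auto simp: orthonormal_def)
next
  case (Suc N)
  then obtain n :: nat and g lev where
    IH: "orthonormal {..<n} g" "\<And>k. k < n \<Longrightarrow> admissible (g k) (lev k)" "\<forall>k<n. lev k < N"
      "\<forall>l<N. excess l \<le> card {k. k < n \<and> lev k \<le> l}" by blast
  obtain n' g' lev' where
    n': "n \<le> n'" "excess N \<le> n'" "orthonormal {..<n'} g'"
    "\<forall>k<n'. admissible (g' k) (lev' k)" "\<forall>k<n. lev' k = lev k"
    "\<forall>k. n \<le> k \<and> k < n' \<longrightarrow> lev' k = N"
    using extend_admissible[OF IH(1,2), of N] by blast
  have lev': "lev' k \<le> N" if "k < n'" for k
    using that n'(5,6) IH(3) by (cases "k < n") (auto intro: less_imp_le)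
  have "excess l \<le> card {k. k < n' \<and> lev' k \<le> l}" if "l < Suc N" for l
  proof (cases "l = N")
    case True
    then have "{k. k < n' \<and> lev' k \<le> l} = {..<n'}" using lev' by auto
    then show ?thesis using n'(2) True by simp
  next
    case False
    then have "excess l \<le> card {k. k < n \<and> lev k \<le> l}" using IH(4) that by simp
    also have "\<dots> \<le> card {k. k < n' \<and> lev' k \<le> l}"
      using n'(1,5) by (intro card_mono) auto
    finally show ?thesis .
  qed
  then show ?case using n'(3,4) lev'
    by (intro exI[of _ n'] exI[of _ g'] exI[of _ lev']) (auto simp: less_Suc_eq_le)
qed

text \<open>A vector of level p is counted at every l \<ge> p, and the geometric series bounds its
  total contribution by 2 (1/2)^p. By \<open>packing\<close> the sum of (1/2)^p over the system is
  at most 1, which gives a bound independent of \<open>N\<close>.\<close>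

lemma weighted_excess_le: "(\<Sum>l<N. (1 / 2) ^ l * real (excess l)) \<le> 2"
proof -
  obtain n :: nat and g lev where
    on: "orthonormal {..<n} g" and adm: "\<And>k. k < n \<Longrightarrow> admissible (g k) (lev k)"
    and lev: "\<And>k. k < n \<Longrightarrow> lev k < N" and ex: "\<And>l. l < N \<Longrightarrow> excess l \<le> card {k. k < n \<and> lev k \<le> l}"
    using admissible_family[of N] by blast
  have "\<exists>\<alpha>. k < n \<longrightarrow> g k = (\<Sum>j\<in>U (lev k). \<alpha> j *\<^sub>C f j)" for k
    using adm unfolding admissible_def by blast
  then obtain \<alpha> where \<alpha>: "\<And>k. k < n \<Longrightarrow> g k = (\<Sum>j\<in>U (lev k). \<alpha> k j *\<^sub>C f j)" by metis
  define F where "F = (\<Union>l<N. U l)"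
  have F: "finite F" "F \<subseteq> J" using U by (auto simp: F_def)
  \<comment> \<open>Vectors of different levels have coefficients on different sets
    \<open>U l\<close>; extension by zero places all of them on the common set
    \<open>F\<close>.\<close>
  define c where "c = (\<lambda>k j. if j \<in> U (lev k) then \<alpha> k j else 0)"
  have "(\<Sum>k<n. (1 / 2 :: real) ^ lev k) \<le> 1"
  proof (rule packing[OF on F, where c = c])
    show "g k = (\<Sum>j\<in>F. c k j *\<^sub>C f j)" if "k < n" for k
    proof -
      have "U (lev k) \<subseteq> F" using lev[OF that] by (auto simp: F_def)
      then have "(\<Sum>j\<in>F. c k j *\<^sub>C f j) = (\<Sum>j\<in>U (lev k). c k j *\<^sub>C f j)"
        using F by (intro sum.mono_neutral_right) (auto simp: c_def)
      then show ?thesis using \<alpha>[OF that] by (simp add: c_def)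
    qed
    show "K * (1 / 2) ^ lev k \<le> f.weight j" if "c k j \<noteq> 0" for k j
      using that by (auto simp: c_def U_def split: if_splits)
    show "g k \<in> closed_cspan (e ` {i \<in> I. e.weight i \<le> (1 / 2) ^ lev k})" if "k < n" for k
      using adm[OF that] by (simp add: admissible_def V)
  qed auto
  have "(\<Sum>l<N. (1 / 2) ^ l * real (excess l)) \<le> (\<Sum>l<N. (1 / 2) ^ l * real (card {k. k < n \<and> lev k \<le> l}))"
    using ex by (intro sum_mono mult_left_mono) auto
  also have "\<dots> = (\<Sum>l<N. \<Sum>k<n. if lev k \<le> l then (1 / 2) ^ l else 0)"
  proof (intro sum.cong refl)
    fix l
    have "(\<Sum>k<n. if lev k \<le> l then (1 / 2) ^ l else 0) = (\<Sum>k\<in>{k \<in> {..<n}. lev k \<le> l}. (1 / 2 :: real) ^ l)"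
      by (rule sum.inter_filter[symmetric]) simp
    then show "(1 / 2) ^ l * real (card {k. k < n \<and> lev k \<le> l}) = (\<Sum>k<n. if lev k \<le> l then (1 / 2) ^ l else 0)"
      by (simp add: mult.commute)
  qed
  also have "\<dots> = (\<Sum>k<n. \<Sum>l<N. if lev k \<le> l then (1 / 2) ^ l else 0)" by (rule sum.swap)
  also have "\<dots> \<le> (\<Sum>k<n. 2 * (1 / 2) ^ lev k)" by (intro sum_mono sum_half_powers_from_le)
  also have "\<dots> \<le> 2" using \<open>(\<Sum>k<n. (1 / 2 :: real) ^ lev k) \<le> 1\<close> by (simp add: sum_distrib_left[symmetric])
  finally show ?thesis .
qed

text \<open>Suppose \<open>f.weight j\<close> lies in the dyadic band of level l and the partner of
  \<open>j\<close> is much lighter. Then the rank of \<open>j\<close> is below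
  \<open>card (U l)\<close>, while that of the partner, which is the same number, is at least
  \<open>card (V l)\<close>. Ranks are distinct, so a level contains at most \<open>excess l\<close>
  such indices.\<close>

lemma unmatched_weights_le:
  assumes F: "finite F" "F \<subseteq> J"
    and \<pi>: "\<And>j. j \<in> F \<Longrightarrow> \<pi> j \<in> I" "\<And>j. j \<in> F \<Longrightarrow> e.rank (\<pi> j) = f.rank j"
    and bad: "\<And>j. j \<in> F \<Longrightarrow> f.weight j > 2 * K * e.weight (\<pi> j)"
  shows "(\<Sum>j\<in>F. f.weight j) \<le> 4 * K"
proof -
  have "\<exists>l. K * (1 / 2) ^ l < f.weight j \<and> f.weight j \<le> 2 * K * (1 / 2) ^ l" if j: "j \<in> F" for j
  proof -
    have "(\<lambda>l. K * (1 / 2) ^ l) \<longlonglongrightarrow> K * 0"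
      by (intro tendsto_mult_left LIMSEQ_power_zero) simp
    then have "\<forall>\<^sub>F l in sequentially. K * (1 / 2) ^ l < f.weight j"
      using order_tendstoD(2)[of _ "K * 0"] f.weight_pos[of j] by simp
    then have ex: "\<exists>l. K * (1 / 2) ^ l < f.weight j" by (auto simp: eventually_sequentially)
    \<comment> \<open>Minimality gives the upper bound, twice the threshold, from the preceding
      level. A preceding level exists because weights are at most 2 and K is at least 4.\<close>
    define l where "l = (LEAST l. K * (1 / 2) ^ l < f.weight j)"
    have l: "K * (1 / 2) ^ l < f.weight j" unfolding l_def using ex by (rule LeastI_ex)
    have "l \<noteq> 0"
    proof
      assume "l = 0"
      then have "K < f.weight j" using l by simp
      moreover have "f.weight j \<le> 2" using f.weight_le_2 j F by blast
      ultimately show False using K_ge_4 by linarith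
    qed
    then obtain l' where l': "l = Suc l'" using not0_implies_Suc by blast
    then have "\<not> K * (1 / 2) ^ l' < f.weight j" 
      using not_less_Least[of l' "\<lambda>l. K * (1 / 2) ^ l < f.weight j"] l_def by simp
    then show ?thesis using l by (intro exI[of _ l]) (simp add: l')
  qed
  then obtain lv where lv: "\<And>j. j \<in> F \<Longrightarrow> K * (1 / 2) ^ lv j < f.weight j"
    "\<And>j. j \<in> F \<Longrightarrow> f.weight j \<le> 2 * K * (1 / 2) ^ lv j" by metis
  have count: "card {j \<in> F. lv j = l} \<le> excess l" for l
  proof -
    have "f.rank ` {j \<in> F. lv j = l} \<subseteq> {card (V l)..<card (U l)}"
    proof clarify
      fix j assume j: "j \<in> F" "l = lv j"
      have jJ: "j \<in> J" using j F by blast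
      have "insert j (f.before j) \<subseteq> U (lv j)"
        using lv(1)[OF j(1)] jJ by (auto simp: U_def f.before_def)
      then have "card (insert j (f.before j)) \<le> card (U (lv j))" by (intro card_mono U)
      moreover have "j \<notin> f.before j" by (simp add: f.before_def)
      ultimately have 1: "f.rank j < card (U (lv j))"
        by (simp add: f.rank_def f.finite_before)
      have "2 * K * e.weight (\<pi> j) < 2 * K * (1 / 2) ^ lv j"
        using bad[OF j(1)] lv(2)[OF j(1)] by linarith
      then have "e.weight (\<pi> j) < (1 / 2) ^ lv j" using K_ge_4 by simp
      then have "V (lv j) \<subseteq> e.before (\<pi> j)" by (auto simp: V_def e.before_def)
      then have "card (V (lv j)) \<le> e.rank (\<pi> j)"
        unfolding e.rank_def by (intro card_mono e.finite_before)
      then show "f.rank j \<in> {card (V (lv j))..<card (U (lv j))}" using 1 \<pi>(2)[OF j(1)] by simp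
    qed
    then have "card (f.rank ` {j \<in> F. lv j = l}) \<le> card {card (V l)..<card (U l)}"
      by (intro card_mono) auto
    then have "card (f.rank ` {j \<in> F. lv j = l}) \<le> excess l" by (simp add: excess_def)
    moreover have "inj_on f.rank {j \<in> F. lv j = l}"
      by (rule inj_on_subset[OF f.inj_on_rank]) (use F in auto)
    ultimately show ?thesis by (simp add: card_image)
  qed
  obtain N where N: "\<And>j. j \<in> F \<Longrightarrow> lv j < N"
    using finite_nat_set_iff_bounded[of "lv ` F"] F by auto
  have "(\<Sum>j\<in>F. f.weight j) = (\<Sum>l<N. \<Sum>j | j \<in> F \<and> lv j = l. f.weight j)"
    by (rule sum.group[symmetric]) (use F N in auto)
  also have "\<dots> \<le> (\<Sum>l<N. \<Sum>j | j \<in> F \<and> lv j = l. 2 * K * (1 / 2) ^ l)"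
    using lv(2) by (intro sum_mono) auto
  also have "\<dots> = (\<Sum>l<N. 2 * K * ((1 / 2) ^ l * real (card {j \<in> F. lv j = l})))"
    by (simp add: algebra_simps)
  also have "\<dots> \<le> (\<Sum>l<N. 2 * K * ((1 / 2) ^ l * real (excess l)))"
    using count K_ge_4 by (intro sum_mono mult_left_mono) auto
  also have "\<dots> = 2 * K * (\<Sum>l<N. (1 / 2) ^ l * real (excess l))" by (simp add: sum_distrib_left)
  also have "\<dots> \<le> 2 * K * 2" using weighted_excess_le K_ge_4 by (intro mult_left_mono) auto
  finally show ?thesis by simp
qed

end

section \<open>Equivalence of bases\<close>

lemma tensor_sum_reindex:
  assumes "inj_on \<pi> F"
  shows "tensor_sum F a (\<lambda>j. x (\<pi> j)) = tensor_sum (\<pi> ` F) (\<lambda>i. a (inv_into F \<pi> i)) x"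
  unfolding tensor_sum_def using assms by (intro ext) (simp add: sum.reindex)

lemma cu_basic_sequence_reindex:
  assumes x: "cu_basic_sequence C I x" and \<pi>: "bij_betw \<pi> J I"
  shows "cu_basic_sequence C J (\<lambda>j. x (\<pi> j))"
  unfolding cu_basic_sequence_def
proof (intro conjI allI impI)
  show "1 \<le> C" using x by (simp add: cu_basic_sequence_def)
  fix n F a t assume F: "finite F" "F \<subseteq> J" "\<forall>j\<in>F. cmod (t j) \<le> 1"
  show "rc_norm n (tensor_sum F (\<lambda>j k l. t j * a j k l) (\<lambda>j. x (\<pi> j)))
      \<le> C * rc_norm n (tensor_sum F a (\<lambda>j. x (\<pi> j)))"
  proof -
    have inj: "inj_on \<pi> F" using \<pi> F by (auto simp: bij_betw_def intro: inj_on_subset)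
    have "\<pi> ` F \<subseteq> I" using \<pi> F by (auto simp: bij_betw_def)
    moreover have "\<forall>i\<in>\<pi> ` F. cmod (t (inv_into F \<pi> i)) \<le> 1" using F inj by simp
    ultimately have "rc_norm n (tensor_sum (\<pi> ` F) (\<lambda>i k l. t (inv_into F \<pi> i) * a (inv_into F \<pi> i) k l) x)
        \<le> C * rc_norm n (tensor_sum (\<pi> ` F) (\<lambda>i. a (inv_into F \<pi> i)) x)"
      using x F(1) unfolding cu_basic_sequence_def by (simp add: subset_iff)
    then show ?thesis unfolding tensor_sum_reindex[OF inj] .
  qed
qed

lemma cu_basic_sequence_mono:
  assumes "cu_basic_sequence c I x" "c \<le> C"
  shows "cu_basic_sequence C I x"
  unfolding cu_basic_sequence_def
proof (intro conjI allI impI)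
  show "1 \<le> C" using assms by (simp add: cu_basic_sequence_def)
  fix n F a t assume F: "finite F" "F \<subseteq> I" "\<forall>i\<in>F. cmod (t i) \<le> 1"
  have "rc_norm n (tensor_sum F (\<lambda>i k l. t i * a i k l) x) \<le> c * rc_norm n (tensor_sum F a x)"
    using assms(1) F unfolding cu_basic_sequence_def by simp
  also have "\<dots> \<le> C * rc_norm n (tensor_sum F a x)"
    by (rule mult_right_mono[OF assms(2) rc_norm_nonneg])
  finally show "rc_norm n (tensor_sum F (\<lambda>i k l. t i * a i k l) x) \<le> C * rc_norm n (tensor_sum F a x)" .
qed

context two_unconditional_bases
begin

text \<open>Away from the set \<open>B\<close> of badly matched indices, the weights of
  \<open>e\<close> are at most \<open>2 * K\<close> times those of \<open>f\<close>. On
  \<open>B\<close> they sum to at most \<open>4 * K\<close>, and there every column of coefficients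
  has squared length at most \<open>R\<close>. The row part of the norm needs only the Riesz bounds.
  The factor 41 that arises is rounded up to the square number 49.\<close>

lemma tensor_norm_le:
  assumes \<pi>: "bij_betw \<pi> J I" and rank: "\<And>j. j \<in> J \<Longrightarrow> f.rank j = e.rank (\<pi> j)"
    and F: "finite F" "F \<subseteq> J"
  shows "rc_norm n (tensor_sum F a (\<lambda>j. (e (\<pi> j), A (e (\<pi> j)))))
    \<le> 7 * C ^ 9 * rc_norm n (tensor_sum F a (\<lambda>j. (f j, A (f j))))"
proof -
  define x y where "x = (\<lambda>j. (f j, A (f j)))" and "y = (\<lambda>j. (e (\<pi> j), A (e (\<pi> j))))"
  have \<pi>I: "\<pi> j \<in> I" if "j \<in> J" for j using \<pi> that by (auto simp: bij_betw_def)
  interpret ep: unconditional_basis D A C J "\<lambda>j. e (\<pi> j)"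
  proof
    have "(\<lambda>j. e (\<pi> j)) ` J = e ` I" 
      using bij_betw_imp_surj_on[OF \<pi>] by (metis image_image)
    then show "closed_cspan ((\<lambda>j. e (\<pi> j)) ` J) = D" using e.span_f by simp
    show "cu_basic_sequence C J (\<lambda>j. (e (\<pi> j), A (e (\<pi> j))))"
      using cu_basic_sequence_reindex[OF e.cu \<pi>] .
  qed (use \<pi>I f.D f.A e.f_D e.norm_f in auto)
  define M where "M = rc_norm n (tensor_sum F a x)"
  have M0: "M \<ge> 0" by (simp add: M_def rc_norm_nonneg)
  have C0: "C \<ge> 0" using f.C_ge_1 by simp
  note sum_swap = sum_scaleC_swap[where N = "{..<n}"]
  have x: "(\<Sum>m<n. (norm (\<Sum>k<n. v k *\<^sub>C fst (tensor_sum F a x k m)))\<^sup>2) \<le> M\<^sup>2 * (\<Sum>k<n. (cmod (v k))\<^sup>2)"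
    "(\<Sum>m<n. (norm (\<Sum>k<n. v k *\<^sub>C snd (tensor_sum F a x m k)))\<^sup>2) \<le> M\<^sup>2 * (\<Sum>k<n. (cmod (v k))\<^sup>2)" for v
    unfolding M_def by (rule rc_norm_row_bound rc_norm_column_bound)+
  note [simp] = x_def y_def
  \<comment> \<open>The row norm of the coefficients up to the Riesz constant. It serves the row
    part of the claim and also yields the bound \<open>R\<close> in the column part.\<close>
  have row: "(\<Sum>m<n. \<Sum>j\<in>F. (cmod (\<Sum>k<n. v k * a j k m))\<^sup>2) \<le> C\<^sup>2 * (M\<^sup>2 * (\<Sum>k<n. (cmod (v k))\<^sup>2))" for v
  proof -
    have "(\<Sum>m<n. \<Sum>j\<in>F. (cmod (\<Sum>k<n. v k * a j k m))\<^sup>2)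
        \<le> (\<Sum>m<n. C\<^sup>2 * (norm (\<Sum>j\<in>F. (\<Sum>k<n. v k * a j k m) *\<^sub>C f j))\<^sup>2)"
      by (intro sum_mono f.riesz_lower F)
    also have "\<dots> = C\<^sup>2 * (\<Sum>m<n. (norm (\<Sum>k<n. v k *\<^sub>C fst (tensor_sum F a x k m)))\<^sup>2)"
      by (simp add: fst_tensor_sum sum_swap sum_distrib_left)
    also have "\<dots> \<le> C\<^sup>2 * (M\<^sup>2 * (\<Sum>k<n. (cmod (v k))\<^sup>2))"
      using x(1) by (intro mult_left_mono) auto
    finally show ?thesis .
  qed
  have "rc_norm n (tensor_sum F a y) \<le> 7 * C ^ 9 * M"
  proof (subst rc_norm_le_iff_squares, simp add: M0 C0, intro conjI allI)
    fix v :: "nat \<Rightarrow> complex"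
    define Q where "Q = M\<^sup>2 * (\<Sum>k<n. (cmod (v k))\<^sup>2)"
    have Q0: "Q \<ge> 0" by (simp add: Q_def sum_nonneg)
    have "(\<Sum>m<n. (norm (\<Sum>k<n. v k *\<^sub>C fst (tensor_sum F a y k m)))\<^sup>2)
        = (\<Sum>m<n. (norm (\<Sum>j\<in>F. (\<Sum>k<n. v k * a j k m) *\<^sub>C e (\<pi> j)))\<^sup>2)"
      by (simp add: fst_tensor_sum sum_swap)
    also have "\<dots> \<le> (\<Sum>m<n. C\<^sup>2 * (\<Sum>j\<in>F. (cmod (\<Sum>k<n. v k * a j k m))\<^sup>2))"
      by (intro sum_mono ep.riesz_upper F)
    also have "\<dots> = C\<^sup>2 * (\<Sum>m<n. \<Sum>j\<in>F. (cmod (\<Sum>k<n. v k * a j k m))\<^sup>2)"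
      by (simp add: sum_distrib_left)
    also have "\<dots> \<le> C\<^sup>2 * (C\<^sup>2 * Q)" using row[of v] by (intro mult_left_mono) (auto simp: Q_def)
    also have "\<dots> = C ^ 4 * Q" by (simp add: power2_eq_square power4_eq_xxxx)
    also have "\<dots> \<le> 49 * C ^ 18 * Q"
      using f.C_power_mono[of 4 18] f.C_power_ge_1[of 18] Q0 by (intro mult_right_mono) auto
    also have "\<dots> = (7 * C ^ 9 * M)\<^sup>2 * (\<Sum>k<n. (cmod (v k))\<^sup>2)"
      by (simp add: Q_def power_mult_distrib power_mult[symmetric])
    finally show "(\<Sum>m<n. (norm (\<Sum>k<n. v k *\<^sub>C fst (tensor_sum F a y k m)))\<^sup>2)
        \<le> (7 * C ^ 9 * M)\<^sup>2 * (\<Sum>k<n. (cmod (v k))\<^sup>2)" .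
  next
    fix v :: "nat \<Rightarrow> complex"
    define Q where "Q = M\<^sup>2 * (\<Sum>k<n. (cmod (v k))\<^sup>2)"
    have Q0: "Q \<ge> 0" by (simp add: Q_def sum_nonneg)
    \<comment> \<open>Applying the column operator to \<open>v\<close> condenses a general matrix
      into a single column of coefficients, so the one-column estimates apply.\<close>
    define c where "c = (\<lambda>m j. \<Sum>k<n. v k * a j m k)"
    define R where "R = C\<^sup>2 * Q"
    have R0: "R \<ge> 0" using Q0 by (simp add: R_def)
    \<comment> \<open>Cauchy-Schwarz in \<open>k\<close> separates \<open>v\<close> from the row
      estimate for \<open>a\<close>, which is then tested at \<open>w\<close>.\<close>
    have rb: "row_bounded R n F c"
      unfolding row_bounded_def
    proof
      fix w :: "nat \<Rightarrow> complex"
      have "(\<Sum>m<n. w m * c m j) = (\<Sum>k<n. v k * (\<Sum>m<n. w m * a j m k))" for j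
        unfolding c_def sum_distrib_left by (subst sum.swap) (simp add: mult.left_commute)
      then have "(\<Sum>j\<in>F. (cmod (\<Sum>m<n. w m * c m j))\<^sup>2)
          \<le> (\<Sum>j\<in>F. (\<Sum>k<n. (cmod (v k))\<^sup>2) * (\<Sum>k<n. (cmod (\<Sum>m<n. w m * a j m k))\<^sup>2))"
        by (simp only:) (intro sum_mono cmod_sum_mult_sq_le)
      also have "\<dots> = (\<Sum>k<n. (cmod (v k))\<^sup>2) * (\<Sum>k<n. \<Sum>j\<in>F. (cmod (\<Sum>m<n. w m * a j m k))\<^sup>2)"
        unfolding sum_distrib_left[symmetric] by (subst sum.swap) (rule refl)
      also have "\<dots> \<le> (\<Sum>k<n. (cmod (v k))\<^sup>2) * (C\<^sup>2 * (M\<^sup>2 * (\<Sum>k<n. (cmod (w k))\<^sup>2)))"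
        by (intro mult_left_mono row sum_nonneg) auto
      finally show "(\<Sum>j\<in>F. (cmod (\<Sum>m<n. w m * c m j))\<^sup>2) \<le> R * (\<Sum>m<n. (cmod (w m))\<^sup>2)"
        by (simp add: R_def Q_def mult_ac)
    qed
    define W where "W = (\<Sum>m<n. \<Sum>j\<in>F. f.weight j * (cmod (c m j))\<^sup>2)"
    have "(\<Sum>m<n. (norm (\<Sum>j\<in>F. c m j *\<^sub>C A (f j)))\<^sup>2) \<le> Q"
      using x(2)[of v] by (simp add: snd_tensor_sum sum_swap c_def Q_def)
    then have "C\<^sup>2 * (\<Sum>m<n. (norm (\<Sum>j\<in>F. c m j *\<^sub>C A (f j)))\<^sup>2) \<le> C\<^sup>2 * Q"
      by (intro mult_left_mono) auto
    then have "W \<le> 2 * C ^ 4 * R + C\<^sup>2 * Q"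
      using f.perturbed_weights_le_image[OF F R0 rb] by (simp add: W_def)
    also have "\<dots> = 2 * (C ^ 6 * Q) + C\<^sup>2 * Q" by (simp add: R_def power_add[symmetric] mult.assoc[symmetric])
    also have "\<dots> \<le> 3 * (C ^ 6 * Q)"
      using mult_right_mono[OF f.C_power_mono[of 2 6] Q0] by (simp add: mult.commute)
    finally have W: "W \<le> 3 * (C ^ 6 * Q)" .
    define B where "B = {j \<in> F. e.weight (\<pi> j) > 2 * K * f.weight j}"
    have B: "finite B" "B \<subseteq> F" using F by (auto simp: B_def)
    have Bsum: "(\<Sum>j\<in>B. e.weight (\<pi> j)) \<le> 4 * K"
    proof -
      \<comment> \<open>Now \<open>e\<close> is the basis with the large weights, and the inverse of
        \<pi> leads to the partners in \<open>J\<close>.\<close>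
      interpret sw: two_unconditional_bases D A C I e J f by (rule swap)
      have inj: "inj_on \<pi> J" using \<pi> by (auto simp: bij_betw_def)
      have injB: "inj_on \<pi> B" using inj B F by (meson inj_on_subset)
      have inv: "inv_into J \<pi> (\<pi> j) = j" if "j \<in> B" for j
        using inj B F that by (auto intro: inv_into_f_f)
      have "(\<Sum>i\<in>\<pi> ` B. e.weight i) \<le> 4 * sw.K"
        by (rule sw.unmatched_weights_le[where \<pi> = "inv_into J \<pi>"])
          (use B F \<pi>I inv rank in \<open>auto simp: B_def subset_iff\<close>)
      then show ?thesis by (simp add: sum.reindex[OF injB])
    qed
    have "(\<Sum>m<n. \<Sum>j\<in>F. e.weight (\<pi> j) * (cmod (c m j))\<^sup>2)
        = (\<Sum>j\<in>F. e.weight (\<pi> j) * (\<Sum>m<n. (cmod (c m j))\<^sup>2))"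
      by (subst sum.swap) (simp add: sum_distrib_left)
    also have "\<dots> \<le> (\<Sum>j\<in>F. 2 * K * (f.weight j * (\<Sum>m<n. (cmod (c m j))\<^sup>2))
        + (if j \<in> B then e.weight (\<pi> j) * R else 0))"
    proof (intro sum_mono)
      fix j assume j: "j \<in> F"
      define s where "s = (\<Sum>m<n. (cmod (c m j))\<^sup>2)"
      have s: "0 \<le> s" "s \<le> R"
        using row_bounded_column[OF rb F(1) j R0] by (auto simp: s_def sum_nonneg)
      show "e.weight (\<pi> j) * s \<le> 2 * K * (f.weight j * s) + (if j \<in> B then e.weight (\<pi> j) * R else 0)"
      proof (cases "j \<in> B")
        case True
        have "0 \<le> 2 * K * (f.weight j * s)"
          using K_ge_4 f.weight_pos[of j] s by simp
        moreover have "e.weight (\<pi> j) * s \<le> e.weight (\<pi> j) * R"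
          using s e.weight_pos[of "\<pi> j"] by (intro mult_left_mono) auto
        ultimately show ?thesis unfolding if_P[OF True] by linarith
      next
        case False
        then have "e.weight (\<pi> j) \<le> 2 * K * f.weight j" using j by (simp add: B_def)
        then have "e.weight (\<pi> j) * s \<le> 2 * K * f.weight j * s" using s by (intro mult_right_mono)
        then show ?thesis using False by (simp add: mult.assoc)
      qed
    qed
    also have "\<dots> = 2 * K * W + (\<Sum>j\<in>B. e.weight (\<pi> j)) * R"
    proof -
      have "(\<Sum>j\<in>F. if j \<in> B then e.weight (\<pi> j) * R else 0) = (\<Sum>j\<in>B. e.weight (\<pi> j) * R)"
        using B F by (simp add: sum.If_cases Int_absorb1)
      moreover have "(\<Sum>j\<in>F. f.weight j * (\<Sum>m<n. (cmod (c m j))\<^sup>2)) = W"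
        unfolding W_def sum_distrib_left by (rule sum.swap)
      ultimately show ?thesis by (simp add: sum.distrib sum_distrib_left[symmetric] sum_distrib_right)
    qed
    also have "\<dots> \<le> 2 * K * (3 * (C ^ 6 * Q)) + 4 * K * R"
      using W Bsum K_ge_4 R0 by (intro add_mono mult_left_mono mult_right_mono) auto
    also have "\<dots> \<le> 2 * K * (3 * (C ^ 6 * Q)) + 4 * K * (C ^ 6 * Q)"
      using K_ge_4 mult_right_mono[OF f.C_power_mono[of 2 6] Q0] unfolding R_def
      by (intro add_left_mono mult_left_mono) auto
    \<comment> \<open>The two terms add up to ten times \<open>K * (C ^ 6 * Q)\<close>, and
      \<open>K = 4 * C ^ 10\<close>.\<close>
    also have "\<dots> = 40 * (C ^ 16 * Q)" by (simp add: K_def power_add[symmetric])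
    finally have E: "(\<Sum>m<n. \<Sum>j\<in>F. e.weight (\<pi> j) * (cmod (c m j))\<^sup>2) \<le> 40 * (C ^ 16 * Q)" .
    have "(\<Sum>m<n. (norm (\<Sum>k<n. v k *\<^sub>C snd (tensor_sum F a y m k)))\<^sup>2)
        = (\<Sum>m<n. (norm (\<Sum>j\<in>F. c m j *\<^sub>C A (e (\<pi> j))))\<^sup>2)"
      by (simp add: snd_tensor_sum sum_swap c_def)
    also have "\<dots> \<le> C\<^sup>2 * (C\<^sup>2 * R + (\<Sum>m<n. \<Sum>j\<in>F. (norm (A (e (\<pi> j))))\<^sup>2 * (cmod (c m j))\<^sup>2))"
      by (rule ep.image_le_weights[OF F R0 rb])
    also have "\<dots> \<le> C\<^sup>2 * (C\<^sup>2 * R + (\<Sum>m<n. \<Sum>j\<in>F. e.weight (\<pi> j) * (cmod (c m j))\<^sup>2))"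
      by (intro mult_left_mono add_left_mono sum_mono mult_right_mono) (auto simp: e.weight_def)
    also have "\<dots> \<le> C\<^sup>2 * (C\<^sup>2 * R + 40 * (C ^ 16 * Q))"
      using E by (intro mult_left_mono add_left_mono) auto
    also have "\<dots> = C ^ 6 * Q + 40 * (C ^ 18 * Q)"
      by (simp add: R_def algebra_simps power_add[symmetric])
    also have "\<dots> \<le> 49 * C ^ 18 * Q"
      using mult_right_mono[OF f.C_power_mono[of 6 18] Q0] mult_nonneg_nonneg[OF _ Q0, of "C ^ 18"] C0
      by (simp add: mult.commute)
    also have "\<dots> = (7 * C ^ 9 * M)\<^sup>2 * (\<Sum>k<n. (cmod (v k))\<^sup>2)"
      by (simp add: Q_def power_mult_distrib power_mult[symmetric])
    finally show "(\<Sum>m<n. (norm (\<Sum>k<n. v k *\<^sub>C snd (tensor_sum F a y m k)))\<^sup>2)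
        \<le> (7 * C ^ 9 * M)\<^sup>2 * (\<Sum>k<n. (cmod (v k))\<^sup>2)" .
  qed
  then show ?thesis by (simp add: M_def x_def y_def)
qed

text \<open>Pairing indices of equal rank gives the bijection. Its inverse preserves ranks as well,
  so the second inequality is the first one for the exchanged bases.\<close>

theorem equivalent_up_to_permutation_bases:
  "equivalent_up_to_permutation (49 * C ^ 18) J (\<lambda>j. (f j, A (f j))) I (\<lambda>i. (e i, A (e i)))"
proof -
  interpret sw: two_unconditional_bases D A C I e J f by (rule swap)
  define \<pi> where "\<pi> = inv_into I e.rank \<circ> f.rank"
  have "bij_betw f.rank J (e.rank ` I)"
    using f.inj_on_rank by (simp add: bij_betw_def rank_images_eq)
  moreover have "bij_betw (inv_into I e.rank) (e.rank ` I) I"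
    by (rule bij_betw_inv_into) (simp add: bij_betw_def e.inj_on_rank)
  ultimately have \<pi>: "bij_betw \<pi> J I" unfolding \<pi>_def by (rule bij_betw_trans)
  have rank: "f.rank j = e.rank (\<pi> j)" if "j \<in> J" for j
  proof -
    have "f.rank j \<in> e.rank ` I" using rank_images_eq that by blast
    then show ?thesis by (simp add: \<pi>_def f_inv_into_f)
  qed
  define \<rho> where "\<rho> = inv_into J \<pi>"
  have \<rho>: "bij_betw \<rho> I J" unfolding \<rho>_def using \<pi> by (rule bij_betw_inv_into)
  have \<pi>\<rho>: "\<pi> (\<rho> i) = i" if "i \<in> I" for i
    using that \<pi> by (simp add: \<rho>_def bij_betw_inv_into_right)
  have \<rho>\<pi>: "\<rho> (\<pi> j) = j" if "j \<in> J" for j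
    using that \<pi> by (simp add: \<rho>_def bij_betw_inv_into_left)
  have rank': "e.rank i = f.rank (\<rho> i)" if "i \<in> I" for i
    using rank[of "\<rho> i"] \<pi>\<rho>[OF that] \<rho> that by (auto simp: bij_betw_def)
  have "equivalent (7 * C ^ 9 * (7 * C ^ 9)) J (\<lambda>j. (f j, A (f j))) (\<lambda>j. (e (\<pi> j), A (e (\<pi> j))))"
  proof (rule equivalent_if_tensor_bounds)
    show "0 \<le> 7 * C ^ 9" "0 \<le> 7 * C ^ 9" using f.C_ge_1 by auto
    fix n F a assume F: "finite F" "F \<subseteq> J"
    show "rc_norm n (tensor_sum F a (\<lambda>j. (e (\<pi> j), A (e (\<pi> j)))))
        \<le> 7 * C ^ 9 * rc_norm n (tensor_sum F a (\<lambda>j. (f j, A (f j))))"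
      by (rule tensor_norm_le[OF \<pi> rank F])
    have inj: "inj_on \<pi> F" using \<pi> F by (auto simp: bij_betw_def intro: inj_on_subset)
    have \<pi>F: "finite (\<pi> ` F)" "\<pi> ` F \<subseteq> I" using F \<pi> by (auto simp: bij_betw_def)
    define b where "b = (\<lambda>i. a (inv_into F \<pi> i))"
    \<comment> \<open>The exchanged estimate concerns finite subsets of \<open>I\<close>, so both
      tensors are reindexed along \<pi>.\<close>
    have "tensor_sum F a (\<lambda>j. (f j, A (f j))) = tensor_sum F a (\<lambda>j. (f (\<rho> (\<pi> j)), A (f (\<rho> (\<pi> j)))))"
      unfolding tensor_sum_def using F \<rho>\<pi> by (intro ext sum.cong) auto
    also have "\<dots> = tensor_sum (\<pi> ` F) b (\<lambda>i. (f (\<rho> i), A (f (\<rho> i))))"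
      unfolding b_def by (rule tensor_sum_reindex[OF inj, where x = "\<lambda>i. (f (\<rho> i), A (f (\<rho> i)))"])
    finally have "rc_norm n (tensor_sum F a (\<lambda>j. (f j, A (f j))))
        \<le> 7 * C ^ 9 * rc_norm n (tensor_sum (\<pi> ` F) b (\<lambda>i. (e i, A (e i))))"
      using sw.tensor_norm_le[OF \<rho> rank' \<pi>F, of n b] by simp
    also have "tensor_sum (\<pi> ` F) b (\<lambda>i. (e i, A (e i))) = tensor_sum F a (\<lambda>j. (e (\<pi> j), A (e (\<pi> j))))"
      unfolding b_def by (rule tensor_sum_reindex[OF inj, where x = "\<lambda>i. (e i, A (e i))", symmetric])
    finally show "rc_norm n (tensor_sum F a (\<lambda>j. (f j, A (f j))))
        \<le> 7 * C ^ 9 * rc_norm n (tensor_sum F a (\<lambda>j. (e (\<pi> j), A (e (\<pi> j)))))" .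
  qed
  then show ?thesis
    unfolding equivalent_up_to_permutation_def using \<pi>
    by (intro exI[of _ \<pi>]) (simp add: power_add[symmetric])
qed

end

section \<open>Subspaces of X(A), their canonical bases and the conclusion\<close>

lemma closed_csubspace_X_space:
  assumes D: "closed_csubspace D" and A: "compact_contraction_on D A"
  shows "closed_csubspace (X_space D A)"
proof -
  have sub: "cvec.subspace D" and cl: "closed D" and lin: "clinear_on D A"
    and con: "\<And>x. x \<in> D \<Longrightarrow> norm (A x) \<le> norm x"
    using D A by (auto simp: closed_csubspace_def compact_contraction_on_def)
  have "cvec.subspace (X_space D A)"
  proof (rule cvec.subspaceI)
    show "0 \<in> X_space D A"
      using cvec.subspace_0[OF sub] clinear_on_0[OF sub lin] by (auto simp: X_space_def zero_prod_def)
    show "p + q \<in> X_space D A" if "p \<in> X_space D A" "q \<in> X_space D A" for p q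
      using that cvec.subspace_add[OF sub] by (auto simp: X_space_def clinear_on_add[OF sub lin])
    show "c *\<^sub>C p \<in> X_space D A" if "p \<in> X_space D A" for c p
      using that cvec.subspace_scale[OF sub]
      by (auto simp: X_space_def clinear_on_scale[OF sub lin] scaleC_prod_def)
  qed
  moreover have "closed (X_space D A)"
    unfolding closed_sequential_limits
  proof (intro allI impI)
    fix p l assume pl: "(\<forall>n. p n \<in> X_space D A) \<and> p \<longlonglongrightarrow> l"
    have p: "fst (p n) \<in> D" "snd (p n) = A (fst (p n))" for n
      using pl by (auto simp: X_space_def dest!: spec[of _ n])
    have lim: "(\<lambda>n. fst (p n)) \<longlonglongrightarrow> fst l" "(\<lambda>n. snd (p n)) \<longlonglongrightarrow> snd l"
      using pl by (auto intro: tendsto_fst tendsto_snd)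
    have l: "fst l \<in> D" using closed_sequentially[OF cl _ lim(1)] p by blast
    have "(\<lambda>n. A (fst (p n))) \<longlonglongrightarrow> A (fst l)"
      by (rule bounded_clinear_tendsto[OF sub lin, where M = 1]) (use con p l lim in auto)
    then have "snd l = A (fst l)" using lim(2) LIMSEQ_unique unfolding p by blast
    then show "l \<in> X_space D A" using l by (auto simp: X_space_def prod_eq_iff)
  qed
  ultimately show ?thesis by (simp add: closed_csubspace_def)
qed

text \<open>On the graph of a contraction the first component dominates the second, so
  \<open>fst\<close> is bounded below there.\<close>

lemma fst_closed_cspan_X_space:
  assumes A: "compact_contraction_on D A" and D: "closed_csubspace D" and S: "S \<subseteq> X_space D A"
  shows "fst ` closed_cspan S = closed_cspan (fst ` S)"
proof (rule image_closed_cspan[OF bounded_linear_fst, where e = "1 / 2"])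
  fix p assume "p \<in> closed_cspan S"
  then have "p \<in> X_space D A"
    using closed_cspan_minimal[OF S closed_csubspace_X_space[OF D A]] by blast
  then have "norm (snd p) \<le> norm (fst p)"
    using A by (auto simp: X_space_def compact_contraction_on_def)
  then show "1 / 2 * norm p \<le> norm (fst p)"
    using norm_le_max_components[of p] by (simp add: max_def split: if_splits)
qed auto

lemma fst_X_space: "fst ` X_space D A = D"
  by (force simp: X_space_def)

text \<open>A point of the graph is determined by its first component, so totality can be tested in
  \<open>D\<close>.\<close>

lemma closed_cspan_X_space_eqI:
  assumes D: "closed_csubspace D" and A: "compact_contraction_on D A"
    and S: "S \<subseteq> X_space D A" and span: "closed_cspan (fst ` S) = D"
  shows "closed_cspan S = X_space D A"
proof
  show *: "closed_cspan S \<subseteq> X_space D A"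
    by (rule closed_cspan_minimal[OF S closed_csubspace_X_space[OF D A]])
  show "X_space D A \<subseteq> closed_cspan S"
  proof
    fix p assume p: "p \<in> X_space D A"
    then have "fst p \<in> fst ` closed_cspan S"
      unfolding fst_closed_cspan_X_space[OF A D S] span by (auto simp: X_space_def)
    then obtain q where q: "q \<in> closed_cspan S" "fst q = fst p" by force
    then have "q = p" using p * by (auto simp: X_space_def)
    then show "p \<in> closed_cspan S" using q by simp
  qed
qed

lemma canonical_system_in_domain:
  fixes I :: "nat set"
  assumes "closed_csubspace D" "compact_contraction_on D A" "is_canonical_system D A I \<xi>" "i \<in> I"
  shows "\<xi> i \<in> D"
  using canonical_system_span[OF assms(1-3)] closed_cspan_base[of "\<xi> i" "\<xi> ` I"] assms(4) by blast

text \<open>The vectors \<open>\<xi> i\<close> are orthogonal, and so are their images under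
  \<open>A\<close>. The squared norms that define the row and the column norm are therefore sums of
  squared moduli of coefficients with fixed nonnegative factors, and multiplication by the
  \<open>t i\<close> cannot increase them.\<close>

lemma cu_basis_canonical:
  fixes I :: "nat set"
  assumes D: "closed_csubspace D" and A: "compact_contraction_on D A"
    and can: "is_canonical_system D A I \<xi>"
  shows "cu_basis 1 I (\<lambda>i. (\<xi> i, A (\<xi> i))) (X_space D A)"
proof -
  define y where "y = (\<lambda>i. (\<xi> i, A (\<xi> i)))"
  note on = canonical_system_orthonormal[OF D A can]
  have "closed_cspan (y ` I) = X_space D A"
  proof (rule closed_cspan_X_space_eqI[OF D A])
    show "y ` I \<subseteq> X_space D A"
      using canonical_system_in_domain[OF D A can] by (auto simp: y_def X_space_def)
    show "closed_cspan (fst ` y ` I) = D"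
      using canonical_system_span[OF D A can] by (simp add: y_def image_image)
  qed
  moreover have "rc_norm n (tensor_sum F (\<lambda>i k l. t i * a i k l) y) \<le> rc_norm n (tensor_sum F a y)"
    if F: "finite F" "F \<subseteq> I" and t: "\<forall>i\<in>F. cmod (t i) \<le> 1" for n F a t
  proof -
    define M where "M = rc_norm n (tensor_sum F a y)"
    have M0: "M \<ge> 0" by (simp add: M_def rc_norm_nonneg)
    have le: "(norm (\<Sum>k<n. v k *\<^sub>C (\<Sum>j\<in>F. (t j * b j k) *\<^sub>C h j)))\<^sup>2
        \<le> (norm (\<Sum>k<n. v k *\<^sub>C (\<Sum>j\<in>F. b j k *\<^sub>C h j)))\<^sup>2"
      if orth: "\<And>i j. i \<in> F \<Longrightarrow> j \<in> F \<Longrightarrow> i \<noteq> j \<Longrightarrow> cinner (h i) (h j) = 0"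
      for v :: "nat \<Rightarrow> complex" and b :: "nat \<Rightarrow> nat \<Rightarrow> complex" and h :: "nat \<Rightarrow> ell2"
    proof -
      have "(\<Sum>k<n. v k * (t j * b j k)) = t j * (\<Sum>k<n. v k * b j k)" for j
        by (simp add: sum_distrib_left mult.left_commute)
      moreover have "(norm (\<Sum>j\<in>F. c j *\<^sub>C h j))\<^sup>2 = (\<Sum>j\<in>F. (cmod (c j))\<^sup>2 * (norm (h j))\<^sup>2)" for c
        by (rule norm_sum_orthogonal[OF F(1) orth])
      ultimately show ?thesis
        unfolding sum_scaleC_swap using t
        by simp (intro sum_mono mult_right_mono power_mono,
            auto simp: norm_mult intro: mult_left_le_one_le)
    qed
    have orth: "cinner (\<xi> i) (\<xi> j) = 0" "cinner (A (\<xi> i)) (A (\<xi> j)) = 0"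
      if "i \<in> F" "j \<in> F" "i \<noteq> j" for i j
      using that F(2) on canonical_system_image_orthogonal[OF D A can, of i j]
      by (auto simp: orthonormal_def subset_iff)
    have "(\<Sum>m<n. (norm (\<Sum>k<n. v k *\<^sub>C fst (tensor_sum F a y k m)))\<^sup>2) \<le> M\<^sup>2 * (\<Sum>k<n. (cmod (v k))\<^sup>2)"
      "(\<Sum>m<n. (norm (\<Sum>k<n. v k *\<^sub>C snd (tensor_sum F a y m k)))\<^sup>2) \<le> M\<^sup>2 * (\<Sum>k<n. (cmod (v k))\<^sup>2)" for v
      unfolding M_def by (rule rc_norm_row_bound rc_norm_column_bound)+
    moreover have "(\<Sum>m<n. (norm (\<Sum>k<n. v k *\<^sub>C fst (tensor_sum F (\<lambda>i k l. t i * a i k l) y k m)))\<^sup>2)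
        \<le> (\<Sum>m<n. (norm (\<Sum>k<n. v k *\<^sub>C fst (tensor_sum F a y k m)))\<^sup>2)" for v
      unfolding fst_tensor_sum y_def fst_conv by (intro sum_mono le orth)
    moreover have "(\<Sum>m<n. (norm (\<Sum>k<n. v k *\<^sub>C snd (tensor_sum F (\<lambda>i k l. t i * a i k l) y m k)))\<^sup>2)
        \<le> (\<Sum>m<n. (norm (\<Sum>k<n. v k *\<^sub>C snd (tensor_sum F a y m k)))\<^sup>2)" for v
      unfolding snd_tensor_sum y_def snd_conv by (intro sum_mono le orth)
    ultimately have "rc_norm n (tensor_sum F (\<lambda>i k l. t i * a i k l) y) \<le> M"
      unfolding rc_norm_le_iff_squares[OF M0] by (meson order_trans)
    then show ?thesis by (simp add: M_def)
  qed
  ultimately show ?thesis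
    unfolding cu_basis_def cu_basic_sequence_def y_def by simp
qed

text \<open>The two bases share one constant in \<open>two_unconditional_bases\<close>, so the
  constant 1 of the canonical basis is weakened to \<open>C\<close>.\<close>

lemma unconditional_basis_canonical:
  fixes I :: "nat set"
  assumes D: "closed_csubspace D" and A: "compact_contraction_on D A"
    and can: "is_canonical_system D A I \<xi>" and C: "C \<ge> 1"
  shows "unconditional_basis D A C I \<xi>"
proof
  show "cu_basic_sequence C I (\<lambda>j. (\<xi> j, A (\<xi> j)))"
    using cu_basis_canonical[OF D A can] C unfolding cu_basis_def by (blast intro: cu_basic_sequence_mono)
  show "norm (\<xi> j) = 1" if "j \<in> I" for j
    by (rule orthonormal_norm[OF canonical_system_orthonormal[OF D A can] that])
qed (use D A canonical_system_span[OF D A can] canonical_system_in_domain[OF D A can] in auto)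

text \<open>This passes from bases of the graph to their first components. Normalization becomes
  \<open>norm (fst (x j)) = 1\<close> because the first component dominates the second.\<close>

lemma unconditional_basis_if_cu_basis:
  fixes J :: "nat set"
  assumes D: "closed_csubspace D" and A: "compact_contraction_on D A"
    and x: "cu_basis C J x (X_space D A)" "normalized J x"
  shows "unconditional_basis D A C J (\<lambda>j. fst (x j))"
    and "j \<in> J \<Longrightarrow> x j = (fst (x j), A (fst (x j)))"
proof -
  have xY: "x j \<in> X_space D A" if "j \<in> J" for j
    using x(1) that closed_cspan_base[of "x j" "x ` J"] by (auto simp: cu_basis_def)
  then have x_eq: "x j = (fst (x j), A (fst (x j)))" and xD: "fst (x j) \<in> D" if "j \<in> J" for j
    using that by (auto simp: X_space_def prod_eq_iff dest!: xY)
  show "x j = (fst (x j), A (fst (x j)))" if "j \<in> J" by (rule x_eq[OF that])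
  show "unconditional_basis D A C J (\<lambda>j. fst (x j))"
  proof
    show "norm (fst (x j)) = 1" if j: "j \<in> J" for j
    proof -
      have "max (norm (fst (x j))) (norm (snd (x j))) = 1"
        using x(2) j rc_norm_single[of "x j"] by (simp add: normalized_def)
      moreover have "norm (snd (x j)) \<le> norm (fst (x j))"
        using A xD[OF j] arg_cong[OF x_eq[OF j], of snd] by (simp add: compact_contraction_on_def)
      ultimately show ?thesis by simp
    qed
    have "closed_cspan (fst ` x ` J) = fst ` X_space D A"
      using fst_closed_cspan_X_space[OF A D, of "x ` J"] x(1) xY by (auto simp: cu_basis_def)
    then show "closed_cspan ((\<lambda>j. fst (x j)) ` J) = D" by (simp add: fst_X_space image_image)
    have "tensor_sum F a (\<lambda>j. (fst (x j), A (fst (x j)))) = tensor_sum F a x" if "F \<subseteq> J" for F a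
      unfolding tensor_sum_def using x_eq that by (intro ext sum.cong) auto
    then show "cu_basic_sequence C J (\<lambda>j. (fst (x j), A (fst (x j))))"
      using x(1) unfolding cu_basis_def cu_basic_sequence_def by simp
  qed (use D A xD in auto)
qed

text \<open>Continuity of \<open>A\<close> makes the first projection of a closed subspace of the
  graph closed.\<close>

lemma closed_subspace_of_X_space:
  assumes Y: "closed_csubspace Y" "Y \<subseteq> X_space UNIV A" and A: "compact_contraction_on UNIV A"
  obtains D where "closed_csubspace D" "compact_contraction_on D A" "Y = X_space D A"
proof
  define D where "D = fst ` Y"
  have lin: "clinear_on UNIV A" and con: "\<And>x. norm (A x) \<le> norm x"
    using A by (auto simp: compact_contraction_on_def)
  have sub: "cvec.subspace Y" and cl: "closed Y" using Y by (auto simp: closed_csubspace_def)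
  have graph: "x \<in> D \<longleftrightarrow> (x, A x) \<in> Y" for x
    using Y(2) by (force simp: D_def X_space_def)
  have "cvec.subspace D"
  proof (rule cvec.subspaceI)
    show "0 \<in> D" using cvec.subspace_0[OF sub] unfolding D_def by force
    show "x + y \<in> D" if "x \<in> D" "y \<in> D" for x y
      using cvec.subspace_add[OF sub] that unfolding D_def by force
    show "c *\<^sub>C x \<in> D" if x: "x \<in> D" for c x
    proof -
      obtain p where "p \<in> Y" "x = fst p" using x by (auto simp: D_def)
      then show ?thesis
        using imageI[OF cvec.subspace_scale[OF sub, of p c], of fst] by (simp add: D_def)
    qed
  qed
  moreover have "closed D"
    unfolding closed_sequential_limits
  proof (intro allI impI)
    fix x l assume xl: "(\<forall>n. x n \<in> D) \<and> x \<longlonglongrightarrow> l"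
    have "(\<lambda>n. A (x n)) \<longlonglongrightarrow> A l"
      by (rule bounded_clinear_tendsto[OF cvec.subspace_UNIV lin, where M = 1]) (use con xl in auto)
    then have "(\<lambda>n. (x n, A (x n))) \<longlonglongrightarrow> (l, A l)" using xl by (intro tendsto_Pair) auto
    then have "(l, A l) \<in> Y" using closed_sequentially[OF cl, of "\<lambda>n. (x n, A (x n))"] xl graph by blast
    then show "l \<in> D" using graph by blast
  qed
  ultimately show "closed_csubspace D" by (simp add: closed_csubspace_def)
  show "compact_contraction_on D A" by (rule compact_contraction_on_subset[OF A]) simp
  show "Y = X_space D A"
    using Y(2) graph by (auto simp: X_space_def)
qed

theorem theorem1p2:
  shows "(\<forall>X\<in>family_F. \<forall>Y. closed_csubspace Y \<and> Y \<subseteq> X \<longrightarrow>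
            (\<exists>(I :: nat set) e. is_canonical_basis Y I e) \<and>
            (\<forall>(I :: nat set) e. is_canonical_basis Y I e \<longrightarrow> cu_basis 1 I e Y)) \<and>
         (\<exists>\<phi> :: real poly.
            \<forall>X\<in>family_F. \<forall>Y. closed_csubspace Y \<and> Y \<subseteq> X \<longrightarrow>
              (\<forall>C (J :: nat set) x (I :: nat set) e.
                 cu_basis C J x Y \<and> normalized J x \<and> is_canonical_basis Y I e \<longrightarrow>
                 equivalent_up_to_permutation (poly \<phi> C) J x I e))"
proof (intro conjI ballI allI impI)
  fix X Y assume X: "X \<in> family_F" and Y: "closed_csubspace Y \<and> Y \<subseteq> X"
  then obtain A where A: "X = X_space UNIV A" "compact_contraction_on UNIV A"
    by (auto simp: family_F_def)
  obtain D where D: "closed_csubspace D" "compact_contraction_on D A" "Y = X_space D A"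
    using closed_subspace_of_X_space[of Y A] Y A by blast
  obtain I :: "nat set" and \<xi> where "is_canonical_system D A I \<xi>"
    using canonical_system_exists[OF D(1,2)] by blast
  then have "is_canonical_basis Y I (\<lambda>i. (\<xi> i, A (\<xi> i)))"
    unfolding is_canonical_basis_def using D by blast
  then show "\<exists>(I :: nat set) e. is_canonical_basis Y I e" by blast
next
  have eq: "F \<subseteq> I \<Longrightarrow> tensor_sum F a e = tensor_sum F a e'" if "\<And>i. i \<in> I \<Longrightarrow> e i = e' i"
    for I F :: "nat set" and a and e e' :: "nat \<Rightarrow> ell2 \<times> ell2"
    unfolding tensor_sum_def using that by (intro ext sum.cong) auto
  fix Y and I :: "nat set" and e assume "is_canonical_basis Y I e"
  then obtain D A \<xi> where D: "closed_csubspace D" "compact_contraction_on D A" "Y = X_space D A"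
    "is_canonical_system D A I \<xi>" "\<And>i. i \<in> I \<Longrightarrow> e i = (\<xi> i, A (\<xi> i))"
    unfolding is_canonical_basis_def by blast
  have "e ` I = (\<lambda>i. (\<xi> i, A (\<xi> i))) ` I" using D(5) by auto
  then show "cu_basis 1 I e Y"
    using cu_basis_canonical[OF D(1,2,4)] eq[of I e "\<lambda>i. (\<xi> i, A (\<xi> i))"] D(3,5)
    unfolding cu_basis_def cu_basic_sequence_def by simp
next
  \<comment> \<open>Neither the coefficient nor the exponent depends on the space or the bases, so
    one polynomial serves them all.\<close>
  have "equivalent_up_to_permutation (poly (monom 49 18) C) J x I e"
    if basis: "cu_basis C J x Y" "normalized J x" and can: "is_canonical_basis Y I e"
    for C x Y e and I J :: "nat set"
  proof -
    \<comment> \<open>\<open>D\<close> and \<open>A\<close> come from the canonical basis; since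
      \<open>Y\<close> is their graph, the basis \<open>x\<close> is analysed over the same
      representation.\<close>
    obtain D A \<xi> where D: "closed_csubspace D" "compact_contraction_on D A" "Y = X_space D A"
      "is_canonical_system D A I \<xi>" and e: "\<And>i. i \<in> I \<Longrightarrow> e i = (\<xi> i, A (\<xi> i))"
      using can unfolding is_canonical_basis_def by blast
    have C: "C \<ge> 1" using basis(1) by (simp add: cu_basis_def cu_basic_sequence_def)
    note x = unconditional_basis_if_cu_basis[OF D(1,2) basis(1)[unfolded D(3)] basis(2)]
    interpret two_unconditional_bases D A C J "\<lambda>j. fst (x j)" I \<xi>
      by (rule two_unconditional_bases.intro[OF x(1) unconditional_basis_canonical[OF D(1,2,4) C]])
    obtain \<pi> where \<pi>: "bij_betw \<pi> J I"
      "equivalent (49 * C ^ 18) J (\<lambda>j. (fst (x j), A (fst (x j)))) (\<lambda>j. (\<xi> (\<pi> j), A (\<xi> (\<pi> j))))"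
      using equivalent_up_to_permutation_bases unfolding equivalent_up_to_permutation_def by blast
    have "(\<lambda>j. (fst (x j), A (fst (x j)))) ` J = x ` J" using x(2) by (intro image_cong) auto
    moreover have e\<pi>: "(\<xi> (\<pi> j), A (\<xi> (\<pi> j))) = e (\<pi> j)" if "j \<in> J" for j
      using e \<pi>(1) that by (auto simp: bij_betw_def)
    then have "(\<lambda>j. (\<xi> (\<pi> j), A (\<xi> (\<pi> j)))) ` J = (\<lambda>j. e (\<pi> j)) ` J" by (intro image_cong) auto
    ultimately have "equivalent (49 * C ^ 18) J x (\<lambda>j. e (\<pi> j))"
      using \<pi>(2) x(2) e\<pi> unfolding equivalent_def Let_def by auto
    then show ?thesis
      unfolding equivalent_up_to_permutation_def using \<pi>(1) by (auto simp: poly_monom)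
  qed
  then show "\<exists>\<phi> :: real poly.
            \<forall>X\<in>family_F. \<forall>Y. closed_csubspace Y \<and> Y \<subseteq> X \<longrightarrow>
              (\<forall>C (J :: nat set) x (I :: nat set) e.
                 cu_basis C J x Y \<and> normalized J x \<and> is_canonical_basis Y I e \<longrightarrow>
                 equivalent_up_to_permutation (poly \<phi> C) J x I e)"
    by blast
qed

end
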